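(* Let $(\xi_k^x)_{k\ge1}$ and $(\xi_k^y)_{k\ge1}$ be independent sequences of i.i.d. non-negative integer-valued random variables. Assume that $t\mapsto P(\xi_1^x>t)$ and $t\mapsto P(\xi_1^y>t)$ are regularly varying functions with tail indices $\alpha_x$ and $\alpha_y$ respectively, where $0<\alpha_x,\alpha_y<1$. Then for all $\varepsilon\in(0,1-p_c]$, $$\mathbb{P}^{\Xi}_{p_c+\varepsilon,\,p_c}(o\longleftrightarrow\infty)=0\quad\text{for }\mu_\xi\text{-almost every }\Xi.$$
   Context: A function $H:(0,\infty)\to(0,\infty)$ is regularly varying with tail index $\alpha>0$ if $\lim_{t\to\infty}H(xt)/H(t)=x^{-\alpha}$ for every $x>0$. $\mathbb{Z}_+=\{0,1,2,\dots\}$, and $\mathbb{L}^2_+$ is the nearest-neighbour square lattice restricted to the first quadrant, with vertex set $\mathbb{Z}_+^2$ and origin $o=(0,0)$. Random environment: the spacings define the selected columns $\mathcal{C}=\{0\}\cup\{\sum_{k=1}^m\xi_k^x: m\ge1\}$, the selected rows $\mathcal{R}=\{0\}\cup\{\sum_{k=1}^m\xi_k^y: m\ge1\}$, and the environment $\Xi=\mathcal{C}\times\mathcal{R}\subset\mathbb{Z}_+^2$. $\mu_\xi$ denotes the law of the environment, i.e. the product of the law of $\mathcal{C}$ and the law of $\mathcal{R}$. Percolation: for fixed $\Xi$ and $p,q\in[0,1]$, $\mathbb{P}^{\Xi}_{p,q}$ is the product measure on $\{0,1\}^{\mathbb{Z}_+^2}$ under which the $\omega(v)$, $v\in\mathbb{Z}_+^2$,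 are independent, with $\omega(v)=1$ ($v$ open) with probability $p$ if $v\in\Xi$ and with probability $q$ if $v\notin\Xi$. A path (sequence of distinct successively adjacent vertices) is open if all its vertices are open. $\{o\longleftrightarrow\infty\}$ is the event that there is an unbounded sequence of vertices of $\mathbb{Z}_+^2$ each connected to $o$ by an open path. $p_c$ is the critical threshold of homogeneous Bernoulli site percolation on $\mathbb{L}^2_+$. *)

theory Defs
  imports "HOL-Probability.Probability"
begin

definition regularly_varying :: "(real \<Rightarrow> real) \<Rightarrow> real \<Rightarrow> bool" where
  "regularly_varying H \<alpha> \<longleftrightarrow>
     \<alpha> > 0 \<and> (\<forall>t>0. H t > 0) \<and>
     (\<forall>x>0. ((\<lambda>t. H (x * t) / H t) \<longlongrightarrow> x powr (- \<alpha>)) at_top)"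

text \<open>Sequences of spacings are indexed by \<open>k \<ge> 1\<close>; the value at index 0 is irrelevant.\<close>

definition (in prob_space) iid_seq :: "(nat \<Rightarrow> 'a \<Rightarrow> nat) \<Rightarrow> bool" where
  "iid_seq X \<longleftrightarrow>
     indep_vars (\<lambda>_. count_space UNIV) X {1..} \<and>
     (\<forall>k\<ge>1. distr M (count_space UNIV) (X k) = distr M (count_space UNIV) (X 1))"

definition (in prob_space) indep_seqs ::
  "(nat \<Rightarrow> 'a \<Rightarrow> nat) \<Rightarrow> (nat \<Rightarrow> 'a \<Rightarrow> nat) \<Rightarrow> bool" where
  "indep_seqs X Y \<longleftrightarrow>
     indep_var (PiM {1..} (\<lambda>_. count_space UNIV)) (\<lambda>\<omega>. \<lambda>k\<in>{1..}. X k \<omega>)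
               (PiM {1..} (\<lambda>_. count_space UNIV)) (\<lambda>\<omega>. \<lambda>k\<in>{1..}. Y k \<omega>)"

subsection \<open>Environment\<close>

definition selected :: "(nat \<Rightarrow> nat) \<Rightarrow> nat set" where
  "selected s = {0} \<union> {\<Sum>k=1..m. s k | m. m \<ge> 1}"

text \<open>The cylinder sigma-algebra on subsets of a type, i.e. the product sigma-algebra
  when subsets are identified with their indicator functions.\<close>

definition set_algebra :: "'b set measure" where
  "set_algebra = sigma UNIV (range (\<lambda>v. {A. v \<in> A}))"

definition selected_law :: "'a measure \<Rightarrow> (nat \<Rightarrow> 'a \<Rightarrow> nat) \<Rightarrow> nat set measure" where
  "selected_law M X = distr M set_algebra (\<lambda>\<omega>. selected (\<lambda>k. X k \<omega>))"

definition env_law ::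
  "'a measure \<Rightarrow> (nat \<Rightarrow> 'a \<Rightarrow> nat) \<Rightarrow> (nat \<Rightarrow> 'a \<Rightarrow> nat) \<Rightarrow> (nat \<times> nat) set measure" where
  "env_law M X Y =
     distr (selected_law M X \<Otimes>\<^sub>M selected_law M Y) set_algebra (\<lambda>(C, R). C \<times> R)"

subsection \<open>Site percolation on the first quadrant\<close>

definition percolation :: "(nat \<times> nat) set \<Rightarrow> real \<Rightarrow> real \<Rightarrow> (nat \<times> nat \<Rightarrow> bool) measure" where
  "percolation \<Xi> p q = PiM UNIV (\<lambda>v. measure_pmf (bernoulli_pmf (if v \<in> \<Xi> then p else q)))"

definition adjacent :: "nat \<times> nat \<Rightarrow> nat \<times> nat \<Rightarrow> bool" where
  "adjacent u v \<longleftrightarrow>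
     \<bar>int (fst u) - int (fst v)\<bar> + \<bar>int (snd u) - int (snd v)\<bar> = 1"

definition is_path :: "(nat \<times> nat) list \<Rightarrow> bool" where
  "is_path vs \<longleftrightarrow> vs \<noteq> [] \<and> distinct vs \<and> successively adjacent vs"

definition connected_by_open :: "(nat \<times> nat \<Rightarrow> bool) \<Rightarrow> nat \<times> nat \<Rightarrow> nat \<times> nat \<Rightarrow> bool" where
  "connected_by_open \<omega> u v \<longleftrightarrow>
     (\<exists>vs. is_path vs \<and> hd vs = u \<and> last vs = v \<and> (\<forall>w\<in>set vs. \<omega> w))"

definition percolates :: "(nat \<times> nat \<Rightarrow> bool) set" where
  "percolates =
     {\<omega>. \<exists>s :: nat \<Rightarrow> nat \<times> nat. (\<forall>N. \<exists>n. N < fst (s n) + snd (s n)) \<and>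
                              (\<forall>n. connected_by_open \<omega> (0, 0) (s n))}"

text \<open>In the homogeneous model every site has the same parameter, so the choice of the
  environment is immaterial.\<close>

definition p_c :: real where
  "p_c = Sup {p \<in> {0..1}. measure (percolation UNIV p p) percolates = 0}"

subsection \<open>Well-definedness: measurability\<close>

lemma space_set_algebra [simp]: "space set_algebra = UNIV"
  by (simp add: set_algebra_def)

lemma measurable_set_algebraI:
  assumes "\<And>v. {x \<in> space N. v \<in> f x} \<in> sets N"
  shows "f \<in> measurable N set_algebra"
  unfolding set_algebra_def using assms
  by (intro measurable_sigma_sets[OF sets_measure_of]) (auto simp: vimage_def Int_def conj_commute)

lemma mem_set_algebra: "{A. v \<in> A} \<in> sets set_algebra"
  by (auto simp: set_algebra_def)

lemma measurable_selected:
  assumes "\<And>k. k \<ge> 1 \<Longrightarrow> X k \<in> measurable M (count_space UNIV)"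
  shows "(\<lambda>\<omega>. selected (\<lambda>k. X k \<omega>)) \<in> measurable M set_algebra"
proof (rule measurable_set_algebraI)
  fix v
  have [measurable]: "(\<lambda>\<omega>. \<Sum>k=1..m. X k \<omega>) \<in> measurable M (count_space UNIV)" for m
    using assms by (intro measurable_sum_nat) auto
  have "{\<omega> \<in> space M. v \<in> selected (\<lambda>k. X k \<omega>)} =
      {\<omega> \<in> space M. v = 0 \<or> (\<exists>m. m \<ge> 1 \<and> v = (\<Sum>k=1..m. X k \<omega>))}"
    by (auto simp: selected_def)
  also have "\<dots> \<in> sets M" by measurable
  finally show "{\<omega> \<in> space M. v \<in> selected (\<lambda>k. X k \<omega>)} \<in> sets M" .
qed

lemma (in prob_space) prob_space_selected_law:
  assumes "iid_seq X"
  shows "prob_space (selected_law M X)"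
  unfolding selected_law_def
  using assms by (intro prob_space_distr measurable_selected) (auto simp: iid_seq_def indep_vars_def)

lemma (in prob_space) prob_space_env_law:
  assumes "iid_seq X" "iid_seq Y"
  shows "prob_space (env_law M X Y)"
proof -
  interpret X: prob_space "selected_law M X" by (rule prob_space_selected_law) fact
  interpret Y: prob_space "selected_law M Y" by (rule prob_space_selected_law) fact
  interpret XY: pair_prob_space "selected_law M X" "selected_law M Y" ..
  have s: "sets (selected_law M Z) = sets set_algebra" for Z :: "nat \<Rightarrow> 'a \<Rightarrow> nat"
    by (simp add: selected_law_def)
  have "(\<lambda>(C, R). C \<times> R) \<in>
      measurable (set_algebra \<Otimes>\<^sub>M set_algebra) (set_algebra :: (nat \<times> nat) set measure)"
  proof (rule measurable_set_algebraI)
    fix v :: "nat \<times> nat"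
    have "{x \<in> space (set_algebra \<Otimes>\<^sub>M set_algebra). v \<in> (case x of (C, R) \<Rightarrow> C \<times> R)} =
        {A. fst v \<in> A} \<times> {A. snd v \<in> A}"
      by (auto simp: space_pair_measure mem_Times_iff)
    then show "{x \<in> space (set_algebra \<Otimes>\<^sub>M set_algebra). v \<in> (case x of (C, R) \<Rightarrow> C \<times> R)}
        \<in> sets (set_algebra \<Otimes>\<^sub>M set_algebra)"
      by (simp add: mem_set_algebra)
  qed
  then show ?thesis
    unfolding env_law_def
    by (intro XY.prob_space_distr) (simp add: s cong: measurable_cong_sets sets_pair_measure_cong)
qed

lemma prob_space_percolation: "prob_space (percolation \<Xi> p q)"
  unfolding percolation_def by (intro prob_space_PiM prob_space_measure_pmf)

lemma percolates_alt:
  "percolates = {\<omega>. \<forall>N. \<exists>v. N < fst v + snd v \<and> connected_by_open \<omega> (0, 0) v}"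
  unfolding percolates_def
proof (intro Collect_cong iffI allI)
  fix \<omega>
  assume "\<forall>N. \<exists>v. N < fst v + snd v \<and> connected_by_open \<omega> (0, 0) v"
  then show "\<exists>s :: nat \<Rightarrow> nat \<times> nat. (\<forall>N. \<exists>n. N < fst (s n) + snd (s n)) \<and> (\<forall>n. connected_by_open \<omega> (0, 0) (s n))"
    by metis
qed metis

lemma percolates_measurable: "percolates \<in> sets (percolation \<Xi> p q)"
proof -
  have [measurable]: "(\<lambda>\<omega>. \<omega> v) \<in> measurable (percolation \<Xi> p q) (count_space UNIV)" for v
    unfolding percolation_def
    using measurable_component_singleton[of v UNIV "\<lambda>v. measure_pmf (bernoulli_pmf (if v \<in> \<Xi> then p else q))"]
    by (simp cong: measurable_cong_sets)
  have sp: "space (percolation \<Xi> p q) = UNIV"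
    by (simp add: percolation_def space_PiM)
  have "{\<omega> \<in> space (percolation \<Xi> p q).
      \<forall>N. \<exists>v. N < fst v + snd v \<and>
        (\<exists>vs. is_path vs \<and> hd vs = (0, 0) \<and> last vs = v \<and> (\<forall>w\<in>set vs. \<omega> w))}
      \<in> sets (percolation \<Xi> p q)"
    by measurable
  then show ?thesis
    by (simp add: percolates_alt connected_by_open_def sp)
qed

end

theory Submission
  imports Defs
begin

text \<open>
  Favourable sites lie in \<open>C \<times> R\<close>.  If neither \<open>C\<close> nor \<open>R\<close> meets \<open>{n..10 * n}\<close>, then the L-shaped
  region of all sites whose larger coordinate lies between \<open>n\<close> and \<open>10 * n\<close> contains no favourable
  site at all, so inside it the configuration is plain critical percolation.  An infinite open cluster
  of the origin has to cross every such region.  Two facts therefore suffice.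

  \<^item> With spacings of tail index below 1, a renewal process leaves gaps of the form \<open>{n..10 * n}\<close> at
    infinitely many scales, almost surely, and even along any prescribed infinite set of scales
    (\<open>infinitely_many_gaps\<close>).  Using this for the columns along a deterministic set of scales, and then
    for the rows along the random set of scales that were good for the columns, gives infinitely many
    free L-shaped regions (\<open>infinitely_many_free_regions\<close>).

  \<^item> At the critical point there are infinitely many scales at which the L-shaped region is crossed with
    probability at most \<open>1 - c\<^sup>2\<close>, for a fixed \<open>c > 0\<close> (\<open>critical_near_squares\<close>, \<open>pr_L_crossed\<close>).

  Crossings of far apart regions are independent, so the origin percolates with probability at most
  \<open>(1 - c\<^sup>2) ^ k\<close> for all \<open>k\<close>.

  The second fact is proved by contradiction.  If it fails, then the near-squares \<open>9 n \<times> 10 n\<close> are crossed in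
  their short direction with probability tending to 1.  A Russo-Seymour-Welsh argument turns this into
  crossings of \<open>205 u \<times> 180 u\<close> rectangles in the long direction, still with probability close to 1
  (\<open>stretched_crossing\<close>).  This is an event in a finite box, so by continuity it stays likely for parameters
  slightly below \<open>p_c\<close>, in particular for some parameter at which the origin does not percolate.  But a
  likely long crossing at a single scale forces percolation: the probability of failure is squared,
  up to a constant, whenever the scale is doubled (\<open>finite_size_criterion\<close>).

  The Russo-Seymour-Welsh step follows Bollobas and Riordan: explore the leftmost vertical crossing of a box,
  reflect it, and attach to it an open path from the far right (\<open>pr_hook\<close>).  As only crossings of
  near-squares are available, a hook to the right and a hook to the left cannot be joined by
  a crossing of the box in which both start.  Instead, either the vertical crossing avoids the left margin
  of its box, and the box can be narrowed until such a joining crossing exists, or it touches that margin, and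
  shifting the box slightly to the left makes the two hooks meet for topological reasons
  (\<open>hooks_linked\<close>).

  Planarity enters only through two statements about finite boxes: a nearest-neighbour crossing in one
  direction meets every crossing by king moves in the other (\<open>linked4_linked8_meet\<close>), and one of the two
  always exists (\<open>crossing_duality\<close>).  Both are proved by counting edges modulo 2.
\<close>


section \<open>Lattice paths that must meet\<close>

definition adj4 :: "int \<times> int \<Rightarrow> int \<times> int \<Rightarrow> bool" where
  "adj4 u v \<longleftrightarrow> \<bar>fst u - fst v\<bar> + \<bar>snd u - snd v\<bar> = 1"

definition adj8 :: "int \<times> int \<Rightarrow> int \<times> int \<Rightarrow> bool" where
  "adj8 u v \<longleftrightarrow> u \<noteq> v \<and> \<bar>fst u - fst v\<bar> \<le> 1 \<and> \<bar>snd u - snd v\<bar> \<le> 1"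

definition linked :: "('v \<Rightarrow> 'v \<Rightarrow> bool) \<Rightarrow> 'v set \<Rightarrow> 'v \<Rightarrow> 'v \<Rightarrow> bool" where
  "linked A S u v \<longleftrightarrow> u \<in> S \<and> (\<lambda>x y. A x y \<and> y \<in> S)\<^sup>*\<^sup>* u v"

abbreviation "linked4 \<equiv> linked adj4"
abbreviation "linked8 \<equiv> linked adj8"

lemma adj4_cases: "adj4 (x1, y1) (x2, y2) \<longleftrightarrow>
    x2 = x1 \<and> (y2 = y1 + 1 \<or> y1 = y2 + 1) \<or> y2 = y1 \<and> (x2 = x1 + 1 \<or> x1 = x2 + 1)"
  unfolding adj4_def fst_conv snd_conv by linarith

lemma adj4_sym: "adj4 u v \<longleftrightarrow> adj4 v u"
  by (auto simp: adj4_def)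

lemma adj8_sym: "adj8 u v \<longleftrightarrow> adj8 v u"
  by (auto simp: adj8_def)

lemma adj4_imp_adj8: "adj4 u v \<Longrightarrow> adj8 u v"
  by (cases u; cases v) (auto simp: adj4_def adj8_def)

lemma linked_refl: "u \<in> S \<Longrightarrow> linked A S u u"
  by (simp add: linked_def)

lemma linked_step: "linked A S u v \<Longrightarrow> A v w \<Longrightarrow> w \<in> S \<Longrightarrow> linked A S u w"
  by (auto simp: linked_def intro: rtranclp.rtrancl_into_rtrancl)

lemma linked_induct [consumes 1, case_names refl step]:
  assumes "linked A S u v" "u \<in> S \<Longrightarrow> P u"
    and "\<And>x y. linked A S u x \<Longrightarrow> P x \<Longrightarrow> A x y \<Longrightarrow> y \<in> S \<Longrightarrow> P y"
  shows "P v"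
proof -
  have "(\<lambda>x y. A x y \<and> y \<in> S)\<^sup>*\<^sup>* u v" and u: "u \<in> S"
    using assms(1) by (auto simp: linked_def)
  then have "linked A S u v \<and> P v"
    by (induction rule: rtranclp_induct) (use assms(2,3) in \<open>auto intro: linked_step linked_refl\<close>)
  then show ?thesis ..
qed

lemma linked_inD: assumes "linked A S u v" shows "u \<in> S" "v \<in> S"
  using assms by (simp add: linked_def, induction rule: linked_induct)

lemma linked_trans: "linked A S u v \<Longrightarrow> linked A S v w \<Longrightarrow> linked A S u w"
  unfolding linked_def by (auto intro: rtranclp_trans)

lemma linked_mono:
  assumes "linked A S u v" "\<And>x y. A x y \<Longrightarrow> B x y" "S \<subseteq> T"
  shows "linked B T u v"
  using assms(1)
proof (induction rule: linked_induct)
  case refl then show ?case using assms(3) by (auto intro: linked_refl)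
next
  case (step x y) then show ?case using assms(2,3) by (auto intro: linked_step)
qed

lemma linked_subset: "linked A S u v \<Longrightarrow> S \<subseteq> T \<Longrightarrow> linked A T u v"
  by (rule linked_mono[of A S u v A T])

lemma linked_sym:
  assumes "\<And>x y. A x y \<longleftrightarrow> A y x" "linked A S u v"
  shows "linked A S v u"
  using assms(2)
proof (induction rule: linked_induct)
  case refl then show ?case by (rule linked_refl)
next
  case (step x y)
  have "linked A S y x"
    using step.hyps linked_inD[OF step.hyps(1)] assms(1)
    by (meson linked_refl linked_step)
  then show ?case using step.IH by (rule linked_trans)
qed

lemmas linked4_sym = linked_sym[of adj4, OF adj4_sym]

lemma linked_component:
  assumes "linked A S u v" shows "linked A {z. linked A S u z} u v"
  using assms
proof (induction rule: linked_induct)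
  case refl then show ?case by (auto intro: linked_refl)
next
  case (step x y) then show ?case by (auto intro: linked_step)
qed

lemma linked_image:
  assumes "linked A S u v" "\<And>x y. A x y \<Longrightarrow> B (f x) (f y)"
  shows "linked B (f ` S) (f u) (f v)"
  using assms(1)
proof (induction rule: linked_induct)
  case refl then show ?case by (auto intro: linked_refl)
next
  case (step x y) then show ?case using assms(2) by (auto intro: linked_step)
qed

lemma linked_stays_or_leaves:
  assumes "linked A S u v" "u \<in> T"
  shows "linked A (S \<inter> T) u v \<or> (\<exists>x y. linked A (S \<inter> T) u x \<and> A x y \<and> y \<in> S \<and> y \<notin> T)"
  using assms(1)
proof (induction rule: linked_induct)
  case refl then show ?case using assms(2) by (auto intro: linked_refl)
next
  case (step x y) then show ?case by (cases "y \<in> T") (auto intro: linked_step)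
qed

text \<open>
  Cutting a walk at its last passage through level \<open>a\<close> of \<open>g\<close>; used with a coordinate as \<open>g\<close>, to pass to a
  smaller rectangle.
\<close>

lemma linked_crop:
  fixes g :: "'v \<Rightarrow> int"
  assumes "linked A S u v" "g u \<le> a" "a \<le> g v"
    and "\<And>x y. A x y \<Longrightarrow> \<bar>g x - g y\<bar> \<le> 1"
  shows "\<exists>u'. g u' = a \<and> linked A (S \<inter> {x. a \<le> g x}) u' v"
proof -
  have "a \<le> g v \<longrightarrow> (\<exists>u'. g u' = a \<and> linked A (S \<inter> {x. a \<le> g x}) u' v)"
    using assms(1)
  proof (induction rule: linked_induct)
    case refl then show ?case using assms(2) by (auto intro!: exI[of _ u] linked_refl)
  next
    case (step x y)
    show ?case
    proof (intro impI)
      assume y: "a \<le> g y"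
      show "\<exists>u'. g u' = a \<and> linked A (S \<inter> {x. a \<le> g x}) u' y"
      proof (cases "a \<le> g x")
        case True
        with step y show ?thesis by (auto intro: linked_step)
      next
        case False
        then have "g y = a" using assms(4)[OF step.hyps(2)] y by linarith
        then show ?thesis using step by (auto intro!: exI[of _ y] linked_refl)
      qed
    qed
  qed
  then show ?thesis using assms(3) by blast
qed

lemma linked_walk:
  assumes "linked A S u v"
  shows "\<exists>ps. ps \<noteq> [] \<and> hd ps = u \<and> last ps = v \<and> set ps \<subseteq> S \<and> successively A ps"
  using assms
proof (induction rule: linked_induct)
  case refl then show ?case by (auto intro!: exI[of _ "[u]"])
next
  case (step x y)
  then obtain ps where "ps \<noteq> [] \<and> hd ps = u \<and> last ps = x \<and> set ps \<subseteq> S \<and> successively A ps" by blast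
  then show ?case using step
    by (auto intro!: exI[of _ "ps @ [y]"] simp: successively_append_iff)
qed

text \<open>
  The parity of the number of steps of a walk that satisfy \<open>f\<close>.
\<close>

fun crossing_parity :: "('v \<Rightarrow> 'v \<Rightarrow> bool) \<Rightarrow> 'v list \<Rightarrow> bool" where
  "crossing_parity f (p # q # ps) = (f p q \<noteq> crossing_parity f (q # ps))"
| "crossing_parity f _ = False"

text \<open>
  If two kinds of steps differ exactly when the indicator \<open>g\<close> changes, the difference of the two counts
  telescopes modulo 2.
\<close>

lemma crossing_parity_telescope:
  fixes g :: "'v \<Rightarrow> bool"
  assumes "successively (\<lambda>p q. (f p q \<noteq> f' p q) = (g p \<noteq> g q)) ps" "ps \<noteq> []"
  shows "(crossing_parity f ps \<noteq> crossing_parity f' ps) = (g (hd ps) \<noteq> g (last ps))"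
  using assms by (induction f ps rule: crossing_parity.induct) auto

lemma crossing_parity_False: "crossing_parity (\<lambda>_ _. False) ps = False"
  by (induction "\<lambda>(_::'a) (_::'a). False" ps rule: crossing_parity.induct) auto

definition rect :: "int \<Rightarrow> int \<Rightarrow> int \<Rightarrow> int \<Rightarrow> (int \<times> int) set" where
  "rect a b c d = {a..b} \<times> {c..d}"

lemma mem_rect: "p \<in> rect a b c d \<longleftrightarrow> a \<le> fst p \<and> fst p \<le> b \<and> c \<le> snd p \<and> snd p \<le> d"
  by (cases p) (auto simp: rect_def)

lemma finite_rect [simp]: "finite (rect a b c d)"
  by (simp add: rect_def)

text \<open>
  The step from \<open>p\<close> to \<open>q\<close> crosses the vertical ray that starts at \<open>v\<close>, shifted by one half to the right,
  and goes down.  The parity of the number of such steps tells on which side of a walk the site \<open>v\<close> lies.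
\<close>

definition below :: "int \<times> int \<Rightarrow> int \<times> int \<Rightarrow> int \<times> int \<Rightarrow> bool" where
  "below v p q \<longleftrightarrow> snd p = snd q \<and> snd p < snd v \<and>
     (fst p = fst v \<and> fst q = fst v + 1 \<or> fst q = fst v \<and> fst p = fst v + 1)"

text \<open>
  Moving the ray from column \<open>x\<close> to column \<open>x + 1\<close> changes the set of crossed steps only by steps that enter
  or leave the part of column \<open>x + 1\<close> below \<open>v'\<close>, because the walk avoids \<open>v\<close> and \<open>v'\<close>.
\<close>

lemma below_right_step:
  assumes "adj4 p q" "v = (x, y)" "v' = (x + 1, y')" "\<bar>y - y'\<bar> \<le> 1"
    and "p \<noteq> v" "q \<noteq> v" "p \<noteq> v'" "q \<noteq> v'"
  shows "(below v p q \<noteq> below v' p q) =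
    ((fst p = x + 1 \<and> snd p < y') \<noteq> (fst q = x + 1 \<and> snd q < y'))"
proof -
  obtain p1 p2 q1 q2 where pq: "p = (p1, p2)" "q = (q1, q2)" by (cases p; cases q)
  have y: "y' = y \<or> y' = y + 1 \<or> y = y' + 1" using assms(4) by linarith
  from assms(1) consider "q1 = p1" "q2 = p2 + 1" | "q1 = p1" "p2 = q2 + 1"
    | "q2 = p2" "q1 = p1 + 1" | "q2 = p2" "p1 = q1 + 1"
    unfolding pq adj4_cases by blast
  then show ?thesis
    using assms(5-) y unfolding assms(2,3) pq below_def fst_conv snd_conv prod.inject
    by cases (smt (z3))+
qed

lemma below_up_step:
  assumes "v = (x, y)" "v' = (x, y + 1)" "p \<noteq> v" "q \<noteq> v"
  shows "below v p q = below v' p q"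
  using assms by (cases p; cases q) (auto simp: below_def)

text \<open>
  The side of the walk is constant along king moves that avoid the walk.  The columns must lie strictly
  between the end columns, since the parity jumps where the walk ends.
\<close>

lemma below_parity_adj8:
  assumes ps: "successively adj4 ps" "ps \<noteq> []" and v: "v \<notin> set ps" "v' \<notin> set ps" "adj8 v v'"
    and e: "fst (hd ps) < fst v" "fst (hd ps) < fst v'" "fst v < fst (last ps)" "fst v' < fst (last ps)"
  shows "crossing_parity (below v) ps = crossing_parity (below v') ps"
proof -
  have right: "crossing_parity (below w) ps = crossing_parity (below w') ps"
    if "w = (x, y)" "w' = (x + 1, y')" "\<bar>y - y'\<bar> \<le> 1" "w \<notin> set ps" "w' \<notin> set ps"
      "fst (hd ps) < fst w" "fst w' < fst (last ps)" for w w' x y y'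
  proof -
    have "successively (\<lambda>p q. (below w p q \<noteq> below w' p q) =
        ((fst p = x + 1 \<and> snd p < y') \<noteq> (fst q = x + 1 \<and> snd q < y'))) ps"
    proof (rule successively_mono[OF ps(1)])
      fix p q assume "p \<in> set ps" "q \<in> set ps" "adj4 p q"
      then show "(below w p q \<noteq> below w' p q) =
        ((fst p = x + 1 \<and> snd p < y') \<noteq> (fst q = x + 1 \<and> snd q < y'))"
        by (intro below_right_step[OF _ that(1-3)]) (use that in auto)
    qed
    from crossing_parity_telescope[OF this ps(2)] that show ?thesis by auto
  qed
  have up: "crossing_parity (below w) ps = crossing_parity (below w') ps"
    if "w = (x, y)" "w' = (x, y + 1)" "w \<notin> set ps" for w w' x y
  proof -
    have "successively (\<lambda>p q. (below w p q \<noteq> below w' p q) = (False \<noteq> False)) ps"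
    proof (rule successively_mono[OF ps(1)])
      fix p q assume "p \<in> set ps" "q \<in> set ps" "adj4 p q"
      then show "(below w p q \<noteq> below w' p q) = (False \<noteq> False)"
        using below_up_step[OF that(1,2), of p q] that(3) by auto
    qed
    from crossing_parity_telescope[OF this ps(2)] show ?thesis by auto
  qed
  obtain x y x' y' where vv: "v = (x, y)" "v' = (x', y')" by (cases v; cases v')
  have "x' = x + 1 \<and> \<bar>y - y'\<bar> \<le> 1 \<or> x = x' + 1 \<and> \<bar>y' - y\<bar> \<le> 1 \<or>
      x' = x \<and> y' = y + 1 \<or> x' = x \<and> y = y' + 1"
    using v(3) unfolding vv adj8_def fst_conv snd_conv prod.inject by linarith
  then consider "x' = x + 1" "\<bar>y - y'\<bar> \<le> 1" | "x = x' + 1" "\<bar>y' - y\<bar> \<le> 1"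
    | "x' = x" "y' = y + 1" | "x' = x" "y = y' + 1" by blast
  then show ?thesis
  proof cases
    case 1 then show ?thesis using right[of v x y v' y'] vv v e by auto
  next
    case 2 then show ?thesis using right[of v' x' y' v y] vv v e by auto
  next
    case 3 then show ?thesis using up[of v x y v'] vv v by auto
  next
    case 4 then show ?thesis using up[of v' x y' v] vv v by auto
  qed
qed

text \<open>
  If the two connections were disjoint, the parity of \<open>below\<close> would be constant along the king-move
  connection.  At its bottom end it is even, as nothing lies below.  At its top end every step through the column gap to the
  right of the site is counted, and a walk from left to right crosses a column gap an odd number of times.
\<close>

theorem linked4_linked8_meet:
  assumes P: "linked4 S u v" "S \<subseteq> rect a b c d" "fst u = a" "fst v = b"
    and Q: "linked8 T p q" "T \<subseteq> rect a b c d" "snd p = c" "snd q = d"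
  shows "S \<inter> T \<noteq> {}"
proof
  assume disj: "S \<inter> T = {}"
  obtain ps0 where ps0: "ps0 \<noteq> []" "hd ps0 = u" "last ps0 = v" "set ps0 \<subseteq> S" "successively adj4 ps0"
    using linked_walk[OF P(1)] by blast
  (* One extra step at both ends, so that all sites of T lie strictly between the end columns. *)
  define ps where "ps = (a - 1, snd u) # ps0 @ [(b + 1, snd v)]"
  have adju: "adj4 (a - 1, snd u) u" and adjv: "adj4 v (b + 1, snd v)"
    using P(3,4) by (auto simp: adj4_def)
  have ps: "successively adj4 ps" "ps \<noteq> []"
    using ps0 adju adjv by (auto simp: ps_def successively_append_iff successively_Cons)
  have range: "a \<le> fst w \<and> fst w \<le> b \<and> c \<le> snd w \<and> snd w \<le> d" if "w \<in> S \<union> T" for w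
    using that P(2) Q(2) mem_rect[of w a b c d] by blast
  have notin: "w \<notin> set ps" if "w \<in> T" for w
    using that disj ps0(4) range[of w] by (auto simp: ps_def)
  have ends: "fst (hd ps) = a - 1" "fst (last ps) = b + 1"
    by (auto simp: ps_def)
  have snds: "c \<le> snd w \<and> snd w \<le> d" if "w \<in> set ps" for w
    using that ps0(4) range[of w] range[of u] range[of v] linked_inD[OF P(1)] by (auto simp: ps_def)
  have inv: "crossing_parity (below p) ps = crossing_parity (below w) ps" if "linked8 T p w" for w
    using that
  proof (induction rule: linked_induct)
    case (step x y)
    have "x \<in> T" using step.hyps(1) linked_inD by fast
    then show ?case
      using below_parity_adj8[OF ps notin[OF \<open>x \<in> T\<close>] notin[OF step.hyps(3)] step.hyps(2)] range[of x] range[of y] step ends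
      by auto
  qed simp
  have "successively (\<lambda>r s. (below p r s \<noteq> False) = (False \<noteq> False)) ps"
    by (rule successively_mono[OF ps(1)]) (use snds Q(3) in \<open>fastforce simp: below_def\<close>)
  from crossing_parity_telescope[OF this ps(2)] crossing_parity_False[of ps]
  have start: "\<not> crossing_parity (below p) ps" by simp
  have "q \<in> T" using linked_inD(2)[OF Q(1)] .
  have "successively (\<lambda>r s. (below q r s \<noteq> False) = ((fst r \<le> fst q) \<noteq> (fst s \<le> fst q))) ps"
  proof (rule successively_mono[OF ps(1)])
    fix r s assume rs: "r \<in> set ps" "s \<in> set ps" "adj4 r s"
    then have "r \<noteq> q" "s \<noteq> q" "snd r \<le> snd q" "snd s \<le> snd q"
      using notin[OF \<open>q \<in> T\<close>] snds Q(4) by auto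
    then show "(below q r s \<noteq> False) = ((fst r \<le> fst q) \<noteq> (fst s \<le> fst q))"
    proof -
      obtain r1 r2 s1 s2 q1 q2 where e: "r = (r1, r2)" "s = (s1, s2)" "q = (q1, q2)"
        by (cases r; cases s; cases q)
      from rs(3) consider "s1 = r1" "s2 = r2 + 1" | "s1 = r1" "r2 = s2 + 1"
        | "s2 = r2" "s1 = r1 + 1" | "s2 = r2" "r1 = s1 + 1"
        unfolding e adj4_cases by blast
      then show ?thesis
        using \<open>r \<noteq> q\<close> \<open>s \<noteq> q\<close> \<open>snd r \<le> snd q\<close> unfolding e below_def by cases auto
    qed
  qed
  from crossing_parity_telescope[OF this ps(2)] crossing_parity_False[of ps]
  have "crossing_parity (below q) ps" using ends range[of q] \<open>q \<in> T\<close> by auto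
  with start inv[OF Q(1)] show False by simp
qed

section \<open>Duality of lattice crossings\<close>

text \<open>
  Each inner edge of a grid belongs to two faces, so modulo 2 a sum over faces is a sum over boundary edges.
\<close>

lemma even_grid_boundary:
  fixes h v :: "nat \<Rightarrow> nat \<Rightarrow> nat"
  assumes "\<And>i j. i < m \<Longrightarrow> j < n \<Longrightarrow> even (h i j + h i (Suc j) + v i j + v (Suc i) j)"
  shows "even ((\<Sum>i<m. h i 0 + h i n) + (\<Sum>j<n. v 0 j + v m j))"
  using assms
proof (induction n)
  case 0
  then show ?case by (simp flip: mult_2 sum_distrib_left)
next
  case (Suc n)
  have tele: "even ((\<Sum>i<k. v i n + v (Suc i) n) + (v 0 n + v k n))" for k
    by (induction k) auto
  have "even (\<Sum>i<m. h i n + h i (Suc n) + v i n + v (Suc i) n)"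
    by (rule dvd_sum) (use Suc.prems in auto)
  then have "even ((\<Sum>i<m. h i n) + (\<Sum>i<m. h i (Suc n)) + (\<Sum>i<m. v i n + v (Suc i) n))"
    by (simp add: sum.distrib algebra_simps)
  then have "even ((\<Sum>i<m. h i n) + (\<Sum>i<m. h i (Suc n)) + (v 0 n + v m n))"
    using tele[of m] by presburger
  moreover have "even ((\<Sum>i<m. h i 0) + (\<Sum>i<m. h i n) + (\<Sum>j<n. v 0 j + v m j))"
    using Suc by (simp add: sum.distrib)
  ultimately show ?case by (simp add: sum.distrib) presburger
qed

datatype side = Bottom | Top | Left | Right

definition mixed :: "side \<Rightarrow> side \<Rightarrow> nat" where
  "mixed s t = (if s = Bottom \<and> t = Left \<or> s = Left \<and> t = Bottom then 1 else 0)"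

definition opposed4 :: "side \<Rightarrow> side \<Rightarrow> bool" where
  "opposed4 s t \<longleftrightarrow> s = Bottom \<and> t = Top \<or> s = Top \<and> t = Bottom"

definition opposed8 :: "side \<Rightarrow> side \<Rightarrow> bool" where
  "opposed8 s t \<longleftrightarrow> s = Left \<and> t = Right \<or> s = Right \<and> t = Left"

lemma even_mixed_face:
  assumes "\<not> opposed4 p q" "\<not> opposed4 q r" "\<not> opposed4 s r" "\<not> opposed4 p s"
    and "\<not> opposed8 p q" "\<not> opposed8 q r" "\<not> opposed8 s r" "\<not> opposed8 p s"
    and "\<not> opposed8 p r" "\<not> opposed8 q s"
  shows "even (mixed p q + mixed s r + mixed p s + mixed q r)"
  using assms by (cases p; cases q; cases r; cases s) (simp_all add: mixed_def opposed4_def opposed8_def)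

text \<open>
  A parity argument in the spirit of Sperner's lemma.  Open sites are labelled by whether they
  are connected to the bottom, closed sites by whether they are connected to the left side, and a frame
  around the rectangle carries the four side labels.  If both crossings are absent, adjacent open sites never
  carry opposite labels, and neither do closed sites a king move apart; then each face has
  an even number of edges between \<open>Bottom\<close> and \<open>Left\<close>.  But the boundary of the framed rectangle has exactly one such edge, at
  its lower left corner.
\<close>

theorem crossing_duality:
  assumes ab: "a \<le> b" and cd: "c \<le> d"
  shows "(\<exists>u v. linked4 (O' \<inter> rect a b c d) u v \<and> snd u = c \<and> snd v = d) \<or>
    (\<exists>u v. linked8 (rect a b c d - O') u v \<and> fst u = a \<and> fst v = b)"
proof (rule ccontr)
  let ?S = "O' \<inter> rect a b c d" and ?T = "rect a b c d - O'"
  assume "\<not> ?thesis"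
  then have no4: "\<And>u v. linked4 ?S u v \<Longrightarrow> snd u = c \<Longrightarrow> snd v \<noteq> d"
    and no8: "\<And>u v. linked8 ?T u v \<Longrightarrow> fst u = a \<Longrightarrow> fst v \<noteq> b" by blast+
  define lab :: "int \<times> int \<Rightarrow> side" where "lab p =
    (if fst p < a then Left else if b < fst p then Right
     else if snd p < c then Bottom else if d < snd p then Top
     else if p \<in> O' then (if \<exists>u. snd u = c \<and> linked4 ?S u p then Bottom else Top)
     else (if \<exists>u. fst u = a \<and> linked8 ?T u p then Left else Right))" for p
  define E where "E = rect (a - 1) (b + 1) (c - 1) (d + 1)"
  have nobot: "\<not> (lab p = Bottom \<and> lab q = Top)" if pq: "p \<in> E" "q \<in> E" "adj4 p q" for p q
  proof
    assume l: "lab p = Bottom \<and> lab q = Top"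
    have adj: "\<bar>fst p - fst q\<bar> \<le> 1" "\<bar>snd p - snd q\<bar> \<le> 1" using pq(3) by (auto simp: adj4_def)
    have p: "a \<le> fst p" "fst p \<le> b" "snd p < c \<or> p \<in> O' \<and> c \<le> snd p \<and> snd p \<le> d \<and> (\<exists>u. snd u = c \<and> linked4 ?S u p)"
      and q: "a \<le> fst q" "fst q \<le> b" "d < snd q \<or> q \<in> O' \<and> c \<le> snd q \<and> snd q \<le> d \<and> \<not> (\<exists>u. snd u = c \<and> linked4 ?S u q)"
      using l by (auto simp: lab_def split: if_splits)
    from p(3) show False
    proof
      assume "snd p < c"
      with q cd adj have "snd q = c" "q \<in> ?S" by (auto simp: mem_rect)
      then have "linked4 ?S q q" by (intro linked_refl)
      with q(3) cd \<open>snd q = c\<close> show False by (metis linorder_not_less)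
    next
      assume p': "p \<in> O' \<and> c \<le> snd p \<and> snd p \<le> d \<and> (\<exists>u. snd u = c \<and> linked4 ?S u p)"
      then obtain u where u: "snd u = c" "linked4 ?S u p" by blast
      from q(3) show False
      proof
        assume "d < snd q"
        with p' adj have "snd p = d" by linarith
        with no4 u show False by blast
      next
        assume q': "q \<in> O' \<and> c \<le> snd q \<and> snd q \<le> d \<and> \<not> (\<exists>u. snd u = c \<and> linked4 ?S u q)"
        then have "linked4 ?S u q" using u pq(3) q by (auto intro: linked_step simp: mem_rect)
        with u q' show False by blast
      qed
    qed
  qed
  have noleft: "\<not> (lab p = Left \<and> lab q = Right)" if pq: "p \<in> E" "q \<in> E" "adj8 p q" for p q
  proof
    assume l: "lab p = Left \<and> lab q = Right"
    have adj: "\<bar>fst p - fst q\<bar> \<le> 1" "\<bar>snd p - snd q\<bar> \<le> 1" using pq(3) by (auto simp: adj8_def)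
    have p: "fst p < a \<or> p \<notin> O' \<and> p \<in> rect a b c d \<and> (\<exists>u. fst u = a \<and> linked8 ?T u p)"
      and q: "b < fst q \<or> q \<notin> O' \<and> q \<in> rect a b c d \<and> \<not> (\<exists>u. fst u = a \<and> linked8 ?T u q)"
      using l by (auto simp: lab_def mem_rect split: if_splits)
    from p show False
    proof
      assume "fst p < a"
      with q ab adj have "fst q = a" "q \<in> ?T" by (auto simp: mem_rect)
      then have "linked8 ?T q q" by (intro linked_refl)
      with q ab \<open>fst q = a\<close> show False by (metis linorder_not_less)
    next
      assume p': "p \<notin> O' \<and> p \<in> rect a b c d \<and> (\<exists>u. fst u = a \<and> linked8 ?T u p)"
      then obtain u where u: "fst u = a" "linked8 ?T u p" by blast
      from q show False
      proof
        assume "b < fst q"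
        with p' adj have "fst p = b" by (auto simp: mem_rect)
        with no8 u show False by blast
      next
        assume q': "q \<notin> O' \<and> q \<in> rect a b c d \<and> \<not> (\<exists>u. fst u = a \<and> linked8 ?T u q)"
        then have "linked8 ?T u q" using u pq(3) by (auto intro: linked_step)
        with u q' show False by blast
      qed
    qed
  qed
  have no: "\<not> opposed4 (lab p) (lab q)" if "p \<in> E" "q \<in> E" "adj4 p q" for p q
    using nobot[of p q] nobot[of q p] that adj4_sym[of p q] by (auto simp: opposed4_def)
  have no': "\<not> opposed8 (lab p) (lab q)" if "p \<in> E" "q \<in> E" "adj8 p q" for p q
    using noleft[of p q] noleft[of q p] that adj8_sym[of p q] by (auto simp: opposed8_def)
  define L where "L i j = lab (a - 1 + int i, c - 1 + int j)" for i j
  define m where "m = nat (b - a + 2)"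
  define n where "n = nat (d - c + 2)"
  have total: "even ((\<Sum>i<m. mixed (L i 0) (L (Suc i) 0) + mixed (L i n) (L (Suc i) n)) +
      (\<Sum>j<n. mixed (L 0 j) (L 0 (Suc j)) + mixed (L m j) (L m (Suc j))))"
  proof (rule even_grid_boundary)
    fix i j assume ij: "i < m" "j < n"
    have E: "(a - 1 + int i', c - 1 + int j') \<in> E" if "i' \<in> {i, Suc i}" "j' \<in> {j, Suc j}" for i' j'
      using that ij ab cd by (auto simp: E_def mem_rect m_def n_def)
    show "even (mixed (L i j) (L (Suc i) j) + mixed (L i (Suc j)) (L (Suc i) (Suc j)) +
        mixed (L i j) (L i (Suc j)) + mixed (L (Suc i) j) (L (Suc i) (Suc j)))"
      unfolding L_def
      by (rule even_mixed_face; (rule no no'); (rule E)?; simp add: adj4_def adj8_def)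
  qed
  have sides: "L 0 j = Left" "L m j = Right" for j
    using ab by (auto simp: L_def lab_def m_def)
  have bot: "L i 0 = (if i = 0 then Left else if i = m then Right else Bottom)" if "i \<le> m" for i
    using that ab cd by (auto simp: L_def lab_def m_def)
  have top: "L i n = (if i = 0 then Left else if i = m then Right else Top)" if "i \<le> m" for i
    using that ab cd by (auto simp: L_def lab_def m_def n_def)
  have m: "2 \<le> m" using ab by (simp add: m_def)
  have "mixed (L i 0) (L (Suc i) 0) + mixed (L i n) (L (Suc i) n) = (if i = 0 then 1 else 0)" if "i < m" for i
    using that bot[of i] bot[of "Suc i"] top[of i] top[of "Suc i"] m by (auto simp: mixed_def)
  then have "(\<Sum>i<m. mixed (L i 0) (L (Suc i) 0) + mixed (L i n) (L (Suc i) n)) =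
      (\<Sum>i<m. (if i = 0 then 1 else 0 :: nat))"
    by (intro sum.cong) auto
  moreover have "(\<Sum>j<n. mixed (L 0 j) (L 0 (Suc j)) + mixed (L m j) (L m (Suc j))) = 0"
    by (simp add: sides mixed_def)
  ultimately show False using total m by simp
qed

section \<open>Product measures on site configurations\<close>

definition site_measure :: "('v \<Rightarrow> real) \<Rightarrow> ('v \<Rightarrow> bool) measure" where
  "site_measure r = PiM UNIV (\<lambda>v. measure_pmf (bernoulli_pmf (r v)))"

definition open_event :: "('v set \<Rightarrow> bool) \<Rightarrow> ('v \<Rightarrow> bool) set" where
  "open_event Q = {\<omega>. Q {v. \<omega> v}}"

text \<open>
  Events are predicates on the set of open sites, and \<open>r v\<close> is the probability that \<open>v\<close> is open.
\<close>

definition pr :: "('v \<Rightarrow> real) \<Rightarrow> ('v set \<Rightarrow> bool) \<Rightarrow> real" where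
  "pr r Q = measure (site_measure r) (open_event Q)"

text \<open>
  The finite set \<open>V\<close> supports the event \<open>Q\<close>: membership of sites outside \<open>V\<close> does not matter.
\<close>

definition cyl :: "'v set \<Rightarrow> ('v set \<Rightarrow> bool) \<Rightarrow> bool" where
  "cyl V Q \<longleftrightarrow> finite V \<and> (\<forall>A. Q (A \<inter> V) = Q A)"

lemma cylD: "cyl V Q \<Longrightarrow> finite V" "cyl V Q \<Longrightarrow> Q (A \<inter> V) = Q A"
  by (auto simp: cyl_def)

lemma cyl_mono: "cyl V Q \<Longrightarrow> V \<subseteq> W \<Longrightarrow> finite W \<Longrightarrow> cyl W Q"
  unfolding cyl_def by (metis Int_assoc inf.absorb_iff2)

lemma cyl_not: "cyl V Q \<Longrightarrow> cyl V (\<lambda>A. \<not> Q A)"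
  by (simp add: cyl_def)

lemma cyl_conj: "cyl V Q \<Longrightarrow> cyl W R \<Longrightarrow> cyl (V \<union> W) (\<lambda>A. Q A \<and> R A)"
  using cyl_mono[of V Q "V \<union> W"] cyl_mono[of W R "V \<union> W"] by (auto simp: cyl_def)

lemma cyl_disj: "cyl V Q \<Longrightarrow> cyl W R \<Longrightarrow> cyl (V \<union> W) (\<lambda>A. Q A \<or> R A)"
  using cyl_mono[of V Q "V \<union> W"] cyl_mono[of W R "V \<union> W"] by (auto simp: cyl_def)

interpretation site: prob_space "site_measure r" for r
  unfolding site_measure_def by (intro prob_space_PiM prob_space_measure_pmf)

lemma space_site_measure [simp]: "space (site_measure r) = UNIV"
  by (simp add: site_measure_def space_PiM)

lemma site_measurable [measurable]: "(\<lambda>\<omega>. \<omega> v) \<in> measurable (site_measure r) (count_space UNIV)"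
  unfolding site_measure_def
  using measurable_component_singleton[of v UNIV "\<lambda>v. measure_pmf (bernoulli_pmf (r v))"]
  by (simp cong: measurable_cong_sets)

definition pattern :: "'v set \<Rightarrow> 'v set \<Rightarrow> ('v \<Rightarrow> bool) set" where
  "pattern V A = {\<omega>. \<forall>v\<in>V. \<omega> v \<longleftrightarrow> v \<in> A}"

lemma sets_pattern [measurable]: "finite V \<Longrightarrow> pattern V A \<in> sets (site_measure r)"
proof -
  assume V: "finite V"
  have "{\<omega> \<in> space (site_measure r). \<forall>v\<in>V. \<omega> v \<longleftrightarrow> v \<in> A} \<in> sets (site_measure r)"
    using V by (intro sets.sets_Collect_finite_All) measurable
  then show ?thesis by (simp add: pattern_def)
qed

lemma measure_pattern:
  assumes "finite V" "\<And>v. v \<in> V \<Longrightarrow> 0 \<le> r v \<and> r v \<le> 1"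
  shows "measure (site_measure r) (pattern V A) = (\<Prod>v\<in>V. if v \<in> A then r v else 1 - r v)"
proof -
  interpret product_prob_space "\<lambda>v. measure_pmf (bernoulli_pmf (r v))" UNIV
    by unfold_locales
  have "pattern V A = prod_emb UNIV (\<lambda>v. measure_pmf (bernoulli_pmf (r v))) V (\<Pi>\<^sub>E v\<in>V. {v \<in> A})"
    by (auto simp: pattern_def prod_emb_def space_PiM PiE_iff restrict_def extensional_def)
  then have "measure (site_measure r) (pattern V A) =
      (\<Prod>v\<in>V. measure (measure_pmf (bernoulli_pmf (r v))) {v \<in> A})"
    unfolding site_measure_def using assms(1) by (simp add: measure_PiM_emb)
  also have "\<dots> = (\<Prod>v\<in>V. if v \<in> A then r v else 1 - r v)"
    using assms(2) by (intro prod.cong) (auto simp: measure_pmf_single)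
  finally show ?thesis .
qed

lemma open_event_pattern:
  assumes "cyl V Q"
  shows "open_event Q = (\<Union>A\<in>{A \<in> Pow V. Q A}. pattern V A)"
proof -
  have "Q {v. \<omega> v} \<longleftrightarrow> (\<exists>A\<in>{A \<in> Pow V. Q A}. \<omega> \<in> pattern V A)" for \<omega>
  proof
    assume "Q {v. \<omega> v}"
    then have "Q ({v. \<omega> v} \<inter> V)" using cylD(2)[OF assms] by simp
    then show "\<exists>A\<in>{A \<in> Pow V. Q A}. \<omega> \<in> pattern V A"
      by (intro bexI[of _ "{v. \<omega> v} \<inter> V"]) (auto simp: pattern_def)
  next
    assume "\<exists>A\<in>{A \<in> Pow V. Q A}. \<omega> \<in> pattern V A"
    then obtain A where A: "A \<subseteq> V" "Q A" "\<forall>v\<in>V. \<omega> v \<longleftrightarrow> v \<in> A" by (auto simp: pattern_def)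
    then have "{v. \<omega> v} \<inter> V = A" by auto
    then show "Q {v. \<omega> v}" using A cylD(2)[OF assms, of "{v. \<omega> v}"] by simp
  qed
  then show ?thesis by (auto simp: open_event_def)
qed

lemma sets_open_event [measurable]:
  assumes "cyl V Q" shows "open_event Q \<in> sets (site_measure r)"
proof -
  have V: "finite V" using cylD(1)[OF assms] .
  show ?thesis
    unfolding open_event_pattern[OF assms]
  proof (rule sets.finite_UN)
    show "finite {A \<in> Pow V. Q A}" using V by simp
    show "pattern V A \<in> sets (site_measure r)" for A by (rule sets_pattern[OF V])
  qed
qed

lemma pr_formula:
  assumes "cyl V Q" "\<And>v. v \<in> V \<Longrightarrow> 0 \<le> r v \<and> r v \<le> 1"
  shows "pr r Q = (\<Sum>A\<in>Pow V. if Q A then \<Prod>v\<in>V. if v \<in> A then r v else 1 - r v else 0)"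
proof -
  have V: "finite V" using cylD(1)[OF assms(1)] .
  have "pr r Q = (\<Sum>A\<in>{A \<in> Pow V. Q A}. measure (site_measure r) (pattern V A))"
    unfolding pr_def open_event_pattern[OF assms(1)]
  proof (rule site.finite_measure_finite_Union)
    show "finite {A \<in> Pow V. Q A}" using V by simp
    show "pattern V ` {A \<in> Pow V. Q A} \<subseteq> sets (site_measure r)"
      using sets_pattern[OF V] by blast
    show "disjoint_family_on (pattern V) {A \<in> Pow V. Q A}"
      by (auto simp: disjoint_family_on_def pattern_def)
  qed
  also have "\<dots> = (\<Sum>A\<in>{A \<in> Pow V. Q A}. \<Prod>v\<in>V. if v \<in> A then r v else 1 - r v)"
    using V assms(2) by (simp add: measure_pattern)
  also have "\<dots> = (\<Sum>A\<in>Pow V. if Q A then \<Prod>v\<in>V. if v \<in> A then r v else 1 - r v else 0)"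
    using V by (subst sum.inter_filter) auto
  finally show ?thesis .
qed

lemma pr_nonneg: "0 \<le> pr r Q" and pr_le_1: "pr r Q \<le> 1"
  by (auto simp: pr_def)

lemma cyl_insert: "cyl (insert v V) Q \<Longrightarrow> cyl (V - {v}) (\<lambda>A. Q (insert v A))"
  and cyl_remove: "cyl (insert v V) Q \<Longrightarrow> cyl (V - {v}) (\<lambda>A. Q (A - {v}))"
proof -
  assume c: "cyl (insert v V) Q"
  have "Q (insert v (A \<inter> (V - {v}))) = Q (insert v A)" for A
    using cylD(2)[OF c, of "insert v (A \<inter> (V - {v}))"] cylD(2)[OF c, of "insert v A"]
    by (metis (no_types, lifting) Int_Diff Int_insert_left_if1 inf_assoc inf_idem insertI1 insert_Diff_single
        Int_insert_right insert_absorb2)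
  then show "cyl (V - {v}) (\<lambda>A. Q (insert v A))"
    using cylD(1)[OF c] by (auto simp: cyl_def)
  have "Q (A \<inter> (V - {v}) - {v}) = Q (A - {v})" for A
  proof -
    have "(A - {v}) \<inter> insert v V = A \<inter> (V - {v}) - {v}" by blast
    then show ?thesis using cylD(2)[OF c, of "A - {v}"] by simp
  qed
  then show "cyl (V - {v}) (\<lambda>A. Q (A - {v}))"
    using cylD(1)[OF c] by (auto simp: cyl_def)
qed

text \<open>
  Conditioning on a single site.  Induction over the support with this identity yields independence,
  the Harris inequality and invariance under relabelling of sites.
\<close>

theorem pr_condition_site:
  assumes c: "cyl V Q" and r: "\<And>v. 0 \<le> r v \<and> r v \<le> 1"
  shows "pr r Q = r v * pr r (\<lambda>A. Q (insert v A)) + (1 - r v) * pr r (\<lambda>A. Q (A - {v}))"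
proof -
  define W where "W = V - {v}"
  have W: "finite W" "v \<notin> W" using cylD(1)[OF c] by (auto simp: W_def)
  have c': "cyl (insert v W) Q"
    using cyl_mono[OF c, of "insert v W"] W by (auto simp: W_def)
  have c1: "cyl W (\<lambda>A. Q (insert v A))" and c0: "cyl W (\<lambda>A. Q (A - {v}))"
    using cyl_insert[OF c'] cyl_remove[OF c'] W by auto
  have inj: "inj_on (insert v) (Pow W)"
    using W by (auto simp: inj_on_def)
  have eq: "(\<Prod>u\<in>W. if u = v \<or> u \<in> A then r u else 1 - r u) = (\<Prod>u\<in>W. if u \<in> A then r u else 1 - r u)" for A
    using W by (intro prod.cong) auto
  have "pr r Q = (\<Sum>A\<in>Pow W. if Q A then \<Prod>u\<in>insert v W. if u \<in> A then r u else 1 - r u else 0) +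
     (\<Sum>A\<in>insert v ` Pow W. if Q A then \<Prod>u\<in>insert v W. if u \<in> A then r u else 1 - r u else 0)"
    unfolding pr_formula[OF c' r] Pow_insert
    using W by (intro sum.union_disjoint) auto
  also have "(\<Sum>A\<in>Pow W. if Q A then \<Prod>u\<in>insert v W. if u \<in> A then r u else 1 - r u else 0) =
     (1 - r v) * pr r (\<lambda>A. Q (A - {v}))"
    unfolding pr_formula[OF c0 r] sum_distrib_left
    using W by (intro sum.cong) (auto simp: subset_iff Diff_insert0)
  also have "(\<Sum>A\<in>insert v ` Pow W. if Q A then \<Prod>u\<in>insert v W. if u \<in> A then r u else 1 - r u else 0) =
     r v * pr r (\<lambda>A. Q (insert v A))"
    unfolding pr_formula[OF c1 r] sum_distrib_left
    using W inj by (subst sum.reindex) (auto simp: eq intro!: sum.cong)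
  finally show ?thesis by simp
qed

lemma pr_True: "pr r (\<lambda>_. True) = 1"
  using site.prob_space[of r] by (simp add: pr_def open_event_def)

lemma pr_const: "pr r (\<lambda>_. c) = (if c then 1 else 0)"
  by (simp add: pr_def open_event_def site.prob_space flip: UNIV_def) (use site.prob_space[of r] in simp)

lemma pr_mono:
  assumes "cyl W R" "\<And>A. Q A \<Longrightarrow> R A"
  shows "pr r Q \<le> pr r R"
  unfolding pr_def using assms by (intro site.finite_measure_mono) (auto simp: open_event_def[of Q] open_event_def[of R] intro: sets_open_event[unfolded open_event_def])

lemma pr_not:
  assumes "cyl V Q" shows "pr r (\<lambda>A. \<not> Q A) = 1 - pr r Q"
proof -
  have "open_event (\<lambda>A. \<not> Q A) = space (site_measure r) - open_event Q"
    by (auto simp: open_event_def)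
  then show ?thesis unfolding pr_def using site.prob_compl[OF sets_open_event[OF assms]] by simp
qed

lemma pr_conj_bound:
  assumes "cyl V Q" "cyl W R" "pr r Q \<ge> 1 - a" "pr r R \<ge> 1 - b"
  shows "pr r (\<lambda>A. Q A \<and> R A) \<ge> 1 - (a + b)"
proof -
  have "open_event (\<lambda>A. \<not> (Q A \<and> R A)) = open_event (\<lambda>A. \<not> Q A) \<union> open_event (\<lambda>A. \<not> R A)"
    by (auto simp: open_event_def)
  then have "pr r (\<lambda>A. \<not> (Q A \<and> R A)) \<le> pr r (\<lambda>A. \<not> Q A) + pr r (\<lambda>A. \<not> R A)"
    unfolding pr_def using assms(1,2) by (auto intro!: measure_Un_le sets_open_event cyl_not)
  then show ?thesis
    using assms pr_not[OF cyl_conj[OF assms(1,2)], of r] pr_not[OF assms(1), of r] pr_not[OF assms(2), of r] by simp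
qed

lemma cyl_empty_const: "cyl {} Q \<Longrightarrow> Q = (\<lambda>_. Q {})"
  by (rule ext) (auto simp: cyl_def dest!: spec)

lemma pr_independent:
  assumes "cyl V Q" "cyl W R" "V \<inter> W = {}" and r: "\<And>v. 0 \<le> r v \<and> r v \<le> 1"
  shows "pr r (\<lambda>A. Q A \<and> R A) = pr r Q * pr r R"
proof -
  have "finite V" using assms(1) by (rule cylD)
  then show ?thesis using assms(1,3)
  proof (induction V arbitrary: Q)
    case empty
    obtain c where "Q = (\<lambda>_. c)" using cyl_empty_const[OF empty.prems(1)] by blast
    then show ?case by (simp add: pr_const)
  next
    case (insert v V)
    have V: "insert v V - {v} = V" "V - {v} = V" using insert.hyps by auto
    have R: "R (insert v A) = R A" "R (A - {v}) = R A" for A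
    proof -
      have "insert v A \<inter> W = A \<inter> W" "(A - {v}) \<inter> W = A \<inter> W" using insert.prems(2) by auto
      then show "R (insert v A) = R A" "R (A - {v}) = R A" using cylD(2)[OF assms(2)] by metis+
    qed
    have c: "cyl V (\<lambda>A. Q (insert v A))" "cyl V (\<lambda>A. Q (A - {v}))"
      using cyl_insert[OF insert.prems(1)] cyl_remove[OF insert.prems(1)] V by auto
    have "pr r (\<lambda>A. Q A \<and> R A) = r v * pr r (\<lambda>A. Q (insert v A) \<and> R A) + (1 - r v) * pr r (\<lambda>A. Q (A - {v}) \<and> R A)"
      using pr_condition_site[where r = r and v = v, OF cyl_conj[OF insert.prems(1) assms(2)] r] by (simp add: R)
    also have "\<dots> = (r v * pr r (\<lambda>A. Q (insert v A)) + (1 - r v) * pr r (\<lambda>A. Q (A - {v}))) * pr r R"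
      using insert.IH[OF c(1)] insert.IH[OF c(2)] insert.prems(2) by (simp add: algebra_simps)
    also have "\<dots> = pr r Q * pr r R"
      using pr_condition_site[where r = r and v = v, OF insert.prems(1) r] by simp
    finally show ?case .
  qed
qed

text \<open>
  Conditionally on the site \<open>v\<close>, the induction hypothesis applies; averaging over \<open>v\<close> loses nothing, because both
  conditional probabilities increase when \<open>v\<close> is opened.
\<close>

theorem harris:
  assumes "cyl V Q" "cyl V R" "mono Q" "mono R" and r: "\<And>v. 0 \<le> r v \<and> r v \<le> 1"
  shows "pr r (\<lambda>A. Q A \<and> R A) \<ge> pr r Q * pr r R"
proof -
  have "finite V" using assms(1) by (rule cylD)
  then show ?thesis using assms(1-4)
  proof (induction V arbitrary: Q R)
    case empty
    obtain c where "Q = (\<lambda>_. c)" using cyl_empty_const[OF empty.prems(1)] by blast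
    moreover obtain c' where "R = (\<lambda>_. c')" using cyl_empty_const[OF empty.prems(2)] by blast
    ultimately show ?case by (simp add: pr_const)
  next
    case (insert v V)
    have V: "insert v V - {v} = V" "V - {v} = V" using insert.hyps by auto
    have c: "cyl V (\<lambda>A. P (insert v A))" "cyl V (\<lambda>A. P (A - {v}))" if "cyl (insert v V) P" for P
      using cyl_insert[OF that] cyl_remove[OF that] V by auto
    have m: "mono (\<lambda>A. P (insert v A))" "mono (\<lambda>A. P (A - {v}))" if "mono P" for P
      by (auto intro!: monoI monoD[OF that])
    have ge: "pr r (\<lambda>A. P (A - {v})) \<le> pr r (\<lambda>A. P (insert v A))" if "cyl (insert v V) P" "mono P" for P
    proof (rule pr_mono[OF c(1)[OF that(1)]])
      fix A assume "P (A - {v})"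
      moreover have "A - {v} \<subseteq> insert v A" by blast
      ultimately show "P (insert v A)" using monoD[OF that(2)] by (auto simp: le_bool_def)
    qed
    define q1 q0 r1 r0 where d: "q1 = pr r (\<lambda>A. Q (insert v A))" "q0 = pr r (\<lambda>A. Q (A - {v}))"
      "r1 = pr r (\<lambda>A. R (insert v A))" "r0 = pr r (\<lambda>A. R (A - {v}))"
    have le: "q0 \<le> q1" "r0 \<le> r1" unfolding d using ge[OF insert.prems(1,3)] ge[OF insert.prems(2,4)] by simp_all
    have "pr r Q * pr r R = (r v * q1 + (1 - r v) * q0) * (r v * r1 + (1 - r v) * r0)"
      unfolding d using pr_condition_site[where r = r and v = v, OF insert.prems(1) r] pr_condition_site[where r = r and v = v, OF insert.prems(2) r]
      by simp
    also have "\<dots> = r v * (q1 * r1) + (1 - r v) * (q0 * r0) - r v * (1 - r v) * ((q1 - q0) * (r1 - r0))"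
      by (simp add: algebra_simps)
    also have "\<dots> \<le> r v * (q1 * r1) + (1 - r v) * (q0 * r0)"
      using le r[of v] by (simp add: mult_nonneg_nonneg)
    also have "\<dots> \<le> r v * pr r (\<lambda>A. Q (insert v A) \<and> R (insert v A)) + (1 - r v) * pr r (\<lambda>A. Q (A - {v}) \<and> R (A - {v}))"
      unfolding d using r[of v]
      by (intro add_mono mult_left_mono insert.IH c m insert.prems) simp_all
    also have "\<dots> = pr r (\<lambda>A. Q A \<and> R A)"
      using pr_condition_site[where r = r and v = v, OF cyl_conj[OF insert.prems(1,2)] r] by simp
    finally show ?case .
  qed
qed

lemma harris':
  assumes "cyl V Q" "cyl W R" "mono Q" "mono R" and r: "\<And>v. 0 \<le> r v \<and> r v \<le> 1"
  shows "pr r (\<lambda>A. Q A \<and> R A) \<ge> pr r Q * pr r R"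
  using assms cylD(1)[OF assms(1)] cylD(1)[OF assms(2)]
  by (intro harris[of "V \<union> W"]) (auto intro: cyl_mono)

text \<open>
  The complements of increasing events are positively associated as well.  If one of \<open>Q\<close> and \<open>R\<close> is very likely to occur, this
  makes \<open>Q\<close> or \<open>R\<close> itself likely.
\<close>

lemma square_root_trick:
  assumes "cyl V Q" "cyl W R" "mono Q" "mono R" and r: "\<And>v. 0 \<le> r v \<and> r v \<le> 1"
  shows "(1 - pr r Q) * (1 - pr r R) \<le> 1 - pr r (\<lambda>A. Q A \<or> R A)"
proof -
  have "1 - pr r (\<lambda>A. \<not> (\<not> Q A \<and> \<not> R A)) = pr r (\<lambda>A. \<not> Q A \<and> \<not> R A)"
    using pr_not[OF cyl_conj[OF cyl_not[OF assms(1)] cyl_not[OF assms(2)]], of r] by simp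
  moreover have "pr r (\<lambda>A. Q A \<or> R A) = pr r Q + pr r R - pr r (\<lambda>A. Q A \<and> R A)"
  proof -
    have "open_event (\<lambda>A. Q A \<or> R A) = open_event Q \<union> open_event R"
      "open_event (\<lambda>A. Q A \<and> R A) = open_event Q \<inter> open_event R"
      by (auto simp: open_event_def)
    then show ?thesis unfolding pr_def
      using assms(1,2) by (simp add: measure_Un3 site.fmeasurable_eq_sets sets_open_event)
  qed
  ultimately show ?thesis using harris'[where r = r, OF assms] by (simp add: algebra_simps)
qed

text \<open>
  Relabelling sites along an injection; this covers lattice symmetries, the embedding of the quarter plane and
  the comparison of two inhomogeneous models that agree on \<open>V\<close>.
\<close>

lemma pr_transfer:
  fixes f :: "'u \<Rightarrow> 'v"
  assumes "inj f" "cyl (f ` V) Q" "finite V" "\<And>u. u \<in> V \<Longrightarrow> s (f u) = r u"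
    and r: "\<And>v. 0 \<le> r v \<and> r v \<le> 1" and s: "\<And>v. 0 \<le> s v \<and> s v \<le> 1"
  shows "pr r (\<lambda>A. Q (f ` A)) = pr s Q"
  using assms(3,2,4)
proof (induction V arbitrary: Q)
  case empty
  then have "cyl {} Q" by simp
  then obtain c where "Q = (\<lambda>_. c)" using cyl_empty_const by blast
  then show ?case by (simp add: pr_const)
next
  case (insert v V)
  have fv: "f ` V - {f v} = f ` V" using insert.hyps assms(1) by (auto dest: injD)
  have Q: "cyl (insert (f v) (f ` V)) Q" using insert.prems(1) by simp
  have c: "cyl (f ` V) (\<lambda>A. Q (insert (f v) A))" "cyl (f ` V) (\<lambda>A. Q (A - {f v}))"
    using cyl_insert[OF Q] cyl_remove[OF Q] fv by auto
  have cf: "cyl (insert v V) (\<lambda>A. Q (f ` A))"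
    using cylD(2)[OF insert.prems(1)] insert.hyps assms(1) unfolding cyl_def
    by (metis finite_insert image_Int)
  have im: "f ` (A - {v}) = f ` A - {f v}" for A
    using assms(1) by (simp add: image_set_diff)
  have "pr r (\<lambda>A. Q (f ` A)) = r v * pr r (\<lambda>A. Q (insert (f v) (f ` A))) + (1 - r v) * pr r (\<lambda>A. Q (f ` A - {f v}))"
    using pr_condition_site[where r = r and v = v, OF cf r] by (simp add: im)
  also have "\<dots> = s (f v) * pr s (\<lambda>A. Q (insert (f v) A)) + (1 - s (f v)) * pr s (\<lambda>A. Q (A - {f v}))"
    using insert.IH[OF c(1)] insert.IH[OF c(2)] insert.prems(2) by simp
  also have "\<dots> = pr s Q" using pr_condition_site[where r = s and v = "f v", OF Q s] by simp
  finally show ?case .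
qed

lemma continuous_on_pr:
  assumes "cyl V Q"
  shows "continuous_on {0..1} (\<lambda>p. pr (\<lambda>_. p) Q)"
proof (subst continuous_on_cong[OF refl pr_formula[OF assms]])
  show "continuous_on {0..1} (\<lambda>p. \<Sum>A\<in>Pow V. if Q A then \<Prod>v\<in>V. if v \<in> A then p else 1 - p else 0 :: real)"
  proof (rule continuous_on_sum)
    fix A assume "A \<in> Pow V"
    have "continuous_on {0..1} (\<lambda>p :: real. \<Prod>v\<in>V. if v \<in> A then p else 1 - p)"
    proof (rule continuous_on_prod)
      fix v show "continuous_on {0..1} (\<lambda>p :: real. if v \<in> A then p else 1 - p)"
        by (cases "v \<in> A") (auto intro!: continuous_intros)
    qed
    then show "continuous_on {0..1} (\<lambda>p. if Q A then \<Prod>v\<in>V. if v \<in> A then p else 1 - p else 0 :: real)"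
      by (cases "Q A") auto
  qed
qed auto

section \<open>Rectangle crossings and lattice symmetries\<close>

text \<open>
  Crossings of a rectangle by open nearest-neighbour paths: \<open>lr\<close> from left to right, \<open>tb\<close> between the bottom and
  the top.
\<close>

definition lr :: "int \<Rightarrow> int \<Rightarrow> int \<Rightarrow> int \<Rightarrow> (int \<times> int) set \<Rightarrow> bool" where
  "lr a b c d A \<longleftrightarrow> (\<exists>u v. linked4 (A \<inter> rect a b c d) u v \<and> fst u = a \<and> fst v = b)"

definition tb :: "int \<Rightarrow> int \<Rightarrow> int \<Rightarrow> int \<Rightarrow> (int \<times> int) set \<Rightarrow> bool" where
  "tb a b c d A \<longleftrightarrow> (\<exists>u v. linked4 (A \<inter> rect a b c d) u v \<and> snd u = c \<and> snd v = d)"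

lemma cyl_lr: "cyl (rect a b c d) (lr a b c d)"
  and cyl_tb: "cyl (rect a b c d) (tb a b c d)"
  by (simp_all add: cyl_def lr_def tb_def Int_assoc)

lemma mono_lr: "mono (lr a b c d)"
  unfolding lr_def by (intro monoI le_boolI) (blast intro: linked_subset)

lemma mono_tb: "mono (tb a b c d)"
  unfolding tb_def by (intro monoI le_boolI) (blast intro: linked_subset)

lemma rect_mono: "a' \<le> a \<Longrightarrow> b \<le> b' \<Longrightarrow> c' \<le> c \<Longrightarrow> d \<le> d' \<Longrightarrow> rect a b c d \<subseteq> rect a' b' c' d'"
  by (auto simp: rect_def)

definition isom :: "(int \<times> int \<Rightarrow> int \<times> int) \<Rightarrow> bool" where
  "isom f \<longleftrightarrow> bij f \<and> (\<forall>p q. adj4 (f p) (f q) \<longleftrightarrow> adj4 p q)"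

lemma linked4_isom:
  assumes "isom f"
  shows "linked4 (f ` S) (f u) (f v) \<longleftrightarrow> linked4 S u v"
proof
  assume "linked4 (f ` S) (f u) (f v)"
  moreover have "adj4 x y \<Longrightarrow> adj4 (inv f x) (inv f y)" for x y
    using assms by (metis isom_def bij_inv_eq_iff)
  ultimately have "linked4 (inv f ` f ` S) (inv f (f u)) (inv f (f v))"
    by (rule linked_image)
  then show "linked4 S u v"
    using assms by (simp add: isom_def bij_is_inj)
next
  assume "linked4 S u v"
  then show "linked4 (f ` S) (f u) (f v)"
    using assms by (intro linked_image[where A = adj4]) (auto simp: isom_def)
qed

lemma pr_isom:
  assumes "isom f" "cyl V Q" "0 \<le> p" "p \<le> 1"
  shows "pr (\<lambda>_. p) (\<lambda>A. Q (f ` A)) = pr (\<lambda>_. p) Q"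
proof -
  have b: "bij f" using assms(1) by (simp add: isom_def)
  have V: "f ` (f -` V) = V" "finite (f -` V)"
    using b cylD(1)[OF assms(2)] by (auto simp: bij_is_surj bij_is_inj finite_vimageI)
  show ?thesis
    by (rule pr_transfer[where V = "f -` V"]) (use assms b V in \<open>auto simp: bij_is_inj\<close>)
qed

definition translate :: "int \<Rightarrow> int \<Rightarrow> int \<times> int \<Rightarrow> int \<times> int" where
  "translate s t = (\<lambda>(x, y). (x + s, y + t))"
definition flip_x :: "int \<Rightarrow> int \<times> int \<Rightarrow> int \<times> int" where
  "flip_x k = (\<lambda>(x, y). (k - x, y))"
definition flip_y :: "int \<Rightarrow> int \<times> int \<Rightarrow> int \<times> int" where
  "flip_y k = (\<lambda>(x, y). (x, k - y))"

lemma isom_translate: "isom (translate s t)"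
  by (auto simp: isom_def translate_def adj4_def intro!: o_bij[of "translate (-s) (-t)"])
lemma isom_flip_x: "isom (flip_x k)"
  by (auto simp: isom_def flip_x_def adj4_def intro!: o_bij[of "flip_x k"])
lemma isom_flip_y: "isom (flip_y k)"
  by (auto simp: isom_def flip_y_def adj4_def intro!: o_bij[of "flip_y k"])
lemma isom_swap: "isom prod.swap"
  by (auto simp: isom_def adj4_def)

lemma flip_x_rect: "flip_x k ` rect a b c d = rect (k - b) (k - a) c d"
proof -
  have "(x, y) \<in> flip_x k ` rect a b c d" if "(x, y) \<in> rect (k - b) (k - a) c d" for x y
    using that by (intro image_eqI[of _ _ "(k - x, y)"]) (auto simp: flip_x_def rect_def)
  then show ?thesis by (auto simp: flip_x_def rect_def)
qed
lemma flip_y_rect: "flip_y k ` rect a b c d = rect a b (k - d) (k - c)"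
proof -
  have "(x, y) \<in> flip_y k ` rect a b c d" if "(x, y) \<in> rect a b (k - d) (k - c)" for x y
    using that by (intro image_eqI[of _ _ "(x, k - y)"]) (auto simp: flip_y_def rect_def)
  then show ?thesis by (auto simp: flip_y_def rect_def)
qed
lemma translate_rect: "translate s t ` rect a b c d = rect (a + s) (b + s) (c + t) (d + t)"
proof -
  have "(x, y) \<in> translate s t ` rect a b c d" if "(x, y) \<in> rect (a + s) (b + s) (c + t) (d + t)" for x y
    using that by (intro image_eqI[of _ _ "(x - s, y - t)"]) (auto simp: translate_def rect_def)
  then show ?thesis by (auto simp: translate_def rect_def)
qed
lemma swap_rect: "prod.swap ` rect a b c d = rect c d a b"
  by (force simp: rect_def image_iff)

lemma isom_image_Int: "isom f \<Longrightarrow> f ` (A \<inter> B) = f ` A \<inter> f ` B"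
  by (simp add: isom_def bij_is_inj image_Int)

lemma isom_all: "isom f \<Longrightarrow> (\<exists>u. P u) \<longleftrightarrow> (\<exists>u. P (f u))"
  by (metis isom_def bij_pointE)

lemma lr_translate: "lr (a + s) (b + s) (c + t) (d + t) (translate s t ` A) = lr a b c d A"
  unfolding lr_def translate_rect[symmetric] isom_image_Int[OF isom_translate, symmetric]
  by (subst (1 2) isom_all[OF isom_translate[of s t]])
    (simp add: linked4_isom[OF isom_translate], auto simp: translate_def split_beta)

lemma tb_translate: "tb (a + s) (b + s) (c + t) (d + t) (translate s t ` A) = tb a b c d A"
  unfolding tb_def translate_rect[symmetric] isom_image_Int[OF isom_translate, symmetric]
  by (subst (1 2) isom_all[OF isom_translate[of s t]])
    (simp add: linked4_isom[OF isom_translate], auto simp: translate_def split_beta)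

lemma tb_swap: "tb c d a b (prod.swap ` A) = lr a b c d A"
proof -
  have eq: "prod.swap ` A \<inter> rect c d a b = prod.swap ` (A \<inter> rect a b c d)"
    by (simp add: isom_image_Int[OF isom_swap] swap_rect)
  show ?thesis
    unfolding tb_def lr_def eq
    by (subst (1 2) isom_all[OF isom_swap]) (simp only: linked4_isom[OF isom_swap] snd_swap)
qed

lemma pr_lr_translate:
  assumes "0 \<le> p" "p \<le> 1"
  shows "pr (\<lambda>_. p) (lr (a + s) (b + s) (c + t) (d + t)) = pr (\<lambda>_. p) (lr a b c d)"
  using pr_isom[OF isom_translate[of s t] cyl_lr[of "a + s" "b + s" "c + t" "d + t"] assms]
  by (simp add: lr_translate)

lemma pr_tb_swap:
  assumes "0 \<le> p" "p \<le> 1"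
  shows "pr (\<lambda>_. p) (tb c d a b) = pr (\<lambda>_. p) (lr a b c d)"
  using pr_isom[OF isom_swap cyl_tb[of c d a b] assms] by (simp add: tb_swap)

lemma adj8_swap: "adj8 (prod.swap x) (prod.swap y) \<longleftrightarrow> adj8 x y"
  by (cases x; cases y) (auto simp: adj8_def)

lemma linked4_linked8_meet':
  assumes "linked4 S u v" "S \<subseteq> rect a b c d" "snd u = c" "snd v = d"
    and "linked8 T p q" "T \<subseteq> rect a b c d" "fst p = a" "fst q = b"
  shows "S \<inter> T \<noteq> {}"
proof -
  have "linked4 (prod.swap ` S) (prod.swap u) (prod.swap v)"
    using assms(1) linked4_isom[OF isom_swap] by blast
  moreover have "linked8 (prod.swap ` T) (prod.swap p) (prod.swap q)"
    using assms(5) by (rule linked_image) (simp add: adj8_swap)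
  moreover have "prod.swap ` S \<subseteq> rect c d a b" "prod.swap ` T \<subseteq> rect c d a b"
    using assms(2,6) swap_rect by (metis image_mono)+
  ultimately have "prod.swap ` S \<inter> prod.swap ` T \<noteq> {}"
    using assms by (intro linked4_linked8_meet[where a = c and b = d and c = a and d = b]) auto
  then show ?thesis by auto
qed

lemma lr_tb_linked:
  assumes "linked4 (A \<inter> rect a b c d) u v" "fst u = a" "fst v = b"
    and "linked4 (A \<inter> rect a' b' c' d') p q" "snd p = c'" "snd q = d'"
    and "a \<le> a'" "b' \<le> b" "c' \<le> c" "d \<le> d'"
    and "rect a b c d \<union> rect a' b' c' d' \<subseteq> B"
  shows "linked4 (A \<inter> B) u p"
proof -
  let ?S = "{z. linked4 (A \<inter> rect a b c d) u z}" and ?T = "{z. linked4 (A \<inter> rect a' b' c' d') p z}"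
  have "?S \<inter> ?T \<noteq> {}"
  proof (rule linked4_linked8_meet)
    show "linked4 ?S u v" "linked8 ?T p q"
      using linked_component[OF assms(1)] linked_component[OF assms(4)]
      by (simp_all add: linked_mono[OF _ adj4_imp_adj8 order_refl])
    have "?S \<subseteq> rect a b c d" "?T \<subseteq> rect a' b' c' d'" by (auto dest: linked_inD)
    then show "?S \<subseteq> rect a b c' d'" "?T \<subseteq> rect a b c' d'"
      using assms(7-10) rect_mono[of a a b b c' c d d'] rect_mono[of a a' b' b c' c' d' d'] by auto
  qed (use assms in auto)
  then obtain z where z: "linked4 (A \<inter> rect a b c d) u z" "linked4 (A \<inter> rect a' b' c' d') p z" by blast
  have uz: "linked4 (A \<inter> B) u z" and pz: "linked4 (A \<inter> B) p z"
    by (rule linked_subset[OF z(1)] linked_subset[OF z(2)], use assms(11) in blast)+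
  show ?thesis by (rule linked_trans[OF uz linked4_sym[OF pz]])
qed

section \<open>Exploring the leftmost crossing\<close>

text \<open>
  The closed sites of \<open>S\<close> that are connected to the left side by closed king moves, and the sites that have
  to be open for this exploration to stop.  Unless the exploration reaches the right side, the rim contains the leftmost
  vertical crossing of \<open>S\<close>.
\<close>

definition explored :: "(int \<times> int) set \<Rightarrow> (int \<times> int) set \<Rightarrow> (int \<times> int) set" where
  "explored S A = {z. \<exists>u. fst u = 0 \<and> linked8 (S - A) u z}"

definition rim :: "(int \<times> int) set \<Rightarrow> (int \<times> int) set \<Rightarrow> (int \<times> int) set" where
  "rim S d = {z \<in> S. z \<notin> d \<and> (fst z = 0 \<or> (\<exists>y\<in>d. adj8 y z))}"

lemma exploredI: "fst u = 0 \<Longrightarrow> linked8 (S - A) u z \<Longrightarrow> z \<in> explored S A"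
  unfolding explored_def by blast

lemma exploredE:
  assumes "z \<in> explored S A" obtains u where "fst u = 0" "linked8 (S - A) u z"
  using assms unfolding explored_def by blast

lemma explored_subset: "explored S A \<subseteq> S - A"
  by (auto simp: explored_def dest: linked_inD)

lemma rim_subset: "rim S d \<subseteq> S - d"
  by (auto simp: rim_def)

lemma rim_explored_subset: "rim S (explored S A) \<subseteq> A"
proof
  fix z assume z: "z \<in> rim S (explored S A)"
  show "z \<in> A"
  proof (rule ccontr)
    assume "z \<notin> A"
    then have zS: "z \<in> S - A" using z by (auto simp: rim_def)
    have "z \<in> explored S A"
    proof (cases "fst z = 0")
      case True then show ?thesis using linked_refl[OF zS] by (rule exploredI)
    next
      case False
      then obtain y where y: "adj8 y z" "y \<in> explored S A"
        using z unfolding rim_def by blast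
      from y(2) obtain u where u: "fst u = 0" "linked8 (S - A) u y" by (rule exploredE)
      show ?thesis by (rule exploredI[OF u(1) linked_step[OF u(2) y(1) zS]])
    qed
    then show False using z by (auto simp: rim_def)
  qed
qed

lemma linked8_within_explored:
  assumes "linked8 T u z" "fst u = 0" "T \<subseteq> S - rim S d"
  shows "z \<in> d"
  using assms(1)
proof (induction rule: linked_induct)
  case refl
  then show ?case using assms(2,3) by (auto simp: rim_def)
next
  case (step x y)
  then show ?case using assms(3) by (auto simp: rim_def)
qed

text \<open>
  The exploration inspects only the set \<open>d\<close> that it finds and the rim of \<open>d\<close>, so conditioning on its outcome leaves all other sites
  untouched.
\<close>

lemma explored_eq_iff:
  assumes d: "d = explored S A0"
  shows "explored S A = d \<longleftrightarrow> d \<inter> A = {} \<and> rim S d \<subseteq> A"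
proof
  assume "explored S A = d"
  then show "d \<inter> A = {} \<and> rim S d \<subseteq> A"
    using explored_subset[of S A] rim_explored_subset[of S A] by auto
next
  assume h: "d \<inter> A = {} \<and> rim S d \<subseteq> A"
  have "z \<in> d" if "z \<in> explored S A" for z
  proof -
    from that obtain u where u: "fst u = 0" "linked8 (S - A) u z" by (rule exploredE)
    have "S - A \<subseteq> S - rim S d" using h by blast
    with u show ?thesis using linked8_within_explored by blast
  qed
  moreover have "z \<in> explored S A" if "z \<in> d" for z
  proof -
    from that obtain u where u: "fst u = 0" "linked8 (S - A0) u z" unfolding d by (rule exploredE)
    have "{y. linked8 (S - A0) u y} \<subseteq> S - A"
      using exploredI[OF u(1)] d h explored_subset[of S A0] by blast
    from linked_subset[OF linked_component[OF u(2)] this] show ?thesis by (rule exploredI[OF u(1)])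
  qed
  ultimately show "explored S A = d" by blast
qed

lemma pr_exclusive_sum:
  assumes "finite G" "\<And>d. d \<in> G \<Longrightarrow> cyl V (Q d)" "\<And>d d' A. d \<in> G \<Longrightarrow> d' \<in> G \<Longrightarrow> Q d A \<Longrightarrow> Q d' A \<Longrightarrow> d = d'"
  shows "pr r (\<lambda>A. \<exists>d\<in>G. Q d A) = (\<Sum>d\<in>G. pr r (Q d))"
proof -
  have "open_event (\<lambda>A. \<exists>d\<in>G. Q d A) = (\<Union>d\<in>G. open_event (Q d))"
    by (auto simp: open_event_def)
  moreover have "measure (site_measure r) (\<Union>d\<in>G. open_event (Q d)) = (\<Sum>d\<in>G. measure (site_measure r) (open_event (Q d)))"
  proof (rule site.finite_measure_finite_Union[OF assms(1)])
    show "(\<lambda>d. open_event (Q d)) ` G \<subseteq> sets (site_measure r)"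
      using assms(2) sets_open_event by blast
    show "disjoint_family_on (\<lambda>d. open_event (Q d)) G"
      using assms(3) by (fastforce simp: disjoint_family_on_def open_event_def)
  qed
  ultimately show ?thesis by (simp add: pr_def)
qed

text \<open>
  The rectangle is twice as high as the box, so that reflection in the top side of the box maps it to itself.
\<close>

definition hook :: "int \<Rightarrow> int \<Rightarrow> int \<Rightarrow> (int \<times> int) set \<Rightarrow> bool" where
  "hook a m n A \<longleftrightarrow> (\<exists>u v w. linked4 (A \<inter> rect 0 a 0 n) u v \<and> snd u = 0 \<and> snd v = n \<and>
      linked4 (A \<inter> rect 0 m 0 (2 * n)) u w \<and> fst w = m)"

lemma cyl_hook: "a \<le> m \<Longrightarrow> 0 \<le> n \<Longrightarrow> cyl (rect 0 m 0 (2 * n)) (hook a m n)"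
proof -
  assume "a \<le> m" "0 \<le> n"
  then have "rect 0 m 0 (2 * n) \<inter> rect 0 a 0 n = rect 0 a 0 n"
    using rect_mono[of 0 0 a m 0 0 n "2 * n"] by auto
  then show ?thesis by (simp add: cyl_def hook_def Int_assoc)
qed

lemma tb_explored:
  assumes "tb 0 a 0 n A" "z \<in> explored (rect 0 a 0 n) A"
  shows "fst z \<noteq> a"
proof
  assume "fst z = a"
  from assms(2) obtain u where u: "fst u = 0" "linked8 (rect 0 a 0 n - A) u z" by (rule exploredE)
  obtain x y where "linked4 (A \<inter> rect 0 a 0 n) x y" "snd x = 0" "snd y = n"
    using assms(1) unfolding tb_def by blast
  then have "(A \<inter> rect 0 a 0 n) \<inter> (rect 0 a 0 n - A) \<noteq> {}"
    using u \<open>fst z = a\<close> by (intro linked4_linked8_meet'[of _ x y 0 a 0 n _ u z]) auto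
  then show False by blast
qed

text \<open>
  When the exploration does not reach the right side, a closed crossing by king moves that avoids the rim would
  have to stay inside the explored set; duality then yields an open crossing inside the rim.
\<close>

lemma rim_crossing:
  assumes "0 \<le> a" "0 \<le> n" "\<forall>z\<in>d. fst z \<noteq> a"
  obtains u v where "linked4 (rim (rect 0 a 0 n) d) u v" "snd u = 0" "snd v = n"
proof -
  let ?S = "rect 0 a 0 n"
  have "\<not> (linked8 (?S - rim ?S d) u v \<and> fst u = 0 \<and> fst v = a)" for u v
    using linked8_within_explored[of "?S - rim ?S d" u v ?S d] assms(3) by blast
  moreover have "rim ?S d \<inter> ?S = rim ?S d" using rim_subset[of ?S d] by blast
  ultimately have "\<exists>u v. linked4 (rim ?S d) u v \<and> snd u = 0 \<and> snd v = n"
    using crossing_duality[OF assms(1,2), of "rim ?S d"] by (simp only:) blast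
  then show ?thesis using that by blast
qed

text \<open>
  Fix the outcome \<open>d\<close> of the exploration from the left side and reflect \<open>d\<close>, together with a vertical crossing in its
  rim, in the line \<open>y = n\<close>.  A horizontal crossing of the doubled rectangle has to reach this
  reflected barrier from the right without entering \<open>d\<close> or its mirror image.  By symmetry and the square root trick it is
  likely to reach the original half of the barrier, an increasing event that does not involve the sites of \<open>d\<close>.  The event that \<open>d\<close> is explored
  requires the rim to be open and \<open>d\<close> to be closed, so it does not make this less likely.
\<close>

theorem pr_hook:
  assumes a: "0 \<le> a" "a \<le> m" and n: "0 \<le> n" and p: "0 \<le> p" "p \<le> 1"
  shows "pr (\<lambda>_. p) (hook a m n) \<ge>
    pr (\<lambda>_. p) (tb 0 a 0 n) * (1 - sqrt (1 - pr (\<lambda>_. p) (lr 0 m 0 (2 * n))))"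
proof -
  let ?P = "pr (\<lambda>_ :: int \<times> int. p)"
  define S where "S = rect 0 a 0 n"
  define R where "R = rect 0 m 0 (2 * n)"
  define \<rho> where "\<rho> = flip_y (2 * n)"
  have SR: "S \<subseteq> R" unfolding S_def R_def using a n by (intro rect_mono) auto
  have rho: "isom \<rho>" "\<rho> ` R = R" "\<rho> (\<rho> x) = x" "fst (\<rho> x) = fst x" "snd (\<rho> x) = 2 * n - snd x"
    "adj8 (\<rho> x) (\<rho> y) = adj8 x y" for x y
    by (auto simp: \<rho>_def isom_flip_y R_def flip_y_rect)
      (auto simp: flip_y_def adj8_def split_beta prod_eq_iff)
  have rho_img: "x \<in> \<rho> ` X \<longleftrightarrow> \<rho> x \<in> X" for x X
    using rho(3) by (metis image_iff)
  define \<kappa> where "\<kappa> = 1 - sqrt (1 - ?P (lr 0 m 0 (2 * n)))"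
  define G where "G = {d \<in> explored S ` Pow S. \<forall>z\<in>d. fst z \<noteq> a}"
  have finG: "finite G" by (simp add: G_def S_def)
  have expl_cut: "explored S A = explored S (A \<inter> S)" for A
  proof -
    have "S - A = S - (A \<inter> S)" by blast
    then show ?thesis by (simp add: explored_def)
  qed
  have key: "\<exists>E. cyl R E \<and> ?P (\<lambda>A. explored S A = d \<and> E A) \<ge> ?P (\<lambda>A. explored S A = d) * \<kappa> \<and>
      (\<forall>A. explored S A = d \<and> E A \<longrightarrow> hook a m n A)" if dG: "d \<in> G" for d
  proof -
    obtain A0 where d: "d = explored S A0" using dG by (auto simp: G_def)
    have far: "\<forall>z\<in>d. fst z \<noteq> a" using dG by (auto simp: G_def)
    have dS: "d \<subseteq> S" using d explored_subset by blast
    define F where "F = rim S d"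
    have FS: "F \<subseteq> S" "F \<inter> d = {}" using rim_subset[of S d] by (auto simp: F_def)
    obtain u v where uv: "linked4 F u v" "snd u = 0" "snd v = n"
      using rim_crossing[OF a(1) n far] unfolding F_def S_def by blast
    define \<Gamma> where "\<Gamma> = {z. linked4 F u z}"
    have GF: "\<Gamma> \<subseteq> F" by (auto simp: \<Gamma>_def dest: linked_inD)
    have Guv: "linked4 \<Gamma> u v" unfolding \<Gamma>_def by (rule linked_component[OF uv(1)])
    define D where "D = d \<union> \<rho> ` d"
    have rhoD: "\<rho> ` D = D" using rho(3) by (auto simp: D_def image_Un image_image)
    (* The barrier is reached from the right in the lower half (E), or in the mirror image (E'). *)
    define E where "E A \<longleftrightarrow> (\<exists>w z. linked4 (A \<inter> R - D) w z \<and> fst w = m \<and> z \<in> \<Gamma>)" for A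
    define E' where "E' A \<longleftrightarrow> (\<exists>w z. linked4 (A \<inter> R - D) w z \<and> fst w = m \<and> z \<in> \<rho> ` \<Gamma>)" for A
    have cyl: "cyl (R - d) E" "cyl R E" "cyl R E'"
    proof -
      have "A \<inter> (R - d) \<inter> R - D = A \<inter> R - D" "A \<inter> R \<inter> R - D = A \<inter> R - D" for A
        by (auto simp: D_def)
      then show "cyl (R - d) E" "cyl R E" "cyl R E'" by (simp_all add: cyl_def E_def E'_def R_def)
    qed
    have mono: "mono E" "mono E'"
    proof -
      have "linked4 (B \<inter> R - D) w z" if "A \<subseteq> B" "linked4 (A \<inter> R - D) w z" for A B w z
        by (rule linked_subset[OF that(2)]) (use that(1) in blast)
      then show "mono E" "mono E'" unfolding E_def E'_def
        by (intro monoI le_boolI; blast)+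
    qed
    have E': "E' A = E (\<rho> ` A)" for A
    proof -
      have eq: "\<rho> ` A \<inter> R - D = \<rho> ` (A \<inter> R - D)"
        using rho(1) by (simp add: isom_def bij_is_inj image_set_diff image_Int rho(2) rhoD)
      have "E (\<rho> ` A) \<longleftrightarrow> (\<exists>w z. linked4 (\<rho> ` (A \<inter> R - D)) (\<rho> w) (\<rho> z) \<and> fst (\<rho> w) = m \<and> \<rho> z \<in> \<Gamma>)"
        unfolding E_def eq by (subst (1 2) isom_all[OF rho(1)]) (rule refl)
      then show ?thesis by (simp add: linked4_isom[OF rho(1)] rho(4) rho_img E'_def)
    qed
    then have PE': "?P E' = ?P E"
      using pr_isom[OF rho(1) cyl(2) p] by presburger
    have cover: "E A \<or> E' A" if "lr 0 m 0 (2 * n) A" for A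
    proof (rule ccontr)
      assume no: "\<not> (E A \<or> E' A)"
      obtain x w where xw: "linked4 (A \<inter> R) x w" "fst x = 0" "fst w = m"
        using \<open>lr 0 m 0 (2 * n) A\<close> unfolding lr_def R_def by blast
      have inS: "fst z \<le> a \<and> snd z \<le> n" if "z \<in> S" for z using that by (simp add: S_def mem_rect)
      have wD: "w \<notin> D"
      proof
        assume "w \<in> D"
        then have "w \<in> d \<or> \<rho> w \<in> d" by (auto simp: D_def rho_img)
        then have "\<exists>z\<in>d. fst z = m" using xw(3) rho(4)[of w] by metis
        then show False using far dS inS a by fastforce
      qed
      (* W is the cluster of the right end.  If it met no barrier, then W and the explored sets would
         together connect the left and the right side by king moves and avoid the barrier. *)
      define W where "W = {y. linked4 (A \<inter> R - D) w y}"
      have wW: "w \<in> W" unfolding W_def using linked_inD(2)[OF xw(1)] wD by (auto intro: linked_refl)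
      have WW: "linked8 (D \<union> W) y w" if "y \<in> W" for y
      proof -
        have "linked4 W w y" using linked_component[of adj4 "A \<inter> R - D" w y] that by (simp add: W_def)
        then show ?thesis by (intro linked_mono[OF linked4_sym adj4_imp_adj8]) auto
      qed
      have dd: "\<exists>t. fst t = 0 \<and> linked8 (D \<union> W) t y" if "y \<in> d" for y
      proof -
        from that obtain t where t: "fst t = 0" "linked8 (S - A0) t y" unfolding d by (rule exploredE)
        have "{y. linked8 (S - A0) t y} \<subseteq> D \<union> W"
          using exploredI[OF t(1)] unfolding d D_def by blast
        from linked_subset[OF linked_component[OF t(2)] this] t(1) show ?thesis by blast
      qed
      have rd: "\<exists>t. fst t = 0 \<and> linked8 (D \<union> W) t y" if "y \<in> \<rho> ` d" for y
      proof -
        have "\<rho> y \<in> d" using that rho_img by blast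
        then obtain t where t: "fst t = 0" "linked8 (S - A0) t (\<rho> y)" unfolding d by (rule exploredE)
        have "{y. linked8 (S - A0) t y} \<subseteq> d" using exploredI[OF t(1)] unfolding d by blast
        from linked_subset[OF linked_component[OF t(2)] this]
        have "linked8 (\<rho> ` d) (\<rho> t) (\<rho> (\<rho> y))" by (rule linked_image) (simp add: rho)
        then have "linked8 (D \<union> W) (\<rho> t) y" unfolding rho(3) by (rule linked_subset) (auto simp: D_def)
        then show ?thesis using t(1) rho(4) by metis
      qed
      have "\<exists>t. fst t = 0 \<and> linked8 (D \<union> W) t w"
      proof -
        have eq: "A \<inter> R \<inter> - D = A \<inter> R - D" by blast
        have "linked4 (A \<inter> R) w x" by (rule linked4_sym[OF xw(1)])
        from linked_stays_or_leaves[OF this, of "- D"] wD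
        have "x \<in> W \<or> (\<exists>y y'. y \<in> W \<and> adj4 y y' \<and> y' \<in> D)" by (auto simp: W_def eq)
        then show ?thesis
        proof
          assume "x \<in> W" then show ?thesis using WW xw(2) by blast
        next
          assume "\<exists>y y'. y \<in> W \<and> adj4 y y' \<and> y' \<in> D"
          then obtain y y' where y: "y \<in> W" "adj4 y y'" "y' \<in> D" by blast
          have "y' \<in> d \<or> y' \<in> \<rho> ` d" using y(3) by (simp add: D_def)
          then obtain t where t: "fst t = 0" "linked8 (D \<union> W) t y'" using dd rd by blast
          have "adj8 y' y" using y(2) adj4_imp_adj8 adj4_sym by blast
          then have "linked8 (D \<union> W) t y" by (rule linked_step[OF t(2)]) (use y(1) in blast)
          from linked_trans[OF this WW[OF y(1)]] show ?thesis using t(1) by blast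
        qed
      qed
      then obtain t where t: "fst t = 0" "linked8 (D \<union> W) t w" by blast
      have rv: "\<rho> v = v" using rho(4,5)[of v] uv(3) by (simp add: prod_eq_iff)
      have "linked4 (\<rho> ` \<Gamma>) (\<rho> v) (\<rho> u)"
        unfolding linked4_isom[OF rho(1)] by (rule linked4_sym[OF Guv])
      then have "linked4 (\<rho> ` \<Gamma>) v (\<rho> u)" by (simp only: rv)
      from linked_trans[OF linked_subset[OF Guv Un_upper1] linked_subset[OF this Un_upper2]]
      have "linked4 (\<Gamma> \<union> \<rho> ` \<Gamma>) u (\<rho> u)" .
      moreover have sub: "\<Gamma> \<union> \<rho> ` \<Gamma> \<subseteq> R" "D \<union> W \<subseteq> R"
      proof -
        have "\<Gamma> \<subseteq> R" "d \<subseteq> R" "W \<subseteq> R"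
          using GF FS(1) SR dS linked_inD(2)[of adj4 "A \<inter> R - D" w] unfolding W_def by blast+
        then show "\<Gamma> \<union> \<rho> ` \<Gamma> \<subseteq> R" "D \<union> W \<subseteq> R"
          using image_mono[of _ R \<rho>] unfolding D_def rho(2) by (metis Un_least)+
      qed
      ultimately have "(\<Gamma> \<union> \<rho> ` \<Gamma>) \<inter> (D \<union> W) \<noteq> {}"
        using uv(2) rho(5)[of u] t xw(3) unfolding R_def
        by (intro linked4_linked8_meet'[of _ u "\<rho> u" 0 m 0 "2 * n" _ t w]) auto
      then obtain z where z: "z \<in> \<Gamma> \<union> \<rho> ` \<Gamma>" "z \<in> D \<union> W" by blast
      have "z \<notin> W" using z(1) no xw(3) unfolding W_def E_def E'_def by blast
      have far': "False" if "y \<in> \<Gamma>" "y \<in> D" for y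
      proof -
        have "y \<in> S" "y \<notin> d" using that(1) GF FS by auto
        then have "\<rho> y \<in> d" using that(2) rho_img by (auto simp: D_def)
        then have "\<rho> y \<in> S" using dS by blast
        then have "snd y = n" using inS[of y] inS[of "\<rho> y"] \<open>y \<in> S\<close> rho(5)[of y] by linarith
        then have "\<rho> y = y" using rho(4,5)[of y] by (simp add: prod_eq_iff)
        then show False using \<open>\<rho> y \<in> d\<close> \<open>y \<notin> d\<close> by simp
      qed
      have "z \<in> D" using z \<open>z \<notin> W\<close> by blast
      then have "\<rho> z \<in> D" using rhoD rho_img by blast
      then show False using z(1) far'[of z] far'[of "\<rho> z"] \<open>z \<in> D\<close> rho_img by blast
    qed
    have "(1 - ?P E) * (1 - ?P E) \<le> 1 - ?P (\<lambda>A. E A \<or> E' A)"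
      using square_root_trick[OF cyl(2,3) mono, of "\<lambda>_. p"] p PE' by simp
    also have "\<dots> \<le> 1 - ?P (lr 0 m 0 (2 * n))"
      using pr_mono[OF cyl_disj[OF cyl(2,3)], of "lr 0 m 0 (2 * n)" "\<lambda>_. p"] cover by auto
    finally have "1 - ?P E \<le> sqrt (1 - ?P (lr 0 m 0 (2 * n)))"
      by (intro real_le_rsqrt) (simp add: power2_eq_square)
    then have PE: "?P E \<ge> \<kappa>" by (simp add: \<kappa>_def)
    have ev: "(explored S A = d) \<longleftrightarrow> d \<inter> A = {} \<and> F \<subseteq> A" for A
      using explored_eq_iff[OF d] by (simp add: F_def)
    have fin: "finite d" "finite F" "finite R"
      using finite_subset[OF dS] finite_subset[OF FS(1)] by (simp_all add: S_def R_def)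
    have c1: "cyl d (\<lambda>A. d \<inter> A = {})" and c2: "cyl F (\<lambda>A. F \<subseteq> A)"
      using fin by (auto simp: cyl_def)
    have m2: "mono (\<lambda>A. F \<subseteq> A)" by (intro monoI le_boolI) blast
    have "?P (\<lambda>A. explored S A = d) * \<kappa> \<le> ?P (\<lambda>A. explored S A = d) * ?P E"
      by (rule mult_left_mono[OF PE pr_nonneg])
    also have "\<dots> = ?P (\<lambda>A. d \<inter> A = {}) * (?P (\<lambda>A. F \<subseteq> A) * ?P E)"
      using pr_independent[OF c1 c2, of "\<lambda>_. p"] FS p by (auto simp: ev)
    also have "\<dots> \<le> ?P (\<lambda>A. d \<inter> A = {}) * ?P (\<lambda>A. F \<subseteq> A \<and> E A)"
      using harris'[OF c2 cyl(1) m2 mono(1), of "\<lambda>_. p"] p by (intro mult_left_mono pr_nonneg) auto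
    also have "\<dots> = ?P (\<lambda>A. d \<inter> A = {} \<and> (F \<subseteq> A \<and> E A))"
      by (rule pr_independent[OF c1 cyl_conj[OF c2 cyl(1)], symmetric]) (use FS p in auto)
    also have "\<dots> = ?P (\<lambda>A. explored S A = d \<and> E A)"
      by (simp add: ev conj_assoc)
    finally have bound: "?P (\<lambda>A. explored S A = d \<and> E A) \<ge> ?P (\<lambda>A. explored S A = d) * \<kappa>" .
    have "hook a m n A" if h: "explored S A = d" "E A" for A
    proof -
      have FA: "F \<subseteq> A" using h ev by auto
      obtain w z where wz: "linked4 (A \<inter> R - D) w z" "fst w = m" "z \<in> \<Gamma>" using h(2) unfolding E_def by blast
      have sub: "F \<subseteq> A \<inter> S" "F \<subseteq> A \<inter> R" "A \<inter> R - D \<subseteq> A \<inter> R" using FA FS(1) SR by auto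
      have "linked4 F u z" using wz(3) by (simp add: \<Gamma>_def)
      from linked_trans[OF linked_subset[OF this sub(2)] linked4_sym[OF linked_subset[OF wz(1) sub(3)]]]
      show ?thesis using linked_subset[OF uv(1) sub(1)] uv(2,3) wz(2)
        unfolding hook_def S_def R_def by blast
    qed
    then show ?thesis using cyl(2) bound by blast
  qed
  have "\<exists>E. \<forall>d\<in>G. cyl R (E d) \<and> ?P (\<lambda>A. explored S A = d \<and> E d A) \<ge> ?P (\<lambda>A. explored S A = d) * \<kappa> \<and>
      (\<forall>A. explored S A = d \<and> E d A \<longrightarrow> hook a m n A)"
    by (rule bchoice, rule ballI, rule key)
  then obtain E where E: "\<And>d. d \<in> G \<Longrightarrow> cyl R (E d)"
    "\<And>d. d \<in> G \<Longrightarrow> ?P (\<lambda>A. explored S A = d \<and> E d A) \<ge> ?P (\<lambda>A. explored S A = d) * \<kappa>"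
    "\<And>d A. d \<in> G \<Longrightarrow> explored S A = d \<Longrightarrow> E d A \<Longrightarrow> hook a m n A" by blast
  have cex: "cyl R (\<lambda>A. explored S A = d)" for d
  proof -
    have "A \<inter> R \<inter> S = A \<inter> S" for A using SR by blast
    then have "explored S (A \<inter> R) = explored S A" for A
      by (subst (1 2) expl_cut) simp
    then show ?thesis by (simp add: cyl_def R_def)
  qed
  have cexE: "cyl R (\<lambda>A. explored S A = d \<and> E d A)" if "d \<in> G" for d
    using cyl_conj[OF cex E(1)[OF that]] by simp
  have "?P (tb 0 a 0 n) \<le> ?P (\<lambda>A. \<exists>d\<in>G. explored S A = d)"
  proof (rule pr_mono)
    have "explored S (A \<inter> R) = explored S A" for A using cex unfolding cyl_def by blast
    then show "cyl R (\<lambda>A. \<exists>d\<in>G. explored S A = d)" by (simp add: cyl_def R_def)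
    show "\<exists>d\<in>G. explored S A = d" if "tb 0 a 0 n A" for A
    proof -
      have "explored S A \<in> explored S ` Pow S" by (subst expl_cut) blast
      then show ?thesis using tb_explored[OF that] unfolding G_def S_def by blast
    qed
  qed
  also have "\<dots> = (\<Sum>d\<in>G. ?P (\<lambda>A. explored S A = d))"
    by (rule pr_exclusive_sum[OF finG cex]) auto
  finally have tb: "?P (tb 0 a 0 n) \<le> (\<Sum>d\<in>G. ?P (\<lambda>A. explored S A = d))" .
  have \<kappa>0: "0 \<le> \<kappa>" by (simp add: \<kappa>_def pr_nonneg)
  have "?P (tb 0 a 0 n) * \<kappa> \<le> (\<Sum>d\<in>G. ?P (\<lambda>A. explored S A = d) * \<kappa>)"
    using mult_right_mono[OF tb \<kappa>0] by (simp add: sum_distrib_right)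
  also have "\<dots> \<le> (\<Sum>d\<in>G. ?P (\<lambda>A. explored S A = d \<and> E d A))"
    by (intro sum_mono E(2))
  also have "\<dots> = ?P (\<lambda>A. \<exists>d\<in>G. explored S A = d \<and> E d A)"
    by (rule pr_exclusive_sum[OF finG cexE, symmetric]) auto
  also have "\<dots> \<le> ?P (hook a m n)"
    using E(3) by (intro pr_mono[OF cyl_hook[OF a(2) n]]) blast
  finally show ?thesis by (simp add: \<kappa>_def)
qed

section \<open>Hooks that must meet\<close>

lemma linked4_horizontal:
  assumes "x \<le> x'" "\<And>z. x \<le> z \<Longrightarrow> z \<le> x' \<Longrightarrow> (z, y) \<in> S"
  shows "linked4 S (x, y) (x', y)"
  using assms
proof (induction x' rule: int_ge_induct)
  case base then show ?case by (auto intro: linked_refl)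
next
  case (step i)
  have "linked4 S (x, y) (i, y)" using step by auto
  then show ?case by (rule linked_step) (use step in \<open>auto simp: adj4_def\<close>)
qed

lemma linked4_vertical:
  assumes "y \<le> y'" "\<And>z. y \<le> z \<Longrightarrow> z \<le> y' \<Longrightarrow> (x, z) \<in> S"
  shows "linked4 S (x, y) (x, y')"
  using assms
proof (induction y' rule: int_ge_induct)
  case base then show ?case by (auto intro: linked_refl)
next
  case (step i)
  have "linked4 S (x, y) (x, i)" using step by auto
  then show ?case by (rule linked_step) (use step in \<open>auto simp: adj4_def\<close>)
qed

text \<open>
  One path joins the left side to the bottom, the other the right side to a point of the bottom further left.  Extended along an
  additional row and column, they become a horizontal and a vertical crossing, so they meet.
\<close>

lemma interlaced_linked:
  assumes L: "linked4 (A \<inter> rect l r 0 h) w2 z2" "fst w2 = l" "snd z2 = 0"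
    and R: "linked4 (A \<inter> rect l r 0 h) w1 z1" "fst w1 = r" "snd z1 = 0"
    and lt: "fst z1 < fst z2"
  shows "linked4 (A \<inter> rect l r 0 h) w2 w1"
proof -
  let ?Q = "A \<inter> rect l r 0 h"
  define K2 where "K2 = {z. linked4 ?Q w2 z}"
  define K1 where "K1 = {z. linked4 ?Q w1 z}"
  have K: "K1 \<subseteq> rect l r 0 h" "K2 \<subseteq> rect l r 0 h"
    using linked_inD(2)[of adj4 ?Q] unfolding K1_def K2_def by blast+
  have k2: "linked4 K2 w2 z2" and k1: "linked4 K1 w1 z1"
    unfolding K1_def K2_def by (rule linked_component, fact)+
  define T where "T = K2 \<union> {z. snd z = -1 \<and> fst z2 \<le> fst z \<and> fst z \<le> r + 1}"
  define S where "S = insert (fst z1, -1) (K1 \<union> {z. fst z = r + 1 \<and> snd w1 \<le> snd z \<and> snd z \<le> h})"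
  have w1K: "w1 \<in> K1" "z1 \<in> K1" "z2 \<in> K2" using linked_inD[OF k1] linked_inD[OF k2] by auto
  have kin: "l \<le> fst z \<and> fst z \<le> r \<and> 0 \<le> snd z \<and> snd z \<le> h" if "z \<in> K1 \<or> z \<in> K2" for z
    using that K mem_rect[of z] by blast
  have in1: "l \<le> fst z1" "fst z1 \<le> r" "fst z2 \<le> r" "0 \<le> snd w1" "snd w1 \<le> h" "l \<le> fst z2" "0 \<le> h" "l \<le> r"
    using kin[of w1] kin[of z1] kin[of z2] w1K by auto
  have "linked4 T w2 z2" by (rule linked_subset[OF k2]) (auto simp: T_def)
  moreover have "adj4 z2 (fst z2, -1)" "(fst z2, -1) \<in> T"
    using L(3) in1 by (auto simp: adj4_def T_def)
  moreover have "linked4 T (fst z2, -1) (r + 1, -1)"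
    by (rule linked4_horizontal) (use in1 in \<open>auto simp: T_def\<close>)
  ultimately have T: "linked4 T w2 (r + 1, -1)" using linked_step linked_trans by metis
  have "linked4 S w1 z1" by (rule linked_subset[OF k1]) (auto simp: S_def)
  moreover have "adj4 z1 (fst z1, -1)" "(fst z1, -1) \<in> S"
    using R(3) in1 by (auto simp: adj4_def S_def)
  ultimately have S1: "linked4 S w1 (fst z1, -1)" using linked_step by metis
  have "w1 \<in> S" using w1K by (simp add: S_def)
  moreover have "adj4 w1 (r + 1, snd w1)" "(r + 1, snd w1) \<in> S"
    using R(2) in1 by (auto simp: adj4_def S_def)
  moreover have "linked4 S (r + 1, snd w1) (r + 1, h)"
    by (rule linked4_vertical) (use in1 in \<open>auto simp: S_def\<close>)
  ultimately have S2: "linked4 S w1 (r + 1, h)" using linked_step linked_trans linked_refl by metis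
  have S: "linked4 S (fst z1, -1) (r + 1, h)" by (rule linked_trans[OF linked4_sym[OF S1] S2])
  have T8: "linked8 T w2 (r + 1, -1)" by (rule linked_mono[OF T adj4_imp_adj8 order_refl])
  have "S \<subseteq> rect l (r + 1) (-1) h" "T \<subseteq> rect l (r + 1) (-1) h"
  proof -
    have "z \<in> rect l (r + 1) (-1) h" if "z \<in> S \<or> z \<in> T" for z
      using that in1 kin[of z] unfolding S_def T_def mem_rect by auto
    then show "S \<subseteq> rect l (r + 1) (-1) h" "T \<subseteq> rect l (r + 1) (-1) h" by blast+
  qed
  from linked4_linked8_meet'[OF S this(1) _ _ T8 this(2)] L(2)
  obtain z where z: "z \<in> S" "z \<in> T" by auto
  have "z \<in> K1 \<inter> K2"
  proof -
    have "\<not> (z \<in> K1 \<and> snd z = -1)" "\<not> (z \<in> K2 \<and> fst z = r + 1)" "\<not> (z \<in> K2 \<and> snd z = -1)"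
      using kin[of z] by auto
    then show ?thesis using z lt in1 unfolding S_def T_def by auto
  qed
  then have "linked4 ?Q w1 z" "linked4 ?Q w2 z" by (auto simp: K1_def K2_def)
  then show ?thesis using linked_trans[OF _ linked4_sym] by metis
qed

text \<open>
  The first hook, which leads to the right, has a point \<open>q\<close> to the left of the entire box in which the second hook starts.  If
  the second hook has a bottom point to the right of the starting point \<open>u1\<close> of the first, the two hooks are
  interlaced.  Otherwise the bottom row to the right of \<open>u1\<close>, the path from \<open>u1\<close> to \<open>q\<close>, and the row to the left of \<open>q\<close> form a
  horizontal barrier in the strip of height \<open>n\<close>, which the vertical crossing in the second hook has to cross; it can do
  so only at a site of the first hook.
\<close>

theorem hooks_linked:
  assumes \<tau>: "0 < \<tau>" "\<tau> \<le> m - a" "0 \<le> a" "0 \<le> n"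
    and H1: "linked4 (A \<inter> rect (- \<tau>) (a - \<tau>) 0 n) u1 q" "snd u1 = 0" "fst q < 0"
      "linked4 (A \<inter> rect (- \<tau>) (m - \<tau>) 0 (2 * n)) u1 w1" "fst w1 = m - \<tau>"
    and H2: "linked4 (A \<inter> rect 0 a 0 n) u2 v2" "snd u2 = 0" "snd v2 = n"
      "linked4 (A \<inter> rect (a - m) a 0 (2 * n)) u2 w2" "fst w2 = a - m"
  shows "linked4 (A \<inter> rect (a - m) (m - \<tau>) 0 (2 * n)) w2 w1"
proof -
  let ?Q = "A \<inter> rect (a - m) (m - \<tau>) 0 (2 * n)"
  have sub: "A \<inter> rect (- \<tau>) (a - \<tau>) 0 n \<subseteq> ?Q" "A \<inter> rect (- \<tau>) (m - \<tau>) 0 (2 * n) \<subseteq> ?Q"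
    "A \<inter> rect 0 a 0 n \<subseteq> ?Q" "A \<inter> rect (a - m) a 0 (2 * n) \<subseteq> ?Q"
    using \<tau> by (auto simp: mem_rect)
  define K1 where "K1 = {z. linked4 (A \<inter> rect (- \<tau>) (a - \<tau>) 0 n) u1 z}"
  define K2 where "K2 = {z. linked4 (A \<inter> rect 0 a 0 n) u2 z}"
  have w1u1: "linked4 ?Q w1 u1" by (rule linked4_sym[OF linked_subset[OF H1(4) sub(2)]])
  have w2u2: "linked4 ?Q w2 u2" by (rule linked4_sym[OF linked_subset[OF H2(4) sub(4)]])
  have r1: "linked4 ?Q w1 z" if "z \<in> K1" for z
    using that linked_trans[OF w1u1 linked_subset[OF _ sub(1)]] by (simp add: K1_def)
  have r2: "linked4 ?Q w2 z" if "z \<in> K2" for z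
    using that linked_trans[OF w2u2 linked_subset[OF _ sub(3)]] by (simp add: K2_def)
  show ?thesis
  proof (cases "\<exists>z\<in>K2. snd z = 0 \<and> fst u1 < fst z")
    case True
    then obtain z where z: "z \<in> K2" "snd z = 0" "fst u1 < fst z" by blast
    show ?thesis by (rule interlaced_linked[OF r2[OF z(1)] H2(5) z(2) w1u1 H1(5) H1(2) z(3)])
  next
    case False
    define T where "T = {z. snd z = 0 \<and> fst u1 \<le> fst z \<and> fst z \<le> a} \<union> K1 \<union> {z. snd z = snd q \<and> - \<tau> \<le> fst z \<and> fst z \<le> fst q}"
    have K: "K1 \<subseteq> rect (- \<tau>) (a - \<tau>) 0 n" "K2 \<subseteq> rect 0 a 0 n"
      using linked_inD(2)[of adj4] unfolding K1_def K2_def by blast+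
    have qK: "q \<in> K1" "u1 \<in> K1" using H1(1) linked_refl[OF linked_inD(1)[OF H1(1)]] by (auto simp: K1_def)
    have kin1: "- \<tau> \<le> fst z \<and> fst z \<le> a - \<tau> \<and> 0 \<le> snd z \<and> snd z \<le> n" if "z \<in> K1" for z
      using that K(1) mem_rect[of z] by blast
    have kin2: "0 \<le> fst z \<and> fst z \<le> a \<and> 0 \<le> snd z \<and> snd z \<le> n" if "z \<in> K2" for z
      using that K(2) mem_rect[of z] by blast
    have inq: "- \<tau> \<le> fst q" "0 \<le> snd q" "snd q \<le> n" "- \<tau> \<le> fst u1" "fst u1 \<le> a - \<tau>"
      using kin1[OF qK(1)] kin1[OF qK(2)] by auto
    have k1: "linked4 K1 u1 q" unfolding K1_def by (rule linked_component[OF H1(1)])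
    have "K1 \<subseteq> T" by (auto simp: T_def)
    from linked_subset[OF linked4_sym[OF k1] this] have t2: "linked4 T q u1" .
    have t1: "linked4 T (- \<tau>, snd q) (fst q, snd q)"
      by (rule linked4_horizontal) (use inq in \<open>auto simp: T_def\<close>)
    have t3: "linked4 T (fst u1, 0) (a, 0)"
      by (rule linked4_horizontal) (use inq \<tau> in \<open>auto simp: T_def\<close>)
    have eq: "(fst q, snd q) = q" "(fst u1, 0) = u1" using H1(2) by (simp_all add: prod_eq_iff)
    have T4: "linked4 T (- \<tau>, snd q) (a, 0)"
      using linked_trans[OF t1[unfolded eq(1)] linked_trans[OF t2 t3[unfolded eq(2)]]] .
    have T: "linked8 T (- \<tau>, snd q) (a, 0)"
      by (rule linked_mono[OF T4 adj4_imp_adj8 order_refl])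
    have S: "linked4 K2 u2 v2" unfolding K2_def by (rule linked_component[OF H2(1)])
    have "T \<subseteq> rect (- \<tau>) a 0 n" "K2 \<subseteq> rect (- \<tau>) a 0 n"
    proof -
      have "z \<in> rect (- \<tau>) a 0 n" if "z \<in> T \<or> z \<in> K2" for z
        using that inq \<tau> H1(3) kin1[of z] kin2[of z] unfolding T_def mem_rect by auto
      then show "T \<subseteq> rect (- \<tau>) a 0 n" "K2 \<subseteq> rect (- \<tau>) a 0 n" by blast+
    qed
    from linked4_linked8_meet'[OF S this(2) H2(2,3) T this(1)]
    obtain z where z: "z \<in> K2" "z \<in> T" by auto
    have "z \<in> K1 \<or> z = u1"
    proof -
      have "0 \<le> fst z" using kin2[OF z(1)] by simp
      moreover have "\<not> (snd z = 0 \<and> fst u1 < fst z)" using False z(1) by blast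
      ultimately show ?thesis using z(2) H1(2,3) unfolding T_def by (auto simp: prod_eq_iff)
    qed
    then have "linked4 ?Q w1 z" using r1 qK by blast
    with r2[OF z(1)] show ?thesis using linked_trans[OF _ linked4_sym] by metis
  qed
qed

section \<open>From near-squares to long rectangles\<close>

lemma lrI: "linked4 (A \<inter> rect a b c d) u v \<Longrightarrow> fst u = a \<Longrightarrow> fst v = b \<Longrightarrow> lr a b c d A"
  unfolding lr_def by blast

definition hook_touch :: "int \<Rightarrow> int \<Rightarrow> int \<Rightarrow> int \<Rightarrow> (int \<times> int) set \<Rightarrow> bool" where
  "hook_touch a m n s A \<longleftrightarrow> (\<exists>u q w. linked4 (A \<inter> rect 0 a 0 n) u q \<and> snd u = 0 \<and> fst q \<le> s \<and>
      linked4 (A \<inter> rect 0 m 0 (2 * n)) u w \<and> fst w = m)"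

lemma cyl_hook_touch: "a \<le> m \<Longrightarrow> 0 \<le> n \<Longrightarrow> cyl (rect 0 m 0 (2 * n)) (hook_touch a m n s)"
proof -
  assume "a \<le> m" "0 \<le> n"
  then have "rect 0 m 0 (2 * n) \<inter> rect 0 a 0 n = rect 0 a 0 n"
    using rect_mono[of 0 0 a m 0 0 n "2 * n"] by auto
  then show ?thesis by (simp add: cyl_def hook_touch_def Int_assoc)
qed

lemma mono_hook_touch: "mono (hook_touch a m n s)"
proof (intro monoI le_boolI)
  fix A B :: "(int \<times> int) set" assume "A \<subseteq> B" and "hook_touch a m n s A"
  then obtain u v w where h: "linked4 (A \<inter> rect 0 a 0 n) u v" "snd u = 0" "fst v \<le> s"
    "linked4 (A \<inter> rect 0 m 0 (2 * n)) u w" "fst w = m" unfolding hook_touch_def by blast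
  have AB: "A \<inter> X \<subseteq> B \<inter> X" for X
    using \<open>A \<subseteq> B\<close> by auto
  show "hook_touch a m n s B" unfolding hook_touch_def
    using linked_subset[OF h(1) AB] linked_subset[OF h(4) AB] h(2,3,5) by blast
qed

text \<open>
  If the vertical crossing of a hook does not touch the left margin, it crosses the box without this margin.
\<close>

lemma hook_cases:
  assumes "hook a m n A"
  shows "hook_touch a m n s A \<or> tb (s + 1) a 0 n A"
proof -
  obtain u v w where h: "linked4 (A \<inter> rect 0 a 0 n) u v" "snd u = 0" "snd v = n"
    "linked4 (A \<inter> rect 0 m 0 (2 * n)) u w" "fst w = m" using assms unfolding hook_def by blast
  let ?K = "{z. linked4 (A \<inter> rect 0 a 0 n) u z}"
  show ?thesis
  proof (cases "\<exists>q\<in>?K. fst q \<le> s")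
    case True
    then show ?thesis unfolding hook_touch_def using h by blast
  next
    case False
    have "?K \<subseteq> A \<inter> rect (s + 1) a 0 n"
    proof
      fix z assume z: "z \<in> ?K"
      have "z \<in> A \<inter> rect 0 a 0 n" by (rule linked_inD(2)) (use z in simp)
      moreover have "s < fst z" using False z by (meson linorder_not_le)
      ultimately show "z \<in> A \<inter> rect (s + 1) a 0 n" by (auto simp: mem_rect)
    qed
    from linked_subset[OF linked_component[OF h(1)] this] h(2,3) show ?thesis
      unfolding tb_def by blast
  qed
qed

lemma linked4_pull:
  assumes "isom g" "\<And>x. g (f x) = x" "linked4 (f ` A \<inter> B) x y"
  shows "linked4 (A \<inter> g ` B) (g x) (g y)"
proof -
  have "g ` (f ` A \<inter> B) = A \<inter> g ` B"
    using isom_image_Int[OF assms(1)] by (simp add: assms(2) image_image)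
  with linked4_isom[OF assms(1), of "f ` A \<inter> B" x y] assms(3) show ?thesis by simp
qed

lemma hook_flip:
  assumes "hook a m n (flip_x a ` A)"
  obtains u v w where "linked4 (A \<inter> rect 0 a 0 n) u v" "snd u = 0" "snd v = n"
    "linked4 (A \<inter> rect (a - m) a 0 (2 * n)) u w" "fst w = a - m"
proof -
  have f: "flip_x a (flip_x a x) = x" for x by (simp add: flip_x_def split_beta)
  obtain u v w where h: "linked4 (flip_x a ` A \<inter> rect 0 a 0 n) u v" "snd u = 0" "snd v = n"
    "linked4 (flip_x a ` A \<inter> rect 0 m 0 (2 * n)) u w" "fst w = m" using assms unfolding hook_def by blast
  have "linked4 (A \<inter> rect 0 a 0 n) (flip_x a u) (flip_x a v)"
    using linked4_pull[OF isom_flip_x f h(1)] by (simp add: flip_x_rect)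
  moreover have "linked4 (A \<inter> rect (a - m) a 0 (2 * n)) (flip_x a u) (flip_x a w)"
    using linked4_pull[OF isom_flip_x f h(4)] by (simp add: flip_x_rect)
  moreover have "snd (flip_x a u) = 0" "snd (flip_x a v) = n" "fst (flip_x a w) = a - m"
    using h(2,3,5) by (auto simp: flip_x_def split_beta)
  ultimately show ?thesis using that by blast
qed

lemma hook_touch_translate:
  assumes "hook_touch a m n s (translate t 0 ` A)"
  obtains u q w where "linked4 (A \<inter> rect (- t) (a - t) 0 n) u q" "snd u = 0" "fst q \<le> s - t"
    "linked4 (A \<inter> rect (- t) (m - t) 0 (2 * n)) u w" "fst w = m - t"
proof -
  let ?g = "translate (- t) 0"
  have f: "?g (translate t 0 x) = x" for x by (simp add: translate_def split_beta)
  obtain u v w where h: "linked4 (translate t 0 ` A \<inter> rect 0 a 0 n) u v" "snd u = 0" "fst v \<le> s"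
    "linked4 (translate t 0 ` A \<inter> rect 0 m 0 (2 * n)) u w" "fst w = m" using assms unfolding hook_touch_def by blast
  have "linked4 (A \<inter> rect (- t) (a - t) 0 n) (?g u) (?g v)"
    using linked4_pull[OF isom_translate f h(1)] by (simp add: translate_rect)
  moreover have "linked4 (A \<inter> rect (- t) (m - t) 0 (2 * n)) (?g u) (?g w)"
    using linked4_pull[OF isom_translate f h(4)] by (simp add: translate_rect)
  moreover have "snd (?g u) = 0" "fst (?g v) \<le> s - t" "fst (?g w) = m - t"
    using h(2,3,5) by (auto simp: translate_def split_beta)
  ultimately show ?thesis using that by blast
qed

lemma cyl_isom:
  assumes "isom f" "cyl V Q" shows "cyl (f -` V) (\<lambda>A. Q (f ` A))"
proof -
  have b: "bij f" using assms(1) by (simp add: isom_def)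
  have "f ` (A \<inter> f -` V) = f ` A \<inter> V" for A by blast
  then show ?thesis using cylD[OF assms(2)] b unfolding cyl_def
    by (auto simp: bij_is_inj finite_vimageI)
qed

lemma lr_shrink:
  assumes "lr a b c d A" "a \<le> b'" "b' \<le> b"
  shows "lr a b' c d A"
proof -
  obtain u v where uv: "linked4 (A \<inter> rect a b c d) u v" "fst u = a" "fst v = b"
    using assms(1) unfolding lr_def by blast
  have ad: "\<bar>- fst x - (- fst y)\<bar> \<le> 1" if "adj4 x y" for x y using that by (auto simp: adj4_def)
  obtain v' where v': "- fst v' = - b'" "linked4 (A \<inter> rect a b c d \<inter> {x. - b' \<le> - fst x}) v' u"
    using linked_crop[OF linked4_sym[OF uv(1)], of "\<lambda>x. - fst x" "- b'", OF _ _ ad] uv assms by auto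
  have "linked4 (A \<inter> rect a b' c d) v' u"
    by (rule linked_subset[OF v'(2)]) (auto simp: mem_rect)
  then show ?thesis unfolding lr_def using linked4_sym uv(2) v'(1) by (metis neg_equal_iff_equal)
qed

text \<open>
  All three assumptions concern near-squares of ratio \<open>9 : 10\<close>.  They give hooks that start in the box \<open>100 u \<times> 90 u\<close> and reach distance \<open>162 u\<close>.
  By the square root trick, one of two cases has high probability.
  
  \<^item> The hook touches the margin of width \<open>19 u\<close>.  Shifted to the left by \<open>19 u\<close>, it must meet the mirror image of a hook, and
    the union has length \<open>2 * 162 u - 100 u - 19 u = 205 u\<close>.
  
  \<^item> The box without the margin, \<open>81 u \<times> 90 u\<close>, is crossed vertically.  It has the shape of the given near-squares, so it is also
    crossed horizontally, which joins a hook starting in it to its mirror image; the length is \<open>2 * 162 u - 81 u\<close>.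
  
  The exponent 4 leaves room for two square roots.
\<close>

theorem stretched_crossing:
  fixes t :: real and u :: int
  assumes p: "0 \<le> p" "p \<le> 1" and u: "1 \<le> u" and t: "0 \<le> t" "t \<le> 1"
    and near: "\<And>j. j \<in> {9 * u, 10 * u, 18 * u} \<Longrightarrow> pr (\<lambda>_. p) (lr 0 (9 * j) 0 (10 * j)) \<ge> 1 - t ^ 4"
  shows "pr (\<lambda>_. p) (lr 0 (205 * u) 0 (180 * u)) \<ge> 1 - 6 * t"
proof -
  let ?P = "pr (\<lambda>_ :: int \<times> int. p)"
  have t4eq: "t ^ 4 = t\<^sup>2 * t\<^sup>2" by (simp flip: power_add)
  have t4: "t\<^sup>2 \<le> t" "t^4 \<le> t\<^sup>2" "0 \<le> t\<^sup>2" "t\<^sup>2 \<le> 1" "0 \<le> t^4"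
    using t power_decreasing[of 1 2 t] power_decreasing[of 2 4 t] power_le_one[of t 2]
    by (simp_all flip: power_add)
  have R: "?P (lr 0 (162 * u) 0 (180 * u)) \<ge> 1 - t ^ 4" using near[of "18 * u"] by simp
  have "sqrt (1 - ?P (lr 0 (162 * u) 0 (180 * u))) \<le> sqrt (t\<^sup>2 * t\<^sup>2)"
    by (rule real_sqrt_le_mono) (use R t4eq in linarith)
  also have "\<dots> = t\<^sup>2" using t4(3) by (simp only: real_sqrt_abs2 abs_of_nonneg)
  finally have sq: "1 - sqrt (1 - ?P (lr 0 (162 * u) 0 (180 * u))) \<ge> 1 - t\<^sup>2" by simp
  have V: "?P (tb 0 (100 * u) 0 (90 * u)) \<ge> 1 - t ^ 4"
    using near[of "10 * u"] by (simp add: pr_tb_swap[OF p])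
  have hookbound: "?P (hook a (162 * u) (90 * u)) \<ge> 1 - (x + t\<^sup>2)"
    if "0 \<le> a" "a \<le> 162 * u" "?P (tb 0 a 0 (90 * u)) \<ge> 1 - x" "0 \<le> x" for a x
  proof -
    have "1 - (x + t\<^sup>2) \<le> 1 - (x + t\<^sup>2) + x * t\<^sup>2" using that t4 by simp
    also have "\<dots> = (1 - x) * (1 - t\<^sup>2)" by (simp add: algebra_simps)
    also have "\<dots> \<le> ?P (tb 0 a 0 (90 * u)) * (1 - sqrt (1 - ?P (lr 0 (162 * u) 0 (180 * u))))"
      using that(3) sq t4 pr_nonneg by (intro mult_mono) auto
    also have "\<dots> \<le> ?P (hook a (162 * u) (90 * u))"
      using pr_hook[OF that(1,2) _ p, of "90 * u"] u by simp
    finally show ?thesis .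
  qed
  have mirror: "?P (\<lambda>A. hook a (162 * u) (90 * u) (flip_x a ` A)) = ?P (hook a (162 * u) (90 * u))"
    if "a \<le> 162 * u" for a
    using pr_isom[OF isom_flip_x cyl_hook p] that u by simp
  define \<delta> where "\<delta> = t^4 + t\<^sup>2"
  have d: "0 \<le> \<delta>" "\<delta> \<le> 2 * t\<^sup>2" "\<delta> \<le> 2 * t" using t4 by (auto simp: \<delta>_def)
  have sd: "sqrt \<delta> \<le> 3/2 * t"
  proof (rule real_le_lsqrt)
    have "(3/2 * t)\<^sup>2 = 9/4 * t\<^sup>2" by (simp add: power_mult_distrib power_divide)
    then show "\<delta> \<le> (3/2 * t)\<^sup>2" using d(2) t4(3) by linarith
  qed (use d t in auto)
  have H: "?P (hook (100 * u) (162 * u) (90 * u)) \<ge> 1 - \<delta>"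
    using hookbound[of "100 * u" "t^4"] V u t4 by (simp add: \<delta>_def)
  define B where "B = hook_touch (100 * u) (162 * u) (90 * u) (19 * u - 1)"
  define C where "C = tb (19 * u) (100 * u) 0 (90 * u)"
  have cB: "cyl (rect 0 (162 * u) 0 (2 * (90 * u))) B"
    unfolding B_def by (rule cyl_hook_touch) (use u in auto)
  have mB: "mono B"
    unfolding B_def by (rule mono_hook_touch)
  have cC: "cyl (rect (19 * u) (100 * u) 0 (90 * u)) C" and mC: "mono C"
    unfolding C_def by (rule cyl_tb mono_tb)+
  have "?P (hook (100 * u) (162 * u) (90 * u)) \<le> ?P (\<lambda>A. B A \<or> C A)"
    using hook_cases[of "100 * u" "162 * u" "90 * u" _ "19 * u - 1"] u
    by (intro pr_mono[OF cyl_disj[OF cB cC]]) (simp add: B_def C_def)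
  then have prodle: "(1 - ?P B) * (1 - ?P C) \<le> sqrt \<delta> * sqrt \<delta>"
    using square_root_trick[OF cB cC mB mC, of "\<lambda>_. p"] p H d by simp
  have "?P B \<ge> 1 - sqrt \<delta> \<or> ?P C \<ge> 1 - sqrt \<delta>"
  proof (rule ccontr)
    assume "\<not> ?thesis"
    then have "sqrt \<delta> * sqrt \<delta> < (1 - ?P B) * (1 - ?P C)"
      using d by (intro mult_strict_mono') auto
    with prodle show False by simp
  qed
  then show ?thesis
  proof
    assume PB: "?P B \<ge> 1 - sqrt \<delta>"
    let ?B = "\<lambda>A. B (translate (19 * u) 0 ` A)" and ?H = "\<lambda>A. hook (100 * u) (162 * u) (90 * u) (flip_x (100 * u) ` A)"
    have cH: "cyl (rect 0 (162 * u) 0 (2 * (90 * u))) (hook (100 * u) (162 * u) (90 * u))"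
      using u by (intro cyl_hook) auto
    have "1 - 6 * t \<le> 1 - (sqrt \<delta> + \<delta>)" using sd d by simp
    also have "\<dots> \<le> ?P (\<lambda>A. ?B A \<and> ?H A)"
      using PB H pr_isom[OF isom_translate[of "19 * u" 0] cB p] mirror[of "100 * u"] u
      by (intro pr_conj_bound[OF cyl_isom[OF isom_translate cB] cyl_isom[OF isom_flip_x cH]]) auto
    also have "\<dots> \<le> ?P (lr (- 62 * u) (143 * u) 0 (180 * u))"
    proof (rule pr_mono[OF cyl_lr])
      fix A assume h: "?B A \<and> ?H A"
      obtain u1 q w1 where 1: "linked4 (A \<inter> rect (- (19 * u)) (100 * u - 19 * u) 0 (90 * u)) u1 q" "snd u1 = 0"
        "fst q \<le> 19 * u - 1 - 19 * u"
        "linked4 (A \<inter> rect (- (19 * u)) (162 * u - 19 * u) 0 (2 * (90 * u))) u1 w1" "fst w1 = 162 * u - 19 * u"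
        using hook_touch_translate h unfolding B_def by blast
      obtain u2 v2 w2 where 2: "linked4 (A \<inter> rect 0 (100 * u) 0 (90 * u)) u2 v2" "snd u2 = 0" "snd v2 = 90 * u"
        "linked4 (A \<inter> rect (100 * u - 162 * u) (100 * u) 0 (2 * (90 * u))) u2 w2" "fst w2 = 100 * u - 162 * u"
        using hook_flip h by blast
      have "linked4 (A \<inter> rect (100 * u - 162 * u) (162 * u - 19 * u) 0 (2 * (90 * u))) w2 w1"
        by (rule hooks_linked[OF _ _ _ _ 1(1,2) _ 1(4,5) 2]) (use u 1(3) in auto)
      from lrI[OF this 2(5) 1(5)] show "lr (- 62 * u) (143 * u) 0 (180 * u) A" by simp
    qed
    also have "\<dots> = ?P (lr 0 (205 * u) 0 (180 * u))"
      using pr_lr_translate[OF p, of 0 "-62 * u" "205 * u" 0 0 "180 * u"] by simp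
    finally show ?thesis .
  next
    assume "?P C \<ge> 1 - sqrt \<delta>"
    then have C: "?P (tb 0 (81 * u) 0 (90 * u)) \<ge> 1 - sqrt \<delta>"
      using pr_isom[OF isom_translate[of "19 * u" 0] cC p] tb_translate[of 0 "19 * u" "81 * u" 0 0 "90 * u"]
      by (simp add: C_def)
    let ?h = "hook (81 * u) (162 * u) (90 * u)"
    let ?H = "\<lambda>A. ?h (flip_x (81 * u) ` A)"
    have cH: "cyl (rect 0 (162 * u) 0 (2 * (90 * u))) ?h"
      using u by (intro cyl_hook) auto
    have h: "?P ?h \<ge> 1 - (sqrt \<delta> + t\<^sup>2)"
      using hookbound[of "81 * u" "sqrt \<delta>"] C u d by simp
    have Z: "?P (lr 0 (81 * u) 0 (90 * u)) \<ge> 1 - t ^ 4" using near[of "9 * u"] by simp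
    have "1 - 6 * t \<le> 1 - ((sqrt \<delta> + t\<^sup>2) + ((sqrt \<delta> + t\<^sup>2) + t ^ 4))"
      using sd t4 by (simp add: \<delta>_def)
    also have "\<dots> \<le> ?P (\<lambda>A. ?h A \<and> ?H A \<and> lr 0 (81 * u) 0 (90 * u) A)"
    proof (rule pr_conj_bound[OF cH cyl_conj[OF cyl_isom[OF isom_flip_x cH] cyl_lr] h])
      show "1 - ((sqrt \<delta> + t\<^sup>2) + t ^ 4) \<le> ?P (\<lambda>A. ?H A \<and> lr 0 (81 * u) 0 (90 * u) A)"
        by (rule pr_conj_bound[OF cyl_isom[OF isom_flip_x cH] cyl_lr _ Z])
          (use h mirror[of "81 * u"] u in simp)
    qed
    also have "\<dots> \<le> ?P (lr (- 81 * u) (124 * u) 0 (180 * u))"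
    proof (rule pr_mono[OF cyl_lr])
      fix A assume A: "?h A \<and> ?H A \<and> lr 0 (81 * u) 0 (90 * u) A"
      obtain u1 v1 w1 where 1: "linked4 (A \<inter> rect 0 (81 * u) 0 (90 * u)) u1 v1" "snd u1 = 0" "snd v1 = 90 * u"
        "linked4 (A \<inter> rect 0 (162 * u) 0 (2 * (90 * u))) u1 w1" "fst w1 = 162 * u"
        using A unfolding hook_def by blast
      obtain u2 v2 w2 where 2: "linked4 (A \<inter> rect 0 (81 * u) 0 (90 * u)) u2 v2" "snd u2 = 0" "snd v2 = 90 * u"
        "linked4 (A \<inter> rect (81 * u - 162 * u) (81 * u) 0 (2 * (90 * u))) u2 w2" "fst w2 = 81 * u - 162 * u"
        using hook_flip A by blast
      obtain z z' where z: "linked4 (A \<inter> rect 0 (81 * u) 0 (90 * u)) z z'" "fst z = 0" "fst z' = 81 * u"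
        using A unfolding lr_def by blast
      let ?R = "rect (- 81 * u) (162 * u) 0 (180 * u)"
      have sub: "rect 0 (81 * u) 0 (90 * u) \<union> rect 0 (81 * u) 0 (90 * u) \<subseteq> ?R"
        "A \<inter> rect 0 (162 * u) 0 (2 * (90 * u)) \<subseteq> A \<inter> ?R"
        "A \<inter> rect (81 * u - 162 * u) (81 * u) 0 (2 * (90 * u)) \<subseteq> A \<inter> ?R"
        using u by (auto simp: mem_rect)
      have "linked4 (A \<inter> ?R) z u1"
        by (rule lr_tb_linked[OF z 1(1-3) _ _ _ _ sub(1)]) auto
      moreover have "linked4 (A \<inter> ?R) z u2"
        by (rule lr_tb_linked[OF z 2(1-3) _ _ _ _ sub(1)]) auto
      ultimately have "linked4 (A \<inter> ?R) u2 u1" by (rule linked_trans[OF linked4_sym, rotated])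
      from linked_trans[OF linked4_sym[OF linked_subset[OF 2(4) sub(3)]] linked_trans[OF this linked_subset[OF 1(4) sub(2)]]]
      have "lr (- 81 * u) (162 * u) 0 (180 * u) A"
        by (rule lrI) (use 1(5) 2(5) in auto)
      then show "lr (- 81 * u) (124 * u) 0 (180 * u) A"
        by (rule lr_shrink) (use u in auto)
    qed
    also have "\<dots> = ?P (lr 0 (205 * u) 0 (180 * u))"
      using pr_lr_translate[OF p, of 0 "-81 * u" "205 * u" 0 0 "180 * u"] by simp
    finally show ?thesis .
  qed
qed

section \<open>A finite-size criterion for percolation\<close>

definition defect :: "real \<Rightarrow> int \<Rightarrow> int \<Rightarrow> real" where
  "defect p w h = 1 - pr (\<lambda>_. p) (lr 0 w 0 h)"

lemma defect_mono:
  assumes "0 \<le> w" "w \<le> w'" shows "defect p w h \<le> defect p w' h"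
  unfolding defect_def using pr_mono[OF cyl_lr, of "lr 0 w' 0 h" 0 w 0 h "\<lambda>_. p"] lr_shrink[of 0 w' 0 h _ w] assms by simp

text \<open>
  Two overlapping horizontal crossings are joined by a vertical crossing of the square in which they overlap.
\<close>

lemma defect_glue:
  assumes p: "0 \<le> p" "p \<le> 1" and h: "0 \<le> h" "h \<le> w1" "h \<le> w2"
  shows "defect p (w1 + w2 - h) h \<le> defect p w1 h + 2 * defect p w2 h"
proof -
  let ?P = "pr (\<lambda>_ :: int \<times> int. p)"
  let ?Q = "\<lambda>A. lr 0 w1 0 h A \<and> lr (w1 - h) (w1 - h + w2) 0 h A \<and> tb (w1 - h) w1 0 h A"
  have "?P (lr (w1 - h) (w1 - h + w2) 0 h) = 1 - defect p w2 h"
    using pr_lr_translate[OF p, of 0 "w1 - h" w2 0 0 h] by (simp add: defect_def algebra_simps)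
  moreover have "?P (tb (w1 - h) w1 0 h) \<ge> 1 - defect p w2 h"
    using pr_lr_translate[OF p, of 0 0 h 0 "w1 - h" h] defect_mono[of h w2 p h] h
    by (simp add: pr_tb_swap[OF p] defect_def)
  ultimately have "?P ?Q \<ge> 1 - (defect p w1 h + (defect p w2 h + defect p w2 h))"
    by (intro pr_conj_bound[OF cyl_lr cyl_conj[OF cyl_lr cyl_tb]] pr_conj_bound[OF cyl_lr cyl_tb])
      (simp_all add: defect_def)
  also have "?P ?Q \<le> ?P (lr 0 (w1 + w2 - h) 0 h)"
  proof (rule pr_mono[OF cyl_lr])
    fix A assume A: "?Q A"
    obtain u v where uv: "linked4 (A \<inter> rect 0 w1 0 h) u v" "fst u = 0" "fst v = w1"
      using A unfolding lr_def by blast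
    obtain x y where xy: "linked4 (A \<inter> rect (w1 - h) (w1 - h + w2) 0 h) x y" "fst x = w1 - h" "fst y = w1 - h + w2"
      using A unfolding lr_def by blast
    obtain s t where st: "linked4 (A \<inter> rect (w1 - h) w1 0 h) s t" "snd s = 0" "snd t = h"
      using A unfolding tb_def by blast
    let ?R = "rect 0 (w1 + w2 - h) 0 h"
    have sub: "rect 0 w1 0 h \<union> rect (w1 - h) w1 0 h \<subseteq> ?R"
      "rect (w1 - h) (w1 - h + w2) 0 h \<union> rect (w1 - h) w1 0 h \<subseteq> ?R"
      "A \<inter> rect (w1 - h) (w1 - h + w2) 0 h \<subseteq> A \<inter> ?R"
      using h by (auto simp: mem_rect)
    have "linked4 (A \<inter> ?R) u s"
      by (rule lr_tb_linked[OF uv st _ _ _ _ sub(1)]) (use h in auto)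
    moreover have "linked4 (A \<inter> ?R) x s"
      by (rule lr_tb_linked[OF xy st _ _ _ _ sub(2)]) (use h in auto)
    ultimately have "linked4 (A \<inter> ?R) u x" by (rule linked_trans[OF _ linked4_sym])
    from linked_trans[OF this linked_subset[OF xy(1) sub(3)]]
    show "lr 0 (w1 + w2 - h) 0 h A" by (rule lrI) (use uv xy in auto)
  qed
  finally show ?thesis by (simp add: defect_def)
qed

text \<open>
  Rectangles of \<open>2 L\<close> columns and \<open>L\<close> rows are first stretched to \<open>4 L\<close> columns, at the cost of a factor 5.  Two of these, stacked on top of
  each other, are independent, and one crossing is enough.  Bounds are inclusive, hence the subtractions of 1.
\<close>

lemma defect_double:
  assumes p: "0 \<le> p" "p \<le> 1" and L: "1 \<le> L"
  shows "defect p (2 * (2 * L) - 1) (2 * L - 1) \<le> 25 * (defect p (2 * L - 1) (L - 1))\<^sup>2"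
proof -
  let ?P = "pr (\<lambda>_ :: int \<times> int. p)"
  define \<phi> where "\<phi> = defect p (2 * L - 1) (L - 1)"
  have \<phi>0: "0 \<le> \<phi>" unfolding \<phi>_def defect_def using pr_le_1[of "\<lambda>_. p"] by simp
  have "defect p (3 * L - 1) (L - 1) \<le> 3 * \<phi>"
    using defect_glue[OF p, of "L - 1" "2 * L - 1" "2 * L - 1"] L by (simp add: \<phi>_def algebra_simps)
  moreover have "defect p (4 * L - 1) (L - 1) \<le> defect p (3 * L - 1) (L - 1) + 2 * \<phi>"
    using defect_glue[OF p, of "L - 1" "3 * L - 1" "2 * L - 1"] L by (simp add: \<phi>_def algebra_simps)
  ultimately have long: "defect p (4 * L - 1) (L - 1) \<le> 5 * \<phi>" by simp
  define Q1 where "Q1 = lr 0 (4 * L - 1) 0 (L - 1)"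
  define Q2 where "Q2 = lr 0 (4 * L - 1) L (2 * L - 1)"
  have c: "cyl (rect 0 (4 * L - 1) 0 (L - 1)) Q1" "cyl (rect 0 (4 * L - 1) L (2 * L - 1)) Q2"
    unfolding Q1_def Q2_def by (rule cyl_lr)+
  have disj: "rect 0 (4 * L - 1) 0 (L - 1) \<inter> rect 0 (4 * L - 1) L (2 * L - 1) = {}"
    by (auto simp: mem_rect)
  have Q2: "?P Q2 = ?P Q1"
    unfolding Q1_def Q2_def using pr_lr_translate[OF p, of 0 0 "4 * L - 1" 0 L "L - 1"] by (simp add: algebra_simps)
  let ?Q = "lr 0 (2 * (2 * L) - 1) 0 (2 * L - 1)"
  have "defect p (2 * (2 * L) - 1) (2 * L - 1) = ?P (\<lambda>A. \<not> ?Q A)"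
    unfolding defect_def by (rule pr_not[OF cyl_lr, symmetric])
  also have "\<dots> \<le> ?P (\<lambda>A. \<not> Q1 A \<and> \<not> Q2 A)"
  proof (rule pr_mono[OF cyl_conj[OF cyl_not[OF c(1)] cyl_not[OF c(2)]]])
    fix A assume n: "\<not> ?Q A"
    have sub: "A \<inter> rect 0 (4 * L - 1) 0 (L - 1) \<subseteq> A \<inter> rect 0 (2 * (2 * L) - 1) 0 (2 * L - 1)"
      "A \<inter> rect 0 (4 * L - 1) L (2 * L - 1) \<subseteq> A \<inter> rect 0 (2 * (2 * L) - 1) 0 (2 * L - 1)"
      using L by (auto simp: mem_rect)
    have "?Q A" if "linked4 (A \<inter> rect 0 (4 * L - 1) 0 (L - 1)) u v \<or> linked4 (A \<inter> rect 0 (4 * L - 1) L (2 * L - 1)) u v"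
      "fst u = 0" "fst v = 4 * L - 1" for u v
      using that linked_subset[OF _ sub(1), of adj4 u v] linked_subset[OF _ sub(2), of adj4 u v]
      by (intro lrI[of A 0 "2 * (2 * L) - 1" 0 "2 * L - 1" u v]) auto
    then show "\<not> Q1 A \<and> \<not> Q2 A" using n unfolding Q1_def Q2_def lr_def[of 0 "4 * L - 1"] by blast
  qed
  also have "\<dots> = (1 - ?P Q1) * (1 - ?P Q1)"
    using pr_independent[OF cyl_not[OF c(1)] cyl_not[OF c(2)] disj, of "\<lambda>_. p"] p pr_not[OF c(1), of "\<lambda>_. p"] pr_not[OF c(2), of "\<lambda>_. p"] Q2
    by simp
  also have "\<dots> \<le> (5 * \<phi>) * (5 * \<phi>)"
    using long \<phi>0 pr_le_1[of "\<lambda>_. p" Q1] unfolding Q1_def defect_def by (intro mult_mono) auto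
  finally show ?thesis by (simp add: \<phi>_def power2_eq_square)
qed

lemma pr_subset:
  assumes "finite V" "\<And>v. 0 \<le> r v \<and> r v \<le> 1"
  shows "pr r (\<lambda>A. V \<subseteq> A) = (\<Prod>v\<in>V. r v)"
  using assms(1)
proof (induction V rule: finite_induct)
  case empty then show ?case by (simp add: pr_True)
next
  case (insert v V)
  have c: "cyl (insert v V) (\<lambda>A. insert v V \<subseteq> A)" using insert by (auto simp: cyl_def)
  have eq: "(insert v V \<subseteq> insert v A) = (V \<subseteq> A)" "(insert v V \<subseteq> A - {v}) = False" for A
    using insert.hyps by auto
  show ?case
    using pr_condition_site[where r = r and v = v, OF c assms(2)] insert
    by (simp only: eq pr_const) simp
qed

lemma pr_zero:
  assumes "cyl V Q" "\<not> Q {}"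
  shows "pr (\<lambda>_. 0) Q = 0"
proof -
  have "finite V" using cylD(1)[OF assms(1)] .
  then show ?thesis using assms
  proof (induction V arbitrary: Q)
    case empty
    then obtain c where "Q = (\<lambda>_. c)" using cyl_empty_const by blast
    with empty show ?case by (simp add: pr_const)
  next
    case (insert v V)
    have "cyl V (\<lambda>A. Q (A - {v}))" using cyl_remove[OF insert.prems(1)] insert.hyps by simp
    then have "pr (\<lambda>_. 0) (\<lambda>A. Q (A - {v})) = 0" using insert.IH insert.prems(2) by simp
    then show ?case using pr_condition_site[where r = "\<lambda>_. 0" and v = v, OF insert.prems(1)] by simp
  qed
qed

text \<open>
  Alternately horizontal and vertical crossings of rectangles that share the corner at the origin and double in size.
\<close>

definition stage :: "int \<Rightarrow> nat \<Rightarrow> (int \<times> int) set \<Rightarrow> bool" where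
  "stage L k = (if even k then lr 0 (2 * (2 ^ k * L) - 1) 0 (2 ^ k * L - 1)
     else tb 0 (2 ^ k * L - 1) 0 (2 * (2 ^ k * L) - 1))"

definition stages :: "int \<Rightarrow> nat \<Rightarrow> (int \<times> int) set \<Rightarrow> bool" where
  "stages L K A \<longleftrightarrow> rect 0 (2 * L - 1) 0 (L - 1) \<subseteq> A \<and> (\<forall>k\<le>K. stage L k A)"

lemma scale_mono:
  fixes L :: int
  assumes "1 \<le> L" "k \<le> K"
  obtains l M where "l = 2 ^ k * L" "M = 2 ^ K * L" "L \<le> l" "l \<le> M"
proof -
  have "(1::int) \<le> 2 ^ k" "(2::int) ^ k \<le> 2 ^ K" using assms(2) by (auto intro: power_increasing)
  then have "1 * L \<le> 2 ^ k * L" "2 ^ k * L \<le> 2 ^ K * L"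
    using assms(1) by (meson mult_right_mono zero_le_one order_trans)+
  then show ?thesis by (intro that[OF refl refl]) simp_all
qed

lemma cyl_stage:
  assumes "1 \<le> L" "k \<le> K"
  shows "cyl (rect 0 (2 * (2 ^ K * L)) 0 (2 * (2 ^ K * L))) (stage L k)"
proof -
  obtain l M where l: "l = 2 ^ k * L" "M = 2 ^ K * L" "L \<le> l" "l \<le> M" by (rule scale_mono[OF assms])
  have "rect 0 (2 * l - 1) 0 (l - 1) \<subseteq> rect 0 (2 * M) 0 (2 * M)" "rect 0 (l - 1) 0 (2 * l - 1) \<subseteq> rect 0 (2 * M) 0 (2 * M)"
    by (intro rect_mono; use l(3,4) assms(1) in linarith)+
  then show ?thesis unfolding stage_def l(1,2)[symmetric]
    using cyl_mono[OF cyl_lr] cyl_mono[OF cyl_tb] by (simp add: cyl_mono)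
qed

lemma cyl_stages:
  assumes "1 \<le> L" shows "cyl (rect 0 (2 * (2 ^ K * L)) 0 (2 * (2 ^ K * L))) (stages L K)"
proof -
  let ?R = "rect 0 (2 * (2 ^ K * L)) 0 (2 * (2 ^ K * L))"
  obtain l M where l: "l = 2 ^ 0 * L" "M = 2 ^ K * L" "L \<le> l" "l \<le> M" by (rule scale_mono[OF assms, of 0 K]) simp
  have "rect 0 (2 * L - 1) 0 (L - 1) \<subseteq> ?R" unfolding l(2)[symmetric]
    using l(3,4) assms by (intro rect_mono) auto
  then show ?thesis using cylD(2)[OF cyl_stage[OF assms]]
    unfolding cyl_def stages_def by auto
qed

text \<open>
  Gluing seven times gives length-to-height ratio 2 with failure probability at most \<open>15 / 1500 = 1 / 100\<close>; doubling then
  makes the failure probabilities summable, so all stages occur together with probability at least \<open>1 / 2\<close>.  By the Harris inequality they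
  also occur together with a fully open rectangle at the origin.
\<close>

theorem finite_size_criterion:
  assumes p: "0 \<le> p" "p \<le> 1" and u: "1 \<le> u"
    and H: "pr (\<lambda>_. p) (lr 0 (205 * u) 0 (180 * u)) \<ge> 1 - 1 / 1500"
  shows "\<exists>L \<delta>. 1 \<le> L \<and> 0 < \<delta> \<and> (\<forall>K. pr (\<lambda>_. p) (stages L K) \<ge> \<delta>)"
proof -
  let ?P = "pr (\<lambda>_ :: int \<times> int. p)"
  define e :: real where "e = 1 / 1500"
  define L where "L = 180 * u + 1"
  have L: "1 \<le> L" using u by (simp add: L_def)
  have ext: "defect p (205 * u + 25 * u * int j) (180 * u) \<le> (2 * real j + 1) * e" for j
  proof (induction j)
    case 0 then show ?case using H by (simp add: defect_def e_def)
  next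
    case (Suc j)
    have "defect p (205 * u) (180 * u) \<le> e" using H by (simp add: defect_def e_def)
    moreover have "0 \<le> 25 * u * int j" using u by simp
    ultimately show ?case
      using Suc defect_glue[OF p, of "180 * u" "205 * u + 25 * u * int j" "205 * u"] u
      by (simp add: algebra_simps)
  qed
  define \<phi> where "\<phi> k = defect p (2 * (2 ^ k * L) - 1) (2 ^ k * L - 1)" for k
  have \<phi>: "0 \<le> \<phi> k \<and> \<phi> k \<le> (1 / 100) * (1 / 4) ^ k" for k
  proof (induction k)
    case 0
    have "\<phi> 0 \<le> defect p (205 * u + 25 * u * int 7) (180 * u)"
      unfolding \<phi>_def L_def using u by (auto intro!: defect_mono)
    also have "\<dots> \<le> 1 / 100" using ext[of 7] by (simp add: e_def)
    finally show ?case by (simp add: \<phi>_def defect_def pr_le_1)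
  next
    case (Suc k)
    obtain l M where "l = 2 ^ k * L" "M = 2 ^ k * L" "L \<le> l" "l \<le> M" by (rule scale_mono[OF L order_refl])
    then have "1 \<le> 2 ^ k * L" using L by linarith
    then have "\<phi> (Suc k) \<le> 25 * (\<phi> k)\<^sup>2"
      using defect_double[OF p, of "2 ^ k * L"] by (simp add: \<phi>_def mult.assoc)
    also have "\<dots> \<le> 25 * ((1 / 100) * \<phi> k)"
    proof -
      have "(1 / 4 :: real) ^ k \<le> 1" by (simp add: power_le_one)
      then have "\<phi> k \<le> 1 / 100" using Suc by linarith
      then have "\<phi> k * \<phi> k \<le> 1 / 100 * \<phi> k" using Suc by (intro mult_right_mono) auto
      then show ?thesis by (simp add: power2_eq_square)
    qed
    also have "\<dots> \<le> (1 / 100) * (1 / 4) ^ Suc k" using Suc by simp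
    finally show ?case by (simp add: \<phi>_def defect_def pr_le_1)
  qed
  have stage: "?P (stage L k) = 1 - \<phi> k" for k
    by (simp add: stage_def \<phi>_def defect_def pr_tb_swap[OF p])
  define all where "all K A \<longleftrightarrow> (\<forall>k\<le>K. stage L k A)" for K A
  have call: "cyl (rect 0 (2 * (2 ^ K * L)) 0 (2 * (2 ^ K * L))) (all K)" for K
    using cylD(2)[OF cyl_stage[OF L]] by (auto simp: cyl_def all_def)
  have "?P (all K) \<ge> 1 - (\<Sum>k\<le>K. \<phi> k)" for K
  proof (induction K)
    case 0 then show ?case using stage[of 0] by (simp add: all_def)
  next
    case (Suc K)
    have "all (Suc K) = (\<lambda>A. all K A \<and> stage L (Suc K) A)"
      by (auto simp: all_def le_Suc_eq fun_eq_iff)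
    then show ?case
      using pr_conj_bound[OF call cyl_stage[OF L order_refl] Suc, of "\<phi> (Suc K)" "Suc K"] stage[of "Suc K"] by simp
  qed
  moreover have "(\<Sum>k\<le>K. \<phi> k) \<le> 1 / 2" for K
  proof -
    have "(\<Sum>k\<le>K. \<phi> k) \<le> (\<Sum>k\<le>K. (1 / 100) * (1 / 4) ^ k)" using \<phi> by (intro sum_mono) auto
    also have "\<dots> = (1 / 100) * (\<Sum>k\<le>K. (1 / 4) ^ k)" by (simp add: sum_distrib_left)
    also have "\<dots> \<le> (1 / 100) * (1 / (1 - 1 / 4))"
    proof (rule mult_left_mono)
      have "(\<Sum>k\<le>K. (1 / 4 :: real) ^ k) = (1 - (1 / 4) ^ Suc K) / (1 - 1 / 4)"
        by (subst sum_gp0) simp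
      also have "\<dots> \<le> 1 / (1 - 1 / 4)" by (intro divide_right_mono) simp_all
      finally show "(\<Sum>k\<le>K. (1 / 4 :: real) ^ k) \<le> 1 / (1 - 1 / 4)" .
    qed simp
    finally show ?thesis by simp
  qed
  ultimately have half: "?P (all K) \<ge> 1 / 2" for K by (smt (verit) field_sum_of_halves)
  have "0 < p"
  proof (rule ccontr)
    assume "\<not> 0 < p"
    then have "p = 0" using p by simp
    have "\<not> lr 0 (205 * u) 0 (180 * u) {}" unfolding lr_def by (auto dest: linked_inD)
    from pr_zero[OF cyl_lr this] H \<open>p = 0\<close> show False by simp
  qed
  define B where "B = rect 0 (2 * L - 1) 0 (L - 1)"
  define \<delta> where "\<delta> = p ^ card B * (1 / 2)"
  have "?P (stages L K) \<ge> \<delta>" for K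
  proof -
    have c: "cyl B (\<lambda>A. B \<subseteq> A)" by (auto simp: cyl_def B_def)
    have m: "mono (\<lambda>A. B \<subseteq> A)" by (intro monoI le_boolI) blast
    have "mono (stage L k)" for k unfolding stage_def by (simp add: mono_lr mono_tb)
    then have m': "mono (all K)" unfolding all_def mono_def le_bool_def by blast
    have "\<delta> \<le> ?P (\<lambda>A. B \<subseteq> A) * ?P (all K)"
      unfolding \<delta>_def using pr_subset[of B "\<lambda>_. p"] half[of K] p by (intro mult_mono) (auto simp: B_def)
    also have "\<dots> \<le> ?P (\<lambda>A. B \<subseteq> A \<and> all K A)"
      by (rule harris'[OF c call m m']) (use p in auto)
    also have "(\<lambda>A. B \<subseteq> A \<and> all K A) = stages L K"
      by (simp add: stages_def all_def B_def fun_eq_iff)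
    finally show ?thesis .
  qed
  moreover have "0 < \<delta>" using \<open>0 < p\<close> by (simp add: \<delta>_def)
  ultimately show ?thesis using L by blast
qed

text \<open>
  Consecutive stages are crossings in different directions of rectangles of which one is narrower and taller, so they meet;
  the open rectangle joins the first stage to the origin.
\<close>

lemma stages_connect:
  assumes L: "1 \<le> L" and st: "\<And>k. stages L k A"
  shows "\<exists>v. linked4 (A \<inter> {z. 0 \<le> fst z \<and> 0 \<le> snd z}) (0, 0) v \<and> int K \<le> fst v + snd v"
proof -
  let ?N = "{z :: int \<times> int. 0 \<le> fst z \<and> 0 \<le> snd z}"
  define l where "l k = 2 ^ k * L" for k :: nat
  have l: "1 \<le> l k" "l (Suc k) = 2 * l k" "int k < l k" for k
  proof -
    have "1 * 1 \<le> l k" unfolding l_def using L by (intro mult_mono) auto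
    then show "1 \<le> l k" by simp
    show "l (Suc k) = 2 * l k" by (simp add: l_def)
    have "int k < 2 ^ k" using of_nat_less_two_power[of k, where 'a = int] by simp
    also have "2 ^ k * 1 \<le> l k" unfolding l_def using L by (intro mult_left_mono) auto
    finally show "int k < l k" by simp
  qed
  have lr: "\<exists>u v. linked4 (A \<inter> rect 0 (2 * l k - 1) 0 (l k - 1)) u v \<and> fst u = 0 \<and> fst v = 2 * l k - 1" if "even k" for k
    using st[of k] that by (auto simp: stages_def stage_def lr_def l_def)
  have tb: "\<exists>u v. linked4 (A \<inter> rect 0 (l k - 1) 0 (2 * l k - 1)) u v \<and> snd u = 0 \<and> snd v = 2 * l k - 1" if "odd k" for k
    using st[of k] that by (auto simp: stages_def stage_def tb_def l_def)
  have sub: "A \<inter> rect 0 b 0 d \<subseteq> A \<inter> ?N" for b d by (auto simp: mem_rect)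
  have sub2: "rect 0 b 0 d \<union> rect 0 b' 0 d' \<subseteq> ?N" for b d b' d' by (auto simp: mem_rect)
  have "(even k \<longrightarrow> (\<exists>u v. linked4 (A \<inter> rect 0 (2 * l k - 1) 0 (l k - 1)) u v \<and> fst u = 0 \<and> fst v = 2 * l k - 1
        \<and> linked4 (A \<inter> ?N) (0, 0) u)) \<and>
      (odd k \<longrightarrow> (\<exists>u v. linked4 (A \<inter> rect 0 (l k - 1) 0 (2 * l k - 1)) u v \<and> snd u = 0 \<and> snd v = 2 * l k - 1
        \<and> linked4 (A \<inter> ?N) (0, 0) u))" for k
  proof (induction k)
    case 0
    obtain u v where uv: "linked4 (A \<inter> rect 0 (2 * l 0 - 1) 0 (l 0 - 1)) u v" "fst u = 0" "fst v = 2 * l 0 - 1"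
      using lr[of 0] by auto
    have B: "rect 0 (2 * l 0 - 1) 0 (l 0 - 1) \<subseteq> A" using st[of 0] by (simp add: stages_def l_def)
    have uB: "u \<in> rect 0 (2 * l 0 - 1) 0 (l 0 - 1)" using linked_inD(1)[OF uv(1)] by blast
    have "linked4 (A \<inter> ?N) (0, 0) (0, snd u)"
    proof (rule linked4_vertical)
      show "0 \<le> snd u" using uB by (simp add: mem_rect)
      fix z assume "0 \<le> z" "z \<le> snd u"
      then have "(0, z) \<in> rect 0 (2 * l 0 - 1) 0 (l 0 - 1)" using uB l(1)[of 0] by (simp add: mem_rect)
      then show "(0, z) \<in> A \<inter> ?N" using B \<open>0 \<le> z\<close> by auto
    qed
    moreover have "(0, snd u) = u" using uv(2) by (simp add: prod_eq_iff)
    ultimately have "linked4 (A \<inter> ?N) (0, 0) u" by simp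
    then show ?case using uv by (intro conjI impI exI[of _ u] exI[of _ v]) simp_all
  next
    case (Suc k)
    show ?case
    proof (cases "even k")
      case True
      then obtain u v where uv: "linked4 (A \<inter> rect 0 (2 * l k - 1) 0 (l k - 1)) u v" "fst u = 0" "fst v = 2 * l k - 1"
        "linked4 (A \<inter> ?N) (0, 0) u" using Suc by blast
      obtain x y where xy: "linked4 (A \<inter> rect 0 (l (Suc k) - 1) 0 (2 * l (Suc k) - 1)) x y" "snd x = 0" "snd y = 2 * l (Suc k) - 1"
        using tb[of "Suc k"] True by auto
      have "linked4 (A \<inter> ?N) u x"
        by (rule lr_tb_linked[OF uv(1-3) xy _ _ _ _ sub2]) (use l(1)[of k] in \<open>simp_all add: l(2)\<close>)
      from linked_trans[OF uv(4) this] show ?thesis using xy True by (intro conjI impI exI[of _ x] exI[of _ y]) simp_all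
    next
      case False
      then obtain x y where xy: "linked4 (A \<inter> rect 0 (l k - 1) 0 (2 * l k - 1)) x y" "snd x = 0" "snd y = 2 * l k - 1"
        "linked4 (A \<inter> ?N) (0, 0) x" using Suc by blast
      obtain u v where uv: "linked4 (A \<inter> rect 0 (2 * l (Suc k) - 1) 0 (l (Suc k) - 1)) u v" "fst u = 0" "fst v = 2 * l (Suc k) - 1"
        using lr[of "Suc k"] False by auto
      have "linked4 (A \<inter> ?N) u x"
        by (rule lr_tb_linked[OF uv xy(1-3) _ _ _ _ sub2]) (use l(1)[of k] in \<open>simp_all add: l(2)\<close>)
      from linked_trans[OF xy(4) linked4_sym[OF this]] show ?thesis using uv False
        by (intro conjI impI exI[of _ u] exI[of _ v]) simp_all
    qed
  qed
  note this[of K]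
  then obtain b d u v where uv: "linked4 (A \<inter> rect 0 b 0 d) u v" "linked4 (A \<inter> ?N) (0, 0) u"
    "fst v = 2 * l K - 1 \<or> snd v = 2 * l K - 1"
    by (cases "even K") blast+
  have v: "linked4 (A \<inter> ?N) (0, 0) v" by (rule linked_trans[OF uv(2) linked_subset[OF uv(1) sub]])
  have "0 \<le> fst v" "0 \<le> snd v" using linked_inD(2)[OF v] by auto
  then show ?thesis using v uv(3) l(1,3)[of K] by (intro exI[of _ v]) auto
qed

section \<open>Critical percolation on the quarter plane\<close>

definition emb :: "nat \<times> nat \<Rightarrow> int \<times> int" where
  "emb v = (int (fst v), int (snd v))"

lemma inj_emb: "inj emb"
  by (auto simp: emb_def inj_def prod_eq_iff)

lemma range_emb: "z \<in> range emb \<longleftrightarrow> 0 \<le> fst z \<and> 0 \<le> snd z"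
proof
  assume "0 \<le> fst z \<and> 0 \<le> snd z"
  then have "z = emb (nat (fst z), nat (snd z))" by (simp add: emb_def prod_eq_iff)
  then show "z \<in> range emb" by (rule range_eqI)
qed (auto simp: emb_def)

lemma adj4_emb: "adj4 (emb u) (emb v) \<longleftrightarrow> adjacent u v"
  by (simp add: adj4_def adjacent_def emb_def)

lemma linked_emb:
  assumes "linked4 (emb ` S) (emb u) z"
  shows "\<exists>v. z = emb v \<and> linked adjacent S u v"
  using assms
proof (induction rule: linked_induct)
  case refl
  then have "u \<in> S" using inj_image_mem_iff[OF inj_emb] by blast
  from linked_refl[OF this] show ?case by blast
next
  case (step x y)
  then obtain v w where "x = emb v" "linked adjacent S u v" "y = emb w" "w \<in> S" by blast
  moreover from this have "adjacent v w" using step.hyps(2) by (simp add: adj4_emb)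
  ultimately show ?case using linked_step[of adjacent S u v w] by blast
qed

text \<open>
  Loops are removed by cutting back to the first visit of a repeated site.
\<close>

lemma linked_imp_path:
  assumes "linked adjacent S u v"
  shows "\<exists>vs. is_path vs \<and> hd vs = u \<and> last vs = v \<and> set vs \<subseteq> S"
  using assms
proof (induction rule: linked_induct)
  case refl then show ?case by (intro exI[of _ "[u]"]) (auto simp: is_path_def)
next
  case (step x y)
  then obtain vs where vs: "is_path vs" "hd vs = u" "last vs = x" "set vs \<subseteq> S" by blast
  show ?case
  proof (cases "y \<in> set vs")
    case True
    then obtain xs ys where "vs = xs @ y # ys" by (meson split_list)
    then show ?thesis using vs
      by (intro exI[of _ "xs @ [y]"]) (auto simp: is_path_def successively_append_iff hd_append)
  next
    case False
    then show ?thesis using vs step.hyps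
      by (intro exI[of _ "vs @ [y]"]) (auto simp: is_path_def successively_append_iff hd_append)
  qed
qed

lemma successively_linked:
  assumes "vs \<noteq> []" "successively A vs" "set vs \<subseteq> S"
  shows "linked A S (hd vs) (last vs)"
  using assms
proof (induction vs rule: rev_nonempty_induct)
  case (single x) then show ?case by (auto intro: linked_refl)
next
  case (snoc x xs)
  then have "linked A S (hd xs) (last xs)" "A (last xs) x" "x \<in> S"
    by (auto simp: successively_append_iff)
  from linked_step[OF this] show ?case using snoc.hyps by (simp add: hd_append)
qed

lemma connected_by_open_iff: "connected_by_open \<omega> u v \<longleftrightarrow> linked adjacent {w. \<omega> w} u v"
proof
  assume "connected_by_open \<omega> u v"
  then obtain vs where "is_path vs" "hd vs = u" "last vs = v" "\<forall>w\<in>set vs. \<omega> w"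
    by (auto simp: connected_by_open_def)
  then show "linked adjacent {w. \<omega> w} u v"
    using successively_linked[of vs adjacent "{w. \<omega> w}"] by (auto simp: is_path_def)
next
  assume "linked adjacent {w. \<omega> w} u v"
  then show "connected_by_open \<omega> u v"
    using linked_imp_path unfolding connected_by_open_def by blast
qed

lemma percolation_eq: "percolation \<Xi> p q = site_measure (\<lambda>v. if v \<in> \<Xi> then p else q)"
  by (simp add: percolation_def site_measure_def)

lemma pr_emb:
  assumes "cyl V Q" "V \<subseteq> range emb" "\<And>v. s (emb v) = r v"
    and "\<And>v. 0 \<le> r v \<and> r v \<le> 1" "\<And>v. 0 \<le> s v \<and> s v \<le> 1"
  shows "pr r (\<lambda>A. Q (emb ` A)) = pr s Q"
proof (rule pr_transfer[OF inj_emb, of "emb -` V"])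
  have "emb ` (emb -` V) = V" using assms(2) by blast
  then show "cyl (emb ` (emb -` V)) Q" using assms(1) by simp
  show "finite (emb -` V)" using cylD(1)[OF assms(1)] inj_emb by (simp add: finite_vimageI)
qed (use assms in auto)

lemma cyl_emb:
  assumes "cyl V Q" shows "cyl (emb -` V) (\<lambda>A. Q (emb ` A))"
proof -
  have "emb ` (A \<inter> emb -` V) = emb ` A \<inter> V" for A by blast
  then show ?thesis using cylD[OF assms] inj_emb unfolding cyl_def
    by (auto simp: finite_vimageI)
qed

lemma rect_subset_range: "0 \<le> a \<Longrightarrow> 0 \<le> c \<Longrightarrow> rect a b c d \<subseteq> range emb"
  by (auto simp: range_emb mem_rect simp del: image_iff)

lemma percolates_linked:
  assumes "\<omega> \<in> percolates"
  obtains z where "linked4 (emb ` {v. \<omega> v}) (0, 0) z" "N < fst z + snd z"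
proof -
  obtain v where v: "nat N < fst v + snd v" "connected_by_open \<omega> (0, 0) v"
    using assms unfolding percolates_alt by blast
  have "linked4 (emb ` {v. \<omega> v}) (emb (0, 0)) (emb v)"
    using v(2) unfolding connected_by_open_iff by (rule linked_image) (simp add: adj4_emb)
  then show ?thesis using v(1) that[of "emb v"] by (simp add: emb_def)
qed

theorem positive_percolation:
  assumes p: "0 \<le> p" "p \<le> 1" and L: "1 \<le> L" and d: "0 < \<delta>"
    and st: "\<And>K. pr (\<lambda>_. p) (stages L K) \<ge> \<delta>"
  shows "measure (percolation UNIV p p) percolates > 0"
proof -
  let ?M = "site_measure (\<lambda>_ :: nat \<times> nat. p)"
  define G where "G K = open_event (\<lambda>A. stages L K (emb ` A))" for K
  have "G K \<in> sets ?M" for K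
    unfolding G_def by (rule sets_open_event[OF cyl_emb[OF cyl_stages[OF L]]])
  moreover have "decseq G"
    by (auto simp: decseq_def G_def open_event_def stages_def)
  ultimately have lim: "(\<lambda>K. measure ?M (G K)) \<longlonglongrightarrow> measure ?M (\<Inter>K. G K)"
    by (intro site.finite_Lim_measure_decseq) auto
  have "measure ?M (G K) \<ge> \<delta>" for K
    using pr_emb[OF cyl_stages[OF L, of K] rect_subset_range, of "\<lambda>_. p" "\<lambda>_. p"] st[of K] p
    by (simp add: pr_def G_def)
  then have "\<delta> \<le> measure ?M (\<Inter>K. G K)"
    by (intro LIMSEQ_le_const[OF lim]) auto
  also have "(\<Inter>K. G K) \<subseteq> percolates"
  proof
    fix \<omega> assume "\<omega> \<in> (\<Inter>K. G K)"
    then have st: "stages L K (emb ` {v. \<omega> v})" for K by (auto simp: G_def open_event_def)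
    have "\<exists>v. N < fst v + snd v \<and> connected_by_open \<omega> (0, 0) v" for N
    proof -
      obtain z where z: "linked4 (emb ` {v. \<omega> v} \<inter> {z. 0 \<le> fst z \<and> 0 \<le> snd z}) (0, 0) z" "int (Suc N) \<le> fst z + snd z"
        using stages_connect[OF L st] by blast
      have "linked4 (emb ` {v. \<omega> v}) (emb (0, 0)) z"
        using linked_subset[OF z(1) Int_lower1] by (simp add: emb_def)
      from linked_emb[OF this] obtain v where "z = emb v" "linked adjacent {v. \<omega> v} (0, 0) v" by blast
      then have "N < fst v + snd v" "connected_by_open \<omega> (0, 0) v"
        using z(2) unfolding connected_by_open_iff emb_def by simp_all
      then show ?thesis by blast
    qed
    then show "\<omega> \<in> percolates" by (simp add: percolates_alt)
  qed
  then have "measure ?M (\<Inter>K. G K) \<le> measure ?M percolates"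
    using percolates_measurable[of UNIV p p] by (intro site.finite_measure_mono) (auto simp: percolation_eq)
  finally show ?thesis using d by (simp add: percolation_eq)
qed

text \<open>
  The supremum defining \<open>p_c\<close> is over a nonempty bounded set: at \<open>p = 0\<close> the origin is closed.
\<close>

lemma p_c_set:
  defines "Z \<equiv> {p \<in> {0..1}. measure (percolation UNIV p p) percolates = 0}"
  shows "0 \<in> Z" "bdd_above Z" "0 \<le> p_c" "p_c \<le> 1"
proof -
  have "open_event (\<lambda>A. (0, 0) \<in> A) \<in> sets (site_measure (\<lambda>_ :: nat \<times> nat. 0))"
    by (rule sets_open_event[of "{(0, 0)}"]) (auto simp: cyl_def)
  moreover have "percolates \<subseteq> open_event (\<lambda>A. (0, 0) \<in> A)"
  proof
    fix \<omega> assume "\<omega> \<in> percolates"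
    then obtain v where "connected_by_open \<omega> (0, 0) v" unfolding percolates_alt by blast
    then have "linked adjacent {w. \<omega> w} (0, 0) v" unfolding connected_by_open_iff .
    from linked_inD(1)[OF this] show "\<omega> \<in> open_event (\<lambda>A. (0, 0) \<in> A)"
      by (simp add: open_event_def)
  qed
  ultimately have "measure (percolation UNIV 0 0) percolates \<le> pr (\<lambda>_ :: nat \<times> nat. 0) (\<lambda>A. (0, 0) \<in> A)"
    unfolding pr_def percolation_eq by (simp add: site.finite_measure_mono)
  also have "\<dots> = 0" by (rule pr_zero[of "{(0, 0)}"]) (auto simp: cyl_def)
  finally have "measure (percolation UNIV 0 0) percolates = 0" by (simp add: measure_le_0_iff)
  then show Z0: "0 \<in> Z" unfolding Z_def by simp
  show bdd: "bdd_above Z" unfolding Z_def by (rule bdd_aboveI[of _ 1]) auto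
  have pc: "p_c = Sup Z" by (simp add: p_c_def Z_def)
  show "0 \<le> p_c" unfolding pc by (rule cSup_upper[OF Z0 bdd])
  show "p_c \<le> 1" unfolding pc
  proof (rule cSup_least)
    show "Z \<noteq> {}" using Z0 by blast
  qed (auto simp: Z_def)
qed

text \<open>
  Otherwise \<open>stretched_crossing\<close> applies at \<open>p_c\<close> with error below \<open>1 / 1500\<close>, and by continuity the finite-size
  criterion holds in a neighbourhood of \<open>p_c\<close>.  The supremum \<open>p_c\<close> is approximated by parameters without percolation, for which this
  is impossible.
\<close>

theorem critical_near_squares:
  "\<exists>c>0. \<forall>n0. \<exists>n\<ge>n0. 1 \<le> n \<and> pr (\<lambda>_. p_c) (lr 0 (9 * n) 0 (10 * n)) \<le> 1 - c"
proof (rule ccontr)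
  assume neg: "\<not> ?thesis"
  (* Then 6 * t = 1 / 3000, half of the error allowed by the finite-size criterion. *)
  define t :: real where "t = 1 / 18000"
  have t: "0 < t ^ 4" by (simp add: t_def)
  have "\<not> (\<forall>n0. \<exists>n\<ge>n0. 1 \<le> n \<and> pr (\<lambda>_. p_c) (lr 0 (9 * n) 0 (10 * n)) \<le> 1 - t ^ 4)"
    using neg t by blast
  then obtain n0 where n0: "\<And>n. n0 \<le> n \<Longrightarrow> 1 \<le> n \<Longrightarrow> pr (\<lambda>_. p_c) (lr 0 (9 * n) 0 (10 * n)) > 1 - t ^ 4"
    by (meson linorder_not_le)
  define u where "u = max n0 1"
  have u: "1 \<le> u" "n0 \<le> u" by (auto simp: u_def)
  note pc = p_c_set(3,4)
  let ?Q = "lr 0 (205 * u) 0 (180 * u)"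
  have "pr (\<lambda>_. p_c) ?Q \<ge> 1 - 6 * t"
  proof (rule stretched_crossing[OF pc u(1)])
    fix j assume "j \<in> {9 * u, 10 * u, 18 * u}"
    then have "n0 \<le> j" "1 \<le> j" using u by auto
    then show "1 - t ^ 4 \<le> pr (\<lambda>_. p_c) (lr 0 (9 * j) 0 (10 * j))" using n0 by force
  qed (auto simp: t_def)
  then have Q: "pr (\<lambda>_. p_c) ?Q > 1 - 1 / 1500" by (simp add: t_def)
  have "continuous_on {0..1} (\<lambda>p. pr (\<lambda>_. p) ?Q)" by (rule continuous_on_pr[OF cyl_lr])
  then have "\<forall>e>0. \<exists>d>0. \<forall>p\<in>{0..1}. dist p p_c < d \<longrightarrow> dist (pr (\<lambda>_. p) ?Q) (pr (\<lambda>_. p_c) ?Q) < e"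
    using pc unfolding continuous_on_iff by auto
  then obtain d where d: "d > 0" "\<And>p. p \<in> {0..1} \<Longrightarrow> dist p p_c < d \<Longrightarrow>
      dist (pr (\<lambda>_. p) ?Q) (pr (\<lambda>_. p_c) ?Q) < pr (\<lambda>_. p_c) ?Q - (1 - 1 / 1500)"
    using Q by (metis diff_gt_0_iff_gt)
  define Z where "Z = {p \<in> {0..1}. measure (percolation UNIV p p) percolates = 0}"
  have Zf: "0 \<in> Z" "bdd_above Z" using p_c_set(1,2) by (simp_all add: Z_def)
  have "p_c = Sup Z" by (simp add: p_c_def Z_def)
  then have "p_c - d < Sup Z" using d(1) by simp
  then obtain p where p: "p \<in> Z" "p_c - d < p" using Zf by (subst (asm) less_cSup_iff) auto
  have "p \<le> p_c" unfolding \<open>p_c = Sup Z\<close> by (rule cSup_upper[OF p(1) Zf(2)])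
  have p01: "0 \<le> p" "p \<le> 1" using p(1) by (auto simp: Z_def)
  have "dist p p_c < d" using p(2) \<open>p \<le> p_c\<close> by (simp add: dist_real_def)
  with d(2)[of p] p01 have "pr (\<lambda>_. p) ?Q \<ge> 1 - 1 / 1500" by (simp add: dist_real_def)
  from finite_size_criterion[OF p01 u(1) this] obtain L \<delta> where
    "1 \<le> L" "0 < \<delta>" "\<And>K. pr (\<lambda>_. p) (stages L K) \<ge> \<delta>" by blast
  from positive_percolation[OF p01 this] p(1) show False by (simp add: Z_def)
qed

text \<open>
  A crossing of the L-shaped region between the squares of side \<open>n\<close> and \<open>10 * n\<close> contains a horizontal crossing of its
  vertical leg or a vertical crossing of its horizontal leg.
\<close>

definition L_crossed :: "int \<Rightarrow> (int \<times> int) set \<Rightarrow> bool" where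
  "L_crossed n A \<longleftrightarrow> lr n (10 * n) 0 (10 * n) A \<or> tb 0 (10 * n) n (10 * n) A"

definition L_region :: "int \<Rightarrow> (int \<times> int) set" where
  "L_region n = rect n (10 * n) 0 (10 * n) \<union> rect 0 (10 * n) n (10 * n)"

lemma cyl_L_crossed: "cyl (L_region n) (L_crossed n)"
  unfolding L_crossed_def L_region_def by (rule cyl_disj[OF cyl_lr cyl_tb])

text \<open>
  Both legs fail to be crossed with probability at least \<open>c * c\<close>, by positive association.
\<close>

lemma pr_L_crossed:
  assumes p: "0 \<le> p" "p \<le> 1" and "0 \<le> c" "pr (\<lambda>_. p) (lr 0 (9 * n) 0 (10 * n)) \<le> 1 - c"
  shows "pr (\<lambda>_. p) (L_crossed n) \<le> 1 - c\<^sup>2"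
proof -
  have "pr (\<lambda>_. p) (lr n (10 * n) 0 (10 * n)) \<le> 1 - c"
    using pr_lr_translate[OF p, of 0 n "9 * n" 0 0 "10 * n"] assms(4) by simp
  moreover from this have "pr (\<lambda>_. p) (tb 0 (10 * n) n (10 * n)) \<le> 1 - c"
    by (simp add: pr_tb_swap[OF p])
  ultimately have "c * c \<le> (1 - pr (\<lambda>_. p) (lr n (10 * n) 0 (10 * n))) * (1 - pr (\<lambda>_. p) (tb 0 (10 * n) n (10 * n)))"
    using assms(3) by (intro mult_mono) auto
  also have "\<dots> \<le> 1 - pr (\<lambda>_. p) (L_crossed n)"
    unfolding L_crossed_def by (rule square_root_trick[OF cyl_lr cyl_tb mono_lr mono_tb]) (use p in auto)
  finally show ?thesis by (simp add: power2_eq_square)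
qed

lemma percolates_L_crossed:
  assumes "\<omega> \<in> percolates" "1 \<le> n"
  shows "L_crossed n (emb ` {v. \<omega> v})"
proof -
  let ?O = "emb ` {v. \<omega> v}" and ?T = "rect 0 (10 * n) 0 (10 * n)"
  obtain z where z: "linked4 ?O (0, 0) z" "20 * n < fst z + snd z"
    using percolates_linked[OF assms(1)] by blast
  have zT: "z \<notin> ?T" using z(2) by (auto simp: mem_rect)
  have "(0, 0) \<in> ?T" using assms(2) by (simp add: mem_rect)
  from linked_stays_or_leaves[OF z(1) this]
  obtain x y where xy: "linked4 (?O \<inter> ?T) (0, 0) x" "adj4 x y" "y \<in> ?O" "y \<notin> ?T"
  proof
    assume "linked4 (?O \<inter> ?T) (0, 0) z"
    from linked_inD(2)[OF this] zT show ?thesis by blast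
  qed blast
  have "0 \<le> fst y" "0 \<le> snd y" using xy(3) by (auto simp: emb_def)
  moreover have "x \<in> ?T" using linked_inD(2)[OF xy(1)] by simp
  ultimately have far: "fst x = 10 * n \<or> snd x = 10 * n"
    using xy(2,4) by (auto simp: mem_rect adj4_def)
  have ad: "\<bar>fst x - fst y\<bar> \<le> 1" "\<bar>snd x - snd y\<bar> \<le> 1" if "adj4 x y" for x y
    using that by (auto simp: adj4_def)
  from far show ?thesis
  proof
    assume f: "fst x = 10 * n"
    obtain u' where u': "fst u' = n" "linked4 (?O \<inter> ?T \<inter> {x. n \<le> fst x}) u' x"
      using linked_crop[OF xy(1), of fst n, OF _ _ ad(1)] f assms(2) by auto
    have "linked4 (?O \<inter> rect n (10 * n) 0 (10 * n)) u' x"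
      by (rule linked_subset[OF u'(2)]) (auto simp: mem_rect)
    from lrI[OF this u'(1) f] show ?thesis by (simp add: L_crossed_def)
  next
    assume f: "snd x = 10 * n"
    obtain u' where u': "snd u' = n" "linked4 (?O \<inter> ?T \<inter> {x. n \<le> snd x}) u' x"
      using linked_crop[OF xy(1), of snd n, OF _ _ ad(2)] f assms(2) by auto
    have "linked4 (?O \<inter> rect 0 (10 * n) n (10 * n)) u' x"
      by (rule linked_subset[OF u'(2)]) (auto simp: mem_rect)
    then show ?thesis using u'(1) f unfolding L_crossed_def tb_def by blast
  qed
qed

text \<open>
  Along a rapidly increasing sequence of scales the L-shaped regions are disjoint, so the crossings are independent; within a
  region the model agrees with the homogeneous one of parameter \<open>q\<close>.
\<close>

theorem no_percolation_if_L_regions_free: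
  assumes p: "0 \<le> p" "p \<le> 1" and q: "0 \<le> q" "q \<le> 1" and c: "0 < c"
    and free: "\<And>n0. \<exists>n\<ge>n0. 1 \<le> n \<and> pr (\<lambda>_. q) (lr 0 (9 * n) 0 (10 * n)) \<le> 1 - c \<and> emb ` \<Xi> \<inter> L_region n = {}"
  shows "measure (percolation \<Xi> p q) percolates = 0"
proof -
  define s where "s z = (if z \<in> emb ` \<Xi> then p else q)" for z
  define r where "r v = (if v \<in> \<Xi> then p else q)" for v
  have sr: "s (emb v) = r v" for v by (simp add: s_def r_def inj_image_mem_iff[OF inj_emb])
  have r01: "0 \<le> r v \<and> r v \<le> 1" and s01: "0 \<le> s z \<and> s z \<le> 1" for v z
    using p q by (auto simp: r_def s_def)
  have c1: "c \<le> 1"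
    using free[of 0] pr_nonneg[of "\<lambda>_. q"] by (smt (verit))
  have c2: "0 \<le> 1 - c\<^sup>2" using c c1 by (simp add: power_le_one)
  have events: "\<exists>Q B. cyl (rect 0 B 0 B) Q \<and> pr s Q \<le> (1 - c\<^sup>2) ^ M \<and> (\<forall>\<omega>\<in>percolates. Q (emb ` {v. \<omega> v}))" for M
  proof (induction M)
    case 0
    then show ?case by (intro exI[of _ "\<lambda>_. True"] exI[of _ 0]) (simp add: cyl_def pr_True)
  next
    case (Suc M)
    then obtain Q B where Q: "cyl (rect 0 B 0 B) Q" "pr s Q \<le> (1 - c\<^sup>2) ^ M" "\<forall>\<omega>\<in>percolates. Q (emb ` {v. \<omega> v})"
      by blast
    obtain n where n: "B + 1 \<le> n" "1 \<le> n" "pr (\<lambda>_. q) (lr 0 (9 * n) 0 (10 * n)) \<le> 1 - c" "emb ` \<Xi> \<inter> L_region n = {}"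
      using free[of "B + 1"] by blast
    have disj: "rect 0 B 0 B \<inter> L_region n = {}" using n(1) by (auto simp: L_region_def mem_rect)
    have "pr s (L_crossed n) = pr (\<lambda>_. q) (\<lambda>A. L_crossed n (id ` A))"
      by (rule pr_transfer[symmetric, where V = "L_region n"])
        (use cyl_L_crossed[of n] n(4) q s01 in \<open>auto simp: s_def L_region_def\<close>)
    also have "\<dots> \<le> 1 - c\<^sup>2" using pr_L_crossed[OF q _ n(3)] c by simp
    finally have "pr s Q * pr s (L_crossed n) \<le> (1 - c\<^sup>2) ^ M * (1 - c\<^sup>2)"
      using Q(2) c2 pr_nonneg by (intro mult_mono) auto
    then have "pr s (\<lambda>A. Q A \<and> L_crossed n A) \<le> (1 - c\<^sup>2) ^ Suc M"
      using pr_independent[where r = s, OF Q(1) cyl_L_crossed disj s01] by (simp add: mult.commute)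
    moreover have "cyl (rect 0 (max B (10 * n)) 0 (max B (10 * n))) (\<lambda>A. Q A \<and> L_crossed n A)"
      by (rule cyl_mono[OF cyl_conj[OF Q(1) cyl_L_crossed]]) (use n(2) in \<open>auto simp: L_region_def mem_rect\<close>)
    ultimately show ?case using Q(3) percolates_L_crossed[OF _ n(2)] by blast
  qed
  have bound: "measure (percolation \<Xi> p q) percolates \<le> (1 - c\<^sup>2) ^ M" for M
  proof -
    obtain Q B where Q: "cyl (rect 0 B 0 B) Q" "pr s Q \<le> (1 - c\<^sup>2) ^ M" "\<forall>\<omega>\<in>percolates. Q (emb ` {v. \<omega> v})"
      using events by blast
    have "measure (site_measure r) percolates \<le> pr r (\<lambda>A. Q (emb ` A))"
      unfolding pr_def using Q(3) sets_open_event[OF cyl_emb[OF Q(1)]]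
      by (intro site.finite_measure_mono) (auto simp: open_event_def)
    also have "\<dots> = pr s Q"
      by (rule pr_emb[where r = r and s = s, OF Q(1) rect_subset_range]) (simp_all add: sr r01 s01)
    finally have "measure (site_measure r) percolates \<le> (1 - c\<^sup>2) ^ M" using Q(2) by simp
    moreover have "r = (\<lambda>v. if v \<in> \<Xi> then p else q)" by (simp add: r_def fun_eq_iff)
    ultimately show ?thesis by (simp only: percolation_eq)
  qed
  have "(\<lambda>M. (1 - c\<^sup>2) ^ M) \<longlonglongrightarrow> 0"
    using c c2 by (intro LIMSEQ_power_zero) (simp add: abs_le_iff)
  then have "measure (percolation \<Xi> p q) percolates \<le> 0"
    by (rule LIMSEQ_le_const) (use bound in auto)
  then show ?thesis by (simp add: measure_le_0_iff)
qed

section \<open>Long jumps of heavy-tailed random walks\<close>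

text \<open>
  Finiteness of \<open>J\<close> makes the corresponding event measurable for every \<open>Q\<close>.  Index 0 is excluded, since nothing is assumed about
  that spacing.
\<close>

definition determined :: "nat set \<Rightarrow> ((nat \<Rightarrow> nat) \<Rightarrow> bool) \<Rightarrow> bool" where
  "determined J Q \<longleftrightarrow> finite J \<and> J \<subseteq> {1..} \<and> (\<forall>f g. (\<forall>i\<in>J. f i = g i) \<longrightarrow> Q f = Q g)"

lemma determined_restrict: "determined J Q \<Longrightarrow> Q (restrict f J) = Q f"
  unfolding determined_def by (metis restrict_apply')

lemma determined_mono: "determined J Q \<Longrightarrow> J \<subseteq> J' \<Longrightarrow> finite J' \<Longrightarrow> J' \<subseteq> {1..} \<Longrightarrow> determined J' Q"
  unfolding determined_def by blast

lemma determined_sum: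
  assumes "finite J" "J \<subseteq> {1..}" shows "determined J (\<lambda>f. P (\<Sum>i\<in>J. f i))"
proof -
  have "(\<Sum>i\<in>J. f i) = (\<Sum>i\<in>J. g i)" if "\<forall>i\<in>J. f i = g i" for f g :: "nat \<Rightarrow> nat"
    using that by (intro sum.cong) auto
  then show ?thesis using assms unfolding determined_def by metis
qed

text \<open>
  The event that produces a gap: in the block that starts after index \<open>m\<close>, the spacing number \<open>j\<close> is long compared with the sum of
  those before it.
\<close>

definition jump :: "nat \<Rightarrow> nat \<Rightarrow> nat \<Rightarrow> nat \<Rightarrow> (nat \<Rightarrow> nat) \<Rightarrow> bool" where
  "jump \<kappa> m T j f \<longleftrightarrow> (\<Sum>i\<in>{m<..<m + j}. f i) < T \<and> \<kappa> * T < f (m + j)"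

lemma determined_jump: "1 \<le> j \<Longrightarrow> determined {m<..m + j} (jump \<kappa> m T j)"
proof -
  assume j: "1 \<le> j"
  have "jump \<kappa> m T j f = jump \<kappa> m T j g" if "\<forall>i\<in>{m<..m + j}. f i = g i" for f g
  proof -
    have "(\<Sum>i\<in>{m<..<m + j}. f i) = (\<Sum>i\<in>{m<..<m + j}. g i)" using that by (intro sum.cong) auto
    moreover have "f (m + j) = g (m + j)" using that j by auto
    ultimately show ?thesis by (simp add: jump_def)
  qed
  then show ?thesis by (auto simp: determined_def)
qed

context prob_space
begin

definition seq_event :: "(nat \<Rightarrow> 'a \<Rightarrow> nat) \<Rightarrow> ((nat \<Rightarrow> nat) \<Rightarrow> bool) \<Rightarrow> 'a set" where
  "seq_event X Q = {\<omega> \<in> space M. Q (\<lambda>i. X i \<omega>)}"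

definition tail :: "(nat \<Rightarrow> 'a \<Rightarrow> nat) \<Rightarrow> real \<Rightarrow> real" where
  "tail X t = prob {\<omega> \<in> space M. real (X 1 \<omega>) > t}"

lemma iid_measurable: "iid_seq X \<Longrightarrow> 1 \<le> k \<Longrightarrow> X k \<in> measurable M (count_space UNIV)"
  by (auto simp: iid_seq_def indep_vars_def)

lemma sets_tail_event:
  assumes "iid_seq X" "1 \<le> k" shows "{\<omega> \<in> space M. real (X k \<omega>) > t} \<in> events"
proof -
  have [measurable]: "X k \<in> measurable M (count_space UNIV)" by (rule iid_measurable[OF assms])
  show ?thesis by measurable
qed

lemma sets_discrete_PiM:
  fixes S :: "(nat \<Rightarrow> nat) set"
  assumes "finite J" "S \<subseteq> PiE J (\<lambda>_. UNIV)"
  shows "S \<in> sets (PiM J (\<lambda>_. count_space UNIV))"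
proof -
  have "PiM J (\<lambda>_. count_space UNIV :: nat measure) = count_space (PiE J (\<lambda>_. UNIV))"
    by (rule count_space_PiM_finite[OF assms(1)]) simp
  then show ?thesis using assms(2) by simp
qed

lemma sets_seq_event:
  assumes iid: "iid_seq X" and det: "determined J Q"
  shows "seq_event X Q \<in> events"
proof -
  have J: "finite J" "J \<subseteq> {1..}" using det by (auto simp: determined_def)
  have "(\<lambda>\<omega>. restrict (\<lambda>i. X i \<omega>) J) \<in> measurable M (PiM J (\<lambda>_. count_space UNIV))"
    using J iid_measurable[OF iid] by (intro measurable_restrict) auto
  then have "(\<lambda>\<omega>. restrict (\<lambda>i. X i \<omega>) J) -` {f \<in> PiE J (\<lambda>_. UNIV). Q f} \<inter> space M \<in> events"
    by (rule measurable_sets) (rule sets_discrete_PiM[OF J(1)], blast)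
  also have "(\<lambda>\<omega>. restrict (\<lambda>i. X i \<omega>) J) -` {f \<in> PiE J (\<lambda>_. UNIV). Q f} \<inter> space M = seq_event X Q"
    using determined_restrict[OF det] by (auto simp: seq_event_def)
  finally show ?thesis .
qed

lemma prob_seq_event_conj:
  assumes iid: "iid_seq X" and det: "determined J Q" "determined J' Q'" and disj: "J \<inter> J' = {}"
  shows "prob (seq_event X (\<lambda>f. Q f \<and> Q' f)) = prob (seq_event X Q) * prob (seq_event X Q')"
proof -
  have J: "finite J" "J \<subseteq> {1..}" "finite J'" "J' \<subseteq> {1..}" using det by (auto simp: determined_def)
  have ind: "indep_var (PiM J (\<lambda>_. count_space UNIV)) (\<lambda>\<omega>. restrict (\<lambda>i. X i \<omega>) J)
      (PiM J' (\<lambda>_. count_space UNIV)) (\<lambda>\<omega>. restrict (\<lambda>i. X i \<omega>) J')"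
    using iid J disj by (intro indep_var_restrict[where I = "{1..}"]) (auto simp: iid_seq_def)
  let ?S = "{f \<in> PiE J (\<lambda>_. UNIV). Q f}" and ?S' = "{f \<in> PiE J' (\<lambda>_. UNIV). Q' f}"
  have pre: "(\<lambda>\<omega>. restrict (\<lambda>i. X i \<omega>) J) -` ?S \<inter> space M = seq_event X Q"
    "(\<lambda>\<omega>. restrict (\<lambda>i. X i \<omega>) J') -` ?S' \<inter> space M = seq_event X Q'"
    "(\<lambda>\<omega>. (restrict (\<lambda>i. X i \<omega>) J, restrict (\<lambda>i. X i \<omega>) J')) -` (?S \<times> ?S') \<inter> space M
      = seq_event X (\<lambda>f. Q f \<and> Q' f)"
    using determined_restrict[OF det(1)] determined_restrict[OF det(2)] by (auto simp: seq_event_def)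
  show ?thesis
    using indep_varD[OF ind, of ?S ?S'] sets_discrete_PiM[of J ?S] sets_discrete_PiM[of J' ?S'] J
    unfolding pre by blast
qed

lemma prob_tail:
  assumes iid: "iid_seq X" and k: "1 \<le> k"
  shows "prob {\<omega> \<in> space M. real (X k \<omega>) > t} = tail X t"
proof -
  have eq: "prob {\<omega> \<in> space M. real (X j \<omega>) > t} = measure (distr M (count_space UNIV) (X j)) {n. real n > t}"
    if "1 \<le> j" for j
  proof -
    have "measure (distr M (count_space UNIV) (X j)) {n. real n > t} = prob (X j -` {n. real n > t} \<inter> space M)"
      by (rule measure_distr[OF iid_measurable[OF iid that]]) simp
    also have "X j -` {n. real n > t} \<inter> space M = {\<omega> \<in> space M. real (X j \<omega>) > t}" by auto
    finally show ?thesis by simp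
  qed
  have same: "distr M (count_space UNIV) (X k) = distr M (count_space UNIV) (X 1)"
    using iid k unfolding iid_seq_def by blast
  have "prob {\<omega> \<in> space M. real (X k \<omega>) > t} = measure (distr M (count_space UNIV) (X k)) {n. real n > t}"
    by (rule eq[OF k])
  also have "\<dots> = measure (distr M (count_space UNIV) (X 1)) {n. real n > t}"
    unfolding same ..
  also have "\<dots> = tail X t"
    unfolding tail_def by (rule eq[OF order_refl, symmetric])
  finally show ?thesis .
qed

text \<open>
  Replacing each summand by its minimum with \<open>T\<close> does not change whether the sum reaches \<open>T\<close>, and the expectation of such a
  minimum is the sum of the tail over \<open>{..<T}\<close>; this is Markov's inequality for the truncated sum.
\<close>

lemma truncated_sum_bound:
  assumes iid: "iid_seq X" and J: "finite J" "J \<subseteq> {1..}" and T: "0 < (T::nat)"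
  shows "prob (seq_event X (\<lambda>f. T \<le> (\<Sum>i\<in>J. f i))) \<le> real (card J) * (\<Sum>s<T. tail X (real s)) / real T"
proof -
  let ?I = "\<lambda>i s \<omega>. indicat_real {\<omega> \<in> space M. real (X i \<omega>) > real s} \<omega>"
  have ev: "{\<omega> \<in> space M. real (X i \<omega>) > real s} \<in> events" if "i \<in> J" for i s
    by (rule sets_tail_event[OF iid]) (use that J(2) in auto)
  have int: "integrable M (?I i s)" if "i \<in> J" for i s
    using ev[OF that] by (simp add: emeasure_eq_measure)
  let ?Y = "\<lambda>\<omega>. \<Sum>i\<in>J. \<Sum>s<T. ?I i s \<omega>"
  have intY: "integrable M ?Y" using int by (intro Bochner_Integration.integrable_sum) auto
  have EI: "(\<integral>\<omega>. ?I i s \<omega> \<partial>M) = tail X (real s)" if "i \<in> J" for i s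
    using prob_tail[OF iid, of i "real s"] ev[OF that, of s] that J(2) by (auto simp: Int_absorb1)
  have "(\<integral>\<omega>. ?Y \<omega> \<partial>M) = (\<Sum>i\<in>J. \<Sum>s<T. (\<integral>\<omega>. ?I i s \<omega> \<partial>M))"
    using int by (simp add: Bochner_Integration.integral_sum Bochner_Integration.integrable_sum)
  also have "\<dots> = (\<Sum>i\<in>J. \<Sum>s<T. tail X (real s))"
    by (intro sum.cong refl EI)
  finally have EY: "(\<integral>\<omega>. ?Y \<omega> \<partial>M) = real (card J) * (\<Sum>s<T. tail X (real s))" by simp
  have sm: "(\<Sum>s<T. ?I i s \<omega>) = real (min (X i \<omega>) T)" if "\<omega> \<in> space M" for i \<omega>
  proof -
    have "(\<Sum>s<T. ?I i s \<omega>) = (\<Sum>s<T. if s < X i \<omega> then 1 else 0)"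
      using that by (intro sum.cong) (auto simp: indicator_def)
    also have "\<dots> = real (card ({..<T} \<inter> {s. s < X i \<omega>}))" by (simp add: sum.If_cases)
    also have "{..<T} \<inter> {s. s < X i \<omega>} = {..<min (X i \<omega>) T}" by auto
    finally show ?thesis by simp
  qed
  have "seq_event X (\<lambda>f. T \<le> (\<Sum>i\<in>J. f i)) \<subseteq> {\<omega> \<in> space M. ?Y \<omega> \<ge> real T}"
  proof
    fix \<omega> assume w: "\<omega> \<in> seq_event X (\<lambda>f. T \<le> (\<Sum>i\<in>J. f i))"
    then have sp: "\<omega> \<in> space M" and le: "T \<le> (\<Sum>i\<in>J. X i \<omega>)" by (auto simp: seq_event_def)
    have "T \<le> (\<Sum>i\<in>J. min (X i \<omega>) T)"
    proof (cases "\<exists>i\<in>J. T \<le> X i \<omega>")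
      case True
      then obtain i where "i \<in> J" "T \<le> X i \<omega>" by blast
      then show ?thesis using member_le_sum[of i J "\<lambda>i. min (X i \<omega>) T"] J(1) by simp
    next
      case False
      then have "(\<Sum>i\<in>J. min (X i \<omega>) T) = (\<Sum>i\<in>J. X i \<omega>)" by (intro sum.cong) (auto simp: min_def)
      with le show ?thesis by simp
    qed
    moreover have "?Y \<omega> = real (\<Sum>i\<in>J. min (X i \<omega>) T)"
      unfolding of_nat_sum by (intro sum.cong refl sm sp)
    ultimately have "real T \<le> ?Y \<omega>" by (simp only: of_nat_le_iff)
    then show "\<omega> \<in> {\<omega> \<in> space M. ?Y \<omega> \<ge> real T}" using sp by simp
  qed
  then have "prob (seq_event X (\<lambda>f. T \<le> (\<Sum>i\<in>J. f i))) \<le> prob {\<omega> \<in> space M. ?Y \<omega> \<ge> real T}"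
    using intY by (intro finite_measure_mono) (auto dest!: borel_measurable_integrable)
  also have "\<dots> \<le> (\<integral>\<omega>. ?Y \<omega> \<partial>M) / real T"
    using T by (intro integral_Markov_inequality_measure[where A = "{}"] intY) (auto intro!: sum_nonneg)
  finally show ?thesis unfolding EY .
qed

lemma tail_antimono: "iid_seq X \<Longrightarrow> s \<le> t \<Longrightarrow> tail X t \<le> tail X s"
  unfolding tail_def by (intro finite_measure_mono sets_tail_event) auto

text \<open>
  The one-sided form of Karamata's theorem at powers of 2.  Doubling the scale divides the tail by about \<open>2 powr \<alpha>\<close>, which is
  less than 2, so the ratio of the two sides satisfies a recursion that contracts by a factor \<open>q < 1\<close>.
\<close>

lemma dyadic_karamata:
  assumes iid: "iid_seq X" and rv: "regularly_varying (tail X) \<alpha>" and \<alpha>: "\<alpha> < 1"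
  shows "\<exists>C>0. \<exists>k0. \<forall>k\<ge>k0. (\<Sum>s<2 ^ k. tail X (real s)) \<le> C * 2 ^ k * tail X (2 ^ k)"
proof -
  have pos: "tail X t > 0" if "t > 0" for t using rv that by (auto simp: regularly_varying_def)
  have lim: "((\<lambda>t. tail X (2 * t) / tail X t) \<longlongrightarrow> 2 powr (- \<alpha>)) at_top"
    using rv by (auto simp: regularly_varying_def)
  define q where "q = (2 powr (\<alpha> - 1) + 1) / 2"
  have "2 powr (\<alpha> - 1) < (1::real)" using \<alpha> by (simp add: powr_less_one)
  then have q: "2 powr (\<alpha> - 1) < q" "q < 1" "0 < q" by (auto simp: q_def add_pos_pos)
  have "1 / (2 * q) < 2 powr (- \<alpha>)"
  proof -
    have "2 powr (\<alpha> - 1) = 2 powr \<alpha> / (2::real)" by (simp add: powr_diff)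
    with q(1) have "2 powr \<alpha> < 2 * q" by simp
    then show ?thesis using q(3) by (simp add: powr_minus field_simps)
  qed
  then have "eventually (\<lambda>t. 1 / (2 * q) < tail X (2 * t) / tail X t) at_top"
    by (rule order_tendstoD(1)[OF lim])
  then obtain t0 where t0: "\<And>t. t0 \<le> t \<Longrightarrow> 1 / (2 * q) < tail X (2 * t) / tail X t"
    by (auto simp: eventually_at_top_linorder)
  obtain k0 where k0: "t0 < 2 ^ k0" using real_arch_pow[of 2 t0] by auto
  have ratio: "tail X (2 ^ k) \<le> 2 * q * tail X (2 ^ Suc k)" if "k0 \<le> k" for k
  proof -
    have "(2::real) ^ k0 \<le> 2 ^ k" using that by (simp add: power_increasing)
    then have "t0 \<le> 2 ^ k" using k0 by linarith
    then have "1 / (2 * q) < tail X (2 * 2 ^ k) / tail X (2 ^ k)" by (rule t0)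
    then show ?thesis using q(3) pos[of "2 ^ k"] by (simp add: field_simps)
  qed
  define C where "C = max ((\<Sum>s<2 ^ k0. tail X (real s)) / (2 ^ k0 * tail X (2 ^ k0))) (q / (1 - q))"
  have C: "C > 0" "q * (C + 1) \<le> C"
  proof -
    have "q / (1 - q) > 0" using q by simp
    then show "C > 0" by (simp add: C_def less_max_iff_disj)
    have "q / (1 - q) \<le> C" by (simp add: C_def)
    then show "q * (C + 1) \<le> C" using q by (simp add: field_simps)
  qed
  have "(\<Sum>s<2 ^ k. tail X (real s)) \<le> C * 2 ^ k * tail X (2 ^ k)" if "k0 \<le> k" for k
    using that
  proof (induction k rule: dec_induct)
    case base
    have "(\<Sum>s<2 ^ k0. tail X (real s)) / (2 ^ k0 * tail X (2 ^ k0)) \<le> C" by (simp add: C_def)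
    then show ?case using pos[of "2 ^ k0"] by (simp add: pos_divide_le_eq mult.assoc)
  next
    case (step k)
    have "(\<Sum>s<2 ^ Suc k. tail X (real s)) = (\<Sum>s<2 ^ k. tail X (real s)) + (\<Sum>s\<in>{2 ^ k..<2 ^ Suc k}. tail X (real s))"
      by (subst sum.atLeastLessThan_concat[symmetric, of 0 "2 ^ k", unfolded atLeast0LessThan]) (auto simp: lessThan_atLeast0 sum.atLeastLessThan_concat)
    also have "(\<Sum>s\<in>{2 ^ k..<2 ^ Suc k}. tail X (real s)) \<le> (\<Sum>s\<in>{2 ^ k..<(2::nat) ^ Suc k}. tail X (2 ^ k))"
    proof (rule sum_mono)
      fix s :: nat assume "s \<in> {2 ^ k..<2 ^ Suc k}"
      then have "(2::real) ^ k \<le> real s" by (metis atLeastLessThan_iff of_nat_le_iff of_nat_numeral of_nat_power)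
      then show "tail X (real s) \<le> tail X (2 ^ k)" by (rule tail_antimono[OF iid])
    qed
    also have "\<dots> = 2 ^ k * tail X (2 ^ k)" by simp
    finally have "(\<Sum>s<2 ^ Suc k. tail X (real s)) \<le> (C + 1) * 2 ^ k * tail X (2 ^ k)"
      using step.IH by (simp add: algebra_simps)
    also have "\<dots> \<le> (C + 1) * 2 ^ k * (2 * q * tail X (2 ^ Suc k))"
      using ratio[OF step.hyps(1)] C(1) by (intro mult_left_mono) auto
    also have "\<dots> = (q * (C + 1)) * (2 ^ Suc k * tail X (2 ^ Suc k))" by simp
    also have "\<dots> \<le> C * (2 ^ Suc k * tail X (2 ^ Suc k))"
      using C(2) pos[of "2 ^ Suc k"] by (intro mult_right_mono) auto
    finally show ?case by (simp add: mult.assoc)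
  qed
  then show ?thesis using C(1) by blast
qed

text \<open>
  For different \<open>j\<close> these events exclude each other.  As long as \<open>j\<close> is at most of the order of the inverse of the tail at \<open>2 ^ k\<close>, the partial
  sum stays below \<open>2 ^ k\<close> with probability at least \<open>1 / 2\<close>, and the probability of the long jump is comparable to the
  tail at \<open>2 ^ k\<close>.  Summing over \<open>j\<close> gives a bound that depends neither on the scale nor on \<open>m\<close>.
\<close>

lemma jump_probability:
  assumes iid: "iid_seq X" and rv: "regularly_varying (tail X) \<alpha>" and \<alpha>: "\<alpha> < 1" and \<kappa>: "1 \<le> \<kappa>"
  shows "\<exists>c>0. \<exists>k1. \<forall>k\<ge>k1. \<exists>J. \<forall>m. prob (seq_event X (\<lambda>f. \<exists>j\<in>{1..J}. jump \<kappa> m (2 ^ k) j f)) \<ge> c"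
proof -
  have pos: "tail X t > 0" if "t > 0" for t using rv that by (auto simp: regularly_varying_def)
  obtain C k0 where C: "C > 0" "\<And>k. k0 \<le> k \<Longrightarrow> (\<Sum>s<2 ^ k. tail X (real s)) \<le> C * 2 ^ k * tail X (2 ^ k)"
    using dyadic_karamata[OF iid rv \<alpha>] by blast
  define l where "l = real \<kappa> powr (- \<alpha>)"
  have l: "l > 0" using \<kappa> by (simp add: l_def)
  have "((\<lambda>t. tail X (real \<kappa> * t) / tail X t) \<longlongrightarrow> l) at_top"
    using rv \<kappa> by (auto simp: regularly_varying_def l_def)
  then have "eventually (\<lambda>t. l / 2 < tail X (real \<kappa> * t) / tail X t) at_top"
    by (rule order_tendstoD(1)) (use l in simp)
  then obtain t0 where t0: "\<And>t. t0 \<le> t \<Longrightarrow> l / 2 < tail X (real \<kappa> * t) / tail X t"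
    by (auto simp: eventually_at_top_linorder)
  obtain k2 where k2: "t0 < 2 ^ k2" using real_arch_pow[of 2 t0] by auto
  define c where "c = l / (8 * C)"
  have "\<exists>J. \<forall>m. prob (seq_event X (\<lambda>f. \<exists>j\<in>{1..J}. jump \<kappa> m (2 ^ k) j f)) \<ge> c" if k: "max k0 k2 \<le> k" for k
  proof -
    define F where "F = tail X (2 ^ k)"
    have F: "F > 0" by (simp add: F_def pos)
    define J where "J = nat \<lceil>1 / (2 * C * F)\<rceil>"
    have Jpos: "1 / (2 * C * F) > 0" using C(1) F by simp
    have J: "1 / (2 * C * F) \<le> real J" "real J < 1 / (2 * C * F) + 1"
      using Jpos unfolding J_def by linarith+
    have "(2::real) ^ k2 \<le> 2 ^ k" using k by (simp add: power_increasing)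
    then have "t0 \<le> 2 ^ k" using k2 by linarith
    from t0[OF this] have K: "tail X (real \<kappa> * 2 ^ k) \<ge> l / 2 * F"
      using F by (simp add: F_def field_simps)
    have "prob (seq_event X (\<lambda>f. \<exists>j\<in>{1..J}. jump \<kappa> m (2 ^ k) j f)) \<ge> c" for m
    proof -
      have each: "prob (seq_event X (jump \<kappa> m (2 ^ k) j)) \<ge> 1 / 2 * (l / 2 * F)" if j: "j \<in> {1..J}" for j
      proof -
        let ?B = "{m<..<m + j}"
        have B: "finite ?B" "?B \<subseteq> {1..}" "card ?B = j - 1" by auto
        have d1: "determined ?B (\<lambda>f. (\<Sum>i\<in>?B. f i) < 2 ^ k)" and d1': "determined ?B (\<lambda>f. 2 ^ k \<le> (\<Sum>i\<in>?B. f i))"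
          by (rule determined_sum[OF B(1,2)])+
        have d2: "determined {m + j} (\<lambda>f. \<kappa> * 2 ^ k < f (m + j))" using j by (auto simp: determined_def)
        have "prob (seq_event X (\<lambda>f. 2 ^ k \<le> (\<Sum>i\<in>?B. f i))) \<le> real (j - 1) * (\<Sum>s<2 ^ k. tail X (real s)) / real (2 ^ k)"
          using truncated_sum_bound[OF iid B(1,2), of "2 ^ k"] B(3) by simp
        also have "\<dots> \<le> real (j - 1) * (C * 2 ^ k * F) / real (2 ^ k)"
          using C(2)[of k] k by (intro divide_right_mono mult_left_mono) (auto simp: F_def)
        also have "\<dots> = real (j - 1) * (C * F)" by simp
        also have "\<dots> \<le> 1 / (2 * C * F) * (C * F)"
        proof (rule mult_right_mono)
          have "real (j - 1) \<le> real J - 1" using j by auto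
          then show "real (j - 1) \<le> 1 / (2 * C * F)" using J(2) by linarith
        qed (use C(1) F in simp)
        also have "\<dots> = 1 / 2" using C(1) F by simp
        finally have "prob (seq_event X (\<lambda>f. 2 ^ k \<le> (\<Sum>i\<in>?B. f i))) \<le> 1 / 2" .
        moreover have "seq_event X (\<lambda>f. (\<Sum>i\<in>?B. f i) < 2 ^ k) = space M - seq_event X (\<lambda>f. 2 ^ k \<le> (\<Sum>i\<in>?B. f i))"
          by (auto simp: seq_event_def)
        ultimately have low: "prob (seq_event X (\<lambda>f. (\<Sum>i\<in>?B. f i) < 2 ^ k)) \<ge> 1 / 2"
          using prob_compl[OF sets_seq_event[OF iid d1']] by simp
        have "seq_event X (\<lambda>f. \<kappa> * 2 ^ k < f (m + j)) = {\<omega> \<in> space M. real (X (m + j) \<omega>) > real \<kappa> * 2 ^ k}"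
          unfolding seq_event_def by (metis (no_types, opaque_lifting) of_nat_less_iff of_nat_mult of_nat_numeral of_nat_power)
        then have high: "prob (seq_event X (\<lambda>f. \<kappa> * 2 ^ k < f (m + j))) \<ge> l / 2 * F"
          using prob_tail[OF iid, of "m + j" "real \<kappa> * 2 ^ k"] j K by simp
        have "prob (seq_event X (jump \<kappa> m (2 ^ k) j)) =
            prob (seq_event X (\<lambda>f. (\<Sum>i\<in>?B. f i) < 2 ^ k)) * prob (seq_event X (\<lambda>f. \<kappa> * 2 ^ k < f (m + j)))"
          unfolding jump_def by (rule prob_seq_event_conj[OF iid d1 d2]) auto
        then show ?thesis using low high l F by (simp only:) (intro mult_mono, auto)
      qed
      have disj: "disjoint_family_on (\<lambda>j. seq_event X (jump \<kappa> m (2 ^ k) j)) {1..J}"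
      proof -
        have "\<not> (jump \<kappa> m (2 ^ k) j f \<and> jump \<kappa> m (2 ^ k) j' f)" if "1 \<le> j" "j < j'" for j j' f
        proof
          assume h: "jump \<kappa> m (2 ^ k) j f \<and> jump \<kappa> m (2 ^ k) j' f"
          have "f (m + j) \<le> (\<Sum>i\<in>{m<..<m + j'}. f i)" using that by (intro member_le_sum) auto
          moreover have "2 ^ k \<le> \<kappa> * 2 ^ k" using \<kappa> by simp
          ultimately show False using h unfolding jump_def by linarith
        qed
        then show ?thesis unfolding disjoint_family_on_def seq_event_def
          by (auto simp: neq_iff)
      qed
      have "c \<le> real J * (1 / 2 * (l / 2 * F))"
        using J(1) l F C(1) by (simp add: c_def field_simps)
      also have "\<dots> = (\<Sum>j\<in>{1..J}. 1 / 2 * (l / 2 * F))" by simp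
      also have "\<dots> \<le> (\<Sum>j\<in>{1..J}. prob (seq_event X (jump \<kappa> m (2 ^ k) j)))" by (rule sum_mono) (rule each)
      also have "\<dots> = prob (\<Union>j\<in>{1..J}. seq_event X (jump \<kappa> m (2 ^ k) j))"
        by (rule finite_measure_finite_Union[symmetric])
          (use disj sets_seq_event[OF iid determined_jump] in auto)
      also have "(\<Union>j\<in>{1..J}. seq_event X (jump \<kappa> m (2 ^ k) j)) = seq_event X (\<lambda>f. \<exists>j\<in>{1..J}. jump \<kappa> m (2 ^ k) j f)"
        by (auto simp: seq_event_def)
      finally show ?thesis .
    qed
    then show ?thesis by blast
  qed
  moreover have "c > 0" using l C(1) by (simp add: c_def)
  ultimately show ?thesis by blast
qed

end

section \<open>Free L-shaped regions and absence of percolation\<close>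

text \<open>
  The last selected point before the jump is below \<open>2 * T\<close>, and the next one is above \<open>40 * T\<close>.
\<close>

lemma selected_gap:
  assumes low: "(\<Sum>i\<in>{1..m}. f i) < T" and jump: "jump 40 m T j f" and j: "1 \<le> j"
    and n: "2 * T \<le> n" "n < 4 * T"
  shows "selected f \<inter> {n..10 * n} = {}"
proof -
  have J: "(\<Sum>i\<in>{m<..<m + j}. f i) < T" "40 * T < f (m + j)"
    using jump by (auto simp: jump_def)
  have out: "\<not> (n \<le> (\<Sum>i=1..l. f i) \<and> (\<Sum>i=1..l. f i) \<le> 10 * n)" for l
  proof (cases "l < m + j")
    case True
    have "(\<Sum>i=1..l. f i) \<le> (\<Sum>i\<in>{1..m} \<union> {m<..<m + j}. f i)"
      using True by (intro sum_mono2) auto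
    also have "\<dots> = (\<Sum>i\<in>{1..m}. f i) + (\<Sum>i\<in>{m<..<m + j}. f i)"
      by (intro sum.union_disjoint) auto
    finally show ?thesis using low J(1) n(1) by linarith
  next
    case False
    have "f (m + j) \<le> (\<Sum>i=1..l. f i)" using False j by (intro member_le_sum) auto
    then show ?thesis using J(2) n(2) by linarith
  qed
  have "x \<notin> {n..10 * n}" if x: "x \<in> selected f" for x
  proof -
    from x consider "x = 0" | l where "x = (\<Sum>i=1..l. f i)" unfolding selected_def by blast
    then show ?thesis
    proof cases
      case 1 then show ?thesis using low n(1) by simp
    next
      case 2 then show ?thesis using out[of l] by simp
    qed
  qed
  then show ?thesis by blast
qed

lemma dyadic_scale:
  assumes "2 ^ Suc K \<le> (n::nat)"
  obtains k where "K \<le> k" "2 * 2 ^ k \<le> n" "n < 4 * 2 ^ k"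
proof -
  have "1 \<le> n" using assms by (meson le_trans one_le_numeral one_le_power)
  then obtain e where e: "2 ^ e \<le> n" "n < 2 ^ (e + 1)" using ex_power_ivl1[of 2 n] by auto
  have "(2::nat) ^ Suc K < 2 ^ (e + 1)" using assms e(2) by linarith
  then have "Suc K < e + 1" by (rule power_less_imp_less_exp[rotated]) simp
  then obtain k where k: "e = Suc k" "K \<le> k" by (cases e) auto
  show ?thesis by (rule that[OF k(2)]) (use e k(1) in auto)
qed

lemma determined_combine:
  assumes "determined J Q" "determined J R"
  shows "determined J (\<lambda>f. P (Q f) (R f))"
proof -
  have "P (Q f) (R f) = P (Q g) (R g)" if "\<forall>i\<in>J. f i = g i" for f g
  proof -
    have "Q f = Q g" "R f = R g" using assms that unfolding determined_def by blast+
    then show ?thesis by simp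
  qed
  then show ?thesis using assms(1) unfolding determined_def by blast
qed

context prob_space
begin

lemma partial_sum_tight:
  assumes iid: "iid_seq X" and \<delta>: "0 < \<delta>"
  shows "\<exists>N. prob (seq_event X (\<lambda>f. N \<le> (\<Sum>i\<in>{1..m}. f i))) \<le> \<delta>"
proof -
  define A where "A N = seq_event X (\<lambda>f. N \<le> (\<Sum>i\<in>{1..m}. f i))" for N
  have ev: "A N \<in> events" for N
    unfolding A_def by (rule sets_seq_event[OF iid determined_sum]) auto
  have "decseq A" by (auto simp: decseq_def A_def seq_event_def)
  then have "(\<lambda>N. prob (A N)) \<longlonglongrightarrow> prob (\<Inter>N. A N)"
    using ev by (intro finite_Lim_measure_decseq) auto
  moreover have "(\<Inter>N. A N) = {}"
  proof -
    have "\<omega> \<notin> A (Suc (\<Sum>i\<in>{1..m}. X i \<omega>))" for \<omega> by (simp add: A_def seq_event_def)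
    then show ?thesis by blast
  qed
  ultimately have "(\<lambda>N. prob (A N)) \<longlonglongrightarrow> 0" by simp
  then have "eventually (\<lambda>N. prob (A N) < \<delta>) sequentially" using \<delta> by (rule order_tendstoD(2))
  then obtain N where "prob (A N) < \<delta>" by (auto simp: eventually_sequentially)
  then show ?thesis unfolding A_def by (intro exI[of _ N]) simp
qed

text \<open>
  By induction on \<open>K\<close>, using disjoint blocks of spacings.  Given the first \<open>m\<close> spacings, choose a scale in \<open>I\<close> that exceeds their sum
  except with probability \<open>\<delta>\<close>, and then a block of further spacings that contains a long jump at this scale with
  probability at least \<open>c\<close>.
\<close>

lemma no_gap_bound:
  assumes iid: "iid_seq X" and I: "infinite I" and c: "0 < c" "c \<le> 1"
    and jumps: "\<And>k. k1 \<le> k \<Longrightarrow> \<exists>J. \<forall>m. prob (seq_event X (\<lambda>f. \<exists>j\<in>{1..J}. jump 40 m (2 ^ k) j f)) \<ge> c"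
    and \<delta>: "0 < \<delta>"
  shows "\<exists>m Q. determined {1..m} Q \<and> prob (seq_event X Q) \<le> (1 - c) ^ K + real K * \<delta> \<and>
    (\<forall>f. (\<forall>n\<in>I. n0 \<le> n \<longrightarrow> selected f \<inter> {n..10 * n} \<noteq> {}) \<longrightarrow> Q f)"
proof (induction K)
  case 0
  show ?case by (intro exI[of _ 0] exI[of _ "\<lambda>_. True"]) (auto simp: determined_def)
next
  case (Suc K)
  then obtain m Q where Q: "determined {1..m} Q" "prob (seq_event X Q) \<le> (1 - c) ^ K + real K * \<delta>"
    "\<And>f. \<forall>n\<in>I. n0 \<le> n \<longrightarrow> selected f \<inter> {n..10 * n} \<noteq> {} \<Longrightarrow> Q f" by blast
  obtain N where N: "prob (seq_event X (\<lambda>f. N \<le> (\<Sum>i\<in>{1..m}. f i))) \<le> \<delta>"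
    using partial_sum_tight[OF iid \<delta>] by blast
  obtain n where n: "n \<in> I" "max n0 (2 ^ Suc (max k1 N)) \<le> n"
    using I unfolding infinite_nat_iff_unbounded_le by blast
  obtain k where k: "max k1 N \<le> k" "2 * 2 ^ k \<le> n" "n < 4 * 2 ^ k"
    using dyadic_scale[of "max k1 N" n] n(2) by auto
  obtain J where J: "\<And>m. prob (seq_event X (\<lambda>f. \<exists>j\<in>{1..J}. jump 40 m (2 ^ k) j f)) \<ge> c"
    using jumps[of k] k(1) by auto
  define E where "E f \<longleftrightarrow> (\<exists>j\<in>{1..J}. jump 40 m (2 ^ k) j f)" for f
  define S where "S f \<longleftrightarrow> 2 ^ k \<le> (\<Sum>i\<in>{1..m}. f i)" for f :: "nat \<Rightarrow> nat"
  have dE: "determined {m<..m + J} E"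
  proof -
    have "determined {m<..m + J} (jump 40 m (2 ^ k) j)" if "j \<in> {1..J}" for j
      using that by (intro determined_mono[OF determined_jump]) auto
    then have "jump 40 m (2 ^ k) j f = jump 40 m (2 ^ k) j g"
      if "j \<in> {1..J}" "\<forall>i\<in>{m<..m + J}. f i = g i" for j f g
      using that unfolding determined_def by blast
    then have "E f = E g" if "\<forall>i\<in>{m<..m + J}. f i = g i" for f g
      unfolding E_def using that by (intro bex_cong refl) blast
    then show ?thesis unfolding determined_def by auto
  qed
  then have dnE: "determined {m<..m + J} (\<lambda>f. \<not> E f)" unfolding determined_def by blast
  have dS: "determined {1..m} S" unfolding S_def by (rule determined_sum) auto
  define Q' where "Q' f \<longleftrightarrow> (Q f \<and> \<not> E f) \<or> S f" for f
  have d: "determined {1..m + J} Q" "determined {1..m + J} S" "determined {1..m + J} E"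
    by (rule determined_mono[OF Q(1)] determined_mono[OF dS] determined_mono[OF dE]; auto)+
  have dQE: "determined {1..m + J} (\<lambda>f. Q f \<and> \<not> E f)"
    by (rule determined_combine[OF d(1,3)])
  have dQ': "determined {1..m + J} Q'"
    unfolding Q'_def by (rule determined_combine[OF dQE d(2)])
  have "N < 2 ^ N" by (rule less_exp)
  also have "(2::nat) ^ N \<le> 2 ^ k" using k(1) by (intro power_increasing) auto
  finally have "N \<le> 2 ^ k" by simp
  then have "prob (seq_event X S) \<le> prob (seq_event X (\<lambda>f. N \<le> (\<Sum>i\<in>{1..m}. f i)))"
    by (intro finite_measure_mono sets_seq_event[OF iid determined_sum]) (auto simp: seq_event_def S_def)
  with N have PS: "prob (seq_event X S) \<le> \<delta>" by simp
  have "seq_event X (\<lambda>f. \<not> E f) = space M - seq_event X E" by (auto simp: seq_event_def)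
  then have pe: "prob (seq_event X (\<lambda>f. \<not> E f)) \<le> 1 - c"
    using prob_compl[OF sets_seq_event[OF iid dE]] J[of m] unfolding E_def by simp
  have "prob (seq_event X (\<lambda>f. Q f \<and> \<not> E f)) \<le> ((1 - c) ^ K + real K * \<delta>) * (1 - c)"
  proof -
    have "prob (seq_event X (\<lambda>f. Q f \<and> \<not> E f)) = prob (seq_event X Q) * prob (seq_event X (\<lambda>f. \<not> E f))"
      by (rule prob_seq_event_conj[OF iid Q(1) dnE]) auto
    also have "\<dots> \<le> ((1 - c) ^ K + real K * \<delta>) * (1 - c)"
      using Q(2) pe c \<delta> by (intro mult_mono) auto
    finally show ?thesis .
  qed
  also have "\<dots> \<le> (1 - c) ^ Suc K + real K * \<delta>"
  proof -
    have "real K * \<delta> * (1 - c) \<le> real K * \<delta> * 1" using c \<delta> by (intro mult_left_mono) auto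
    then show ?thesis by (simp add: algebra_simps)
  qed
  finally have PQ: "prob (seq_event X (\<lambda>f. Q f \<and> \<not> E f)) \<le> (1 - c) ^ Suc K + real K * \<delta>" .
  have "seq_event X Q' = seq_event X (\<lambda>f. Q f \<and> \<not> E f) \<union> seq_event X S"
    by (auto simp: seq_event_def Q'_def)
  then have "prob (seq_event X Q') \<le> prob (seq_event X (\<lambda>f. Q f \<and> \<not> E f)) + prob (seq_event X S)"
    using sets_seq_event[OF iid dQE] sets_seq_event[OF iid dS] by (simp add: measure_Un_le)
  then have PQ': "prob (seq_event X Q') \<le> (1 - c) ^ Suc K + real (Suc K) * \<delta>"
    using PQ PS by (simp add: algebra_simps)
  have "Q' f" if h: "\<forall>n\<in>I. n0 \<le> n \<longrightarrow> selected f \<inter> {n..10 * n} \<noteq> {}" for f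
  proof (rule ccontr)
    assume "\<not> Q' f"
    then have "E f" "\<not> S f" using Q(3)[OF h] by (auto simp: Q'_def)
    then obtain j where "j \<in> {1..J}" "jump 40 m (2 ^ k) j f" "(\<Sum>i\<in>{1..m}. f i) < 2 ^ k"
      by (auto simp: E_def S_def)
    then have "selected f \<inter> {n..10 * n} = {}"
      using selected_gap[of f m "2 ^ k" j n] k(2,3) by auto
    then show False using h n by auto
  qed
  then show ?case using dQ' PQ' by blast
qed

theorem infinitely_many_gaps:
  assumes iid: "iid_seq X" and rv: "regularly_varying (tail X) \<alpha>" and \<alpha>: "\<alpha> < 1" and I: "infinite I"
  shows "AE \<omega> in M. \<forall>n0. \<exists>n\<in>I. n0 \<le> n \<and> selected (\<lambda>k. X k \<omega>) \<inter> {n..10 * n} = {}"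
proof -
  obtain c k1 where c: "0 < c" and jumps:
    "\<And>k. k1 \<le> k \<Longrightarrow> \<exists>J. \<forall>m. prob (seq_event X (\<lambda>f. \<exists>j\<in>{1..J}. jump 40 m (2 ^ k) j f)) \<ge> c"
    using jump_probability[OF iid rv \<alpha>, of 40] by auto
  have c1: "c \<le> 1" using jumps[of k1] prob_le_1 order_trans by blast
  have mem: "{\<omega> \<in> space M. v \<in> selected (\<lambda>k. X k \<omega>)} \<in> events" for v
    using measurable_sets[OF measurable_selected[OF iid_measurable[OF iid]] mem_set_algebra[of v]]
    by (simp add: vimage_def Int_def conj_commute)
  have [measurable]: "Measurable.pred M (\<lambda>\<omega>. v \<in> selected (\<lambda>k. X k \<omega>))" for v
    using mem[of v] by (simp add: pred_def)
  have "AE \<omega> in M. \<exists>n\<in>I. n0 \<le> n \<and> selected (\<lambda>k. X k \<omega>) \<inter> {n..10 * n} = {}" for n0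
  proof -
    define B where "B = {\<omega> \<in> space M. \<forall>n\<in>I. n0 \<le> n \<longrightarrow> (\<exists>v\<in>{n..10 * n}. v \<in> selected (\<lambda>k. X k \<omega>))}"
    have B: "B \<in> events" unfolding B_def by measurable
    have bound: "prob B \<le> (1 - c) ^ K + real K * \<delta>" if \<delta>: "0 < \<delta>" for K \<delta>
    proof -
      obtain m Q where Q: "determined {1..m} Q" "prob (seq_event X Q) \<le> (1 - c) ^ K + real K * \<delta>"
        "\<And>f. \<forall>n\<in>I. n0 \<le> n \<longrightarrow> selected f \<inter> {n..10 * n} \<noteq> {} \<Longrightarrow> Q f"
        using no_gap_bound[where K = K and ?n0.0 = n0, OF iid I c c1 jumps \<delta>] by blast
      have "B \<subseteq> seq_event X Q"
      proof
        fix \<omega> assume w: "\<omega> \<in> B"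
        then have "Q (\<lambda>k. X k \<omega>)" by (intro Q(3)) (auto simp: B_def)
        then show "\<omega> \<in> seq_event X Q" using w by (simp add: B_def seq_event_def)
      qed
      then have "prob B \<le> prob (seq_event X Q)"
        by (intro finite_measure_mono sets_seq_event[OF iid Q(1)])
      with Q(2) show ?thesis by simp
    qed
    have "prob B \<le> (1 - c) ^ K" for K
    proof (rule field_le_epsilon)
      fix e :: real assume e: "0 < e"
      have "real K * (e / (real K + 1)) \<le> e" using e by (simp add: field_simps)
      then show "prob B \<le> (1 - c) ^ K + e" using bound[of "e / (real K + 1)" K] e by simp
    qed
    moreover have "(\<lambda>K. (1 - c) ^ K) \<longlonglongrightarrow> 0"
      using c c1 by (intro LIMSEQ_power_zero) simp
    ultimately have "prob B \<le> 0" by (intro LIMSEQ_le_const) auto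
    then have "B \<in> null_sets M" using B by (simp add: null_sets_def emeasure_eq_measure measure_le_0_iff)
    then show ?thesis by (rule AE_I') (auto simp: B_def)
  qed
  then show ?thesis by (simp add: AE_all_countable)
qed

lemma infinitely_many_gaps_law:
  assumes iid: "iid_seq X" and rv: "regularly_varying (tail X) \<alpha>" and \<alpha>: "\<alpha> < 1" and I: "infinite I"
  shows "AE C in selected_law M X. \<forall>n0. \<exists>n\<in>I. n0 \<le> n \<and> C \<inter> {n..10 * n} = {}"
proof -
  have [measurable]: "Measurable.pred set_algebra (\<lambda>A :: nat set. v \<in> A)" for v
    using mem_set_algebra[of v] by (simp add: pred_def)
  have eq: "C \<inter> {n..10 * n} = {} \<longleftrightarrow> (\<forall>v\<in>{n..10 * n}. v \<notin> C)" for C and n :: nat by blast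
  show ?thesis
    unfolding selected_law_def
  proof (subst AE_distr_iff)
    show "(\<lambda>\<omega>. selected (\<lambda>k. X k \<omega>)) \<in> measurable M set_algebra"
      by (rule measurable_selected[OF iid_measurable[OF iid]])
    show "{C \<in> space set_algebra. \<forall>n0. \<exists>n\<in>I. n0 \<le> n \<and> C \<inter> {n..10 * n} = {}} \<in> sets set_algebra"
      unfolding eq by measurable
  qed (rule infinitely_many_gaps[OF assms])
qed

end

lemma measurable_Times:
  "(\<lambda>(C, R). C \<times> R) \<in> measurable (set_algebra \<Otimes>\<^sub>M set_algebra) (set_algebra :: (nat \<times> nat) set measure)"
proof (rule measurable_set_algebraI)
  fix v :: "nat \<times> nat"
  have "{x \<in> space (set_algebra \<Otimes>\<^sub>M set_algebra). v \<in> (case x of (C, R) \<Rightarrow> C \<times> R)} =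
      {A. fst v \<in> A} \<times> {A. snd v \<in> A}"
    by (auto simp: space_pair_measure mem_Times_iff)
  then show "{x \<in> space (set_algebra \<Otimes>\<^sub>M set_algebra). v \<in> (case x of (C, R) \<Rightarrow> C \<times> R)}
      \<in> sets (set_algebra \<Otimes>\<^sub>M set_algebra)"
    by (simp add: mem_set_algebra)
qed

definition L_free :: "(nat \<times> nat) set \<Rightarrow> nat \<Rightarrow> bool" where
  "L_free \<Xi> n \<longleftrightarrow> (\<forall>v\<in>{v. n \<le> fst v \<and> fst v \<le> 10 * n \<or> n \<le> snd v \<and> snd v \<le> 10 * n}. v \<notin> \<Xi>)"

text \<open>
  By Fubini, almost every realisation of the columns can be fixed; the rows are then required to have gaps along the infinite set
  of scales at which the columns do.
\<close>

theorem infinitely_many_free_regions: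
  fixes M :: "'a measure"
  assumes "prob_space M" and iid: "prob_space.iid_seq M X" "prob_space.iid_seq M Y"
    and rv: "regularly_varying (prob_space.tail M X) \<alpha>" "regularly_varying (prob_space.tail M Y) \<beta>"
    and \<alpha>: "\<alpha> < 1" "\<beta> < 1" and I: "infinite I"
  shows "AE \<Xi> in env_law M X Y. \<forall>n0. \<exists>n\<in>I. n0 \<le> n \<and> L_free \<Xi> n"
proof -
  interpret M: prob_space M by fact
  interpret X: prob_space "selected_law M X" by (rule M.prob_space_selected_law[OF iid(1)])
  interpret Y: prob_space "selected_law M Y" by (rule M.prob_space_selected_law[OF iid(2)])
  interpret XY: pair_sigma_finite "selected_law M X" "selected_law M Y" ..
  have sets: "sets (selected_law M Z) = sets set_algebra" for Z :: "nat \<Rightarrow> 'a \<Rightarrow> nat"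
    by (simp add: selected_law_def)
  have meas: "(\<lambda>(C, R). C \<times> R) \<in> measurable (selected_law M X \<Otimes>\<^sub>M selected_law M Y) (set_algebra :: (nat \<times> nat) set measure)"
    using measurable_Times by (simp add: sets cong: measurable_cong_sets sets_pair_measure_cong)
  let ?P = "\<lambda>\<Xi>. \<forall>n0. \<exists>n\<in>I. n0 \<le> n \<and> L_free \<Xi> n"
  have [measurable]: "Measurable.pred set_algebra (\<lambda>A :: (nat \<times> nat) set. v \<in> A)" for v
    using mem_set_algebra[of v] by (simp add: pred_def)
  have P: "{\<Xi> \<in> space set_algebra. ?P \<Xi>} \<in> sets set_algebra"
    unfolding L_free_def by measurable
  have step: "AE R in selected_law M Y. ?P (C \<times> R)"
    if C: "\<forall>n0. \<exists>n\<in>I. n0 \<le> n \<and> C \<inter> {n..10 * n} = {}" for C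
  proof -
    let ?I = "{n \<in> I. C \<inter> {n..10 * n} = {}}"
    have "infinite ?I" unfolding infinite_nat_iff_unbounded_le using C by auto
    from M.infinitely_many_gaps_law[OF iid(2) rv(2) \<alpha>(2) this]
    show ?thesis
    proof eventually_elim
      case (elim R)
      show ?case
      proof
        fix n0
        obtain n where n: "n \<in> I" "n0 \<le> n" "C \<inter> {n..10 * n} = {}" "R \<inter> {n..10 * n} = {}"
          using elim by blast
        have "L_free (C \<times> R) n" unfolding L_free_def using n(3,4) by fastforce
        then show "\<exists>n\<in>I. n0 \<le> n \<and> L_free (C \<times> R) n" using n by auto
      qed
    qed
  qed
  have "AE x in selected_law M X \<Otimes>\<^sub>M selected_law M Y. ?P (case x of (C, R) \<Rightarrow> C \<times> R)"
  proof (rule XY.AE_pair_measure)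
    show "{x \<in> space (selected_law M X \<Otimes>\<^sub>M selected_law M Y). ?P (case x of (C, R) \<Rightarrow> C \<times> R)}
        \<in> sets (selected_law M X \<Otimes>\<^sub>M selected_law M Y)"
    proof -
      have "{x \<in> space (selected_law M X \<Otimes>\<^sub>M selected_law M Y). ?P (case x of (C, R) \<Rightarrow> C \<times> R)} =
          (\<lambda>(C, R). C \<times> R) -` {\<Xi> \<in> space set_algebra. ?P \<Xi>} \<inter> space (selected_law M X \<Otimes>\<^sub>M selected_law M Y)"
        unfolding space_set_algebra by blast
      then show ?thesis using measurable_sets[OF meas P] by (simp only:)
    qed
    have "AE C in selected_law M X. AE R in selected_law M Y. ?P (C \<times> R)"
      using M.infinitely_many_gaps_law[OF iid(1) rv(1) \<alpha>(1) I] by eventually_elim (rule step)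
    then show "AE C in selected_law M X. AE R in selected_law M Y. ?P (case (C, R) of (C, R) \<Rightarrow> C \<times> R)"
      by simp
  qed
  then show ?thesis
    unfolding env_law_def by (subst AE_distr_iff[OF meas P])
qed

theorem theorem2:
  fixes M :: "'a measure"
    and \<xi>x \<xi>y :: "nat \<Rightarrow> 'a \<Rightarrow> nat"
    and \<alpha>x \<alpha>y :: real
  assumes "prob_space M"
    and "prob_space.iid_seq M \<xi>x"
    and "prob_space.iid_seq M \<xi>y"
    and "prob_space.indep_seqs M \<xi>x \<xi>y"
    and "regularly_varying (\<lambda>t. measure M {\<omega> \<in> space M. real (\<xi>x 1 \<omega>) > t}) \<alpha>x"
    and "regularly_varying (\<lambda>t. measure M {\<omega> \<in> space M. real (\<xi>y 1 \<omega>) > t}) \<alpha>y"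
    and "0 < \<alpha>x" "\<alpha>x < 1" "0 < \<alpha>y" "\<alpha>y < 1"
  shows "\<forall>\<epsilon>. 0 < \<epsilon> \<and> \<epsilon> \<le> 1 - p_c \<longrightarrow>
    (AE \<Xi> in env_law M \<xi>x \<xi>y. measure (percolation \<Xi> (p_c + \<epsilon>) p_c) percolates = 0)"
proof (intro allI impI)
  fix \<epsilon> :: real assume \<epsilon>: "0 < \<epsilon> \<and> \<epsilon> \<le> 1 - p_c"
  obtain c where c: "c > 0" "\<And>n0. \<exists>n\<ge>n0. 1 \<le> n \<and> pr (\<lambda>_. p_c) (lr 0 (9 * n) 0 (10 * n)) \<le> 1 - c"
    using critical_near_squares by blast
  define I where "I = {n::nat. 1 \<le> n \<and> pr (\<lambda>_. p_c) (lr 0 (9 * int n) 0 (10 * int n)) \<le> 1 - c}"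
  have "infinite I" unfolding infinite_nat_iff_unbounded_le
  proof
    fix m
    obtain n where n: "int m \<le> n" "1 \<le> n" "pr (\<lambda>_. p_c) (lr 0 (9 * n) 0 (10 * n)) \<le> 1 - c"
      using c(2) by blast
    then show "\<exists>n\<ge>m. n \<in> I" by (intro exI[of _ "nat n"]) (auto simp: I_def)
  qed
  have tails: "prob_space.tail M \<xi>x = (\<lambda>t. measure M {\<omega> \<in> space M. real (\<xi>x 1 \<omega>) > t})"
    "prob_space.tail M \<xi>y = (\<lambda>t. measure M {\<omega> \<in> space M. real (\<xi>y 1 \<omega>) > t})"
    by (simp_all add: prob_space.tail_def[OF assms(1)] fun_eq_iff)
  have "AE \<Xi> in env_law M \<xi>x \<xi>y. \<forall>n0. \<exists>n\<in>I. n0 \<le> n \<and> L_free \<Xi> n"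
    by (rule infinitely_many_free_regions[OF assms(1-3) _ _ assms(8,10) \<open>infinite I\<close>])
      (use assms(5,6) tails in simp_all)
  then show "AE \<Xi> in env_law M \<xi>x \<xi>y. measure (percolation \<Xi> (p_c + \<epsilon>) p_c) percolates = 0"
  proof (rule AE_mp, intro AE_I2 impI)
    fix \<Xi> assume free: "\<forall>n0. \<exists>n\<in>I. n0 \<le> n \<and> L_free \<Xi> n"
    show "measure (percolation \<Xi> (p_c + \<epsilon>) p_c) percolates = 0"
    proof (rule no_percolation_if_L_regions_free[OF _ _ p_c_set(3,4) c(1)])
      fix n0 :: int
      obtain n where n: "n \<in> I" "nat n0 \<le> n" "L_free \<Xi> n" using free by blast
      have "emb v \<notin> L_region (int n)" if "v \<in> \<Xi>" for v
      proof -
        have "\<not> (n \<le> fst v \<and> fst v \<le> 10 * n)" "\<not> (n \<le> snd v \<and> snd v \<le> 10 * n)"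
          using n(3) that unfolding L_free_def by blast+
        then show ?thesis unfolding L_region_def Un_iff mem_rect emb_def fst_conv snd_conv by linarith
      qed
      then have "emb ` \<Xi> \<inter> L_region (int n) = {}" by blast
      then show "\<exists>n\<ge>n0. 1 \<le> n \<and> pr (\<lambda>_. p_c) (lr 0 (9 * n) 0 (10 * n)) \<le> 1 - c \<and> emb ` \<Xi> \<inter> L_region n = {}"
        using n(1,2) by (intro exI[of _ "int n"]) (auto simp: I_def)
    qed (use \<epsilon> p_c_set(3) in auto)
  qed
qed

end
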